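(* Fix integers $I,J\ge 1$, reals $\beta_1,\beta_2>0$ with $\beta_1\ne\beta_2$, and $A,B>0$. For large $L$ let $q=q_L$, $\alpha=\alpha_L$ be defined by $$q=e^{\frac{\beta_1-\beta_2}{L}},\qquad \frac{1+\alpha q^J}{1+\alpha}=e^{-\frac{J\beta_2}{L}},$$ and let $H=H_L$ be the height function of the stochastic higher spin six vertex (SHS6V) model with parameters $q,\alpha,\nu=q^{-I}$. Set $\mathfrak q=e^{\beta_1-\beta_2}$. Let $\chi$ and $\psi$ be two monotone Lipschitz functions (on $[0,A]$ and $[0,B]$ respectively). Suppose that the boundary data of the SHS6V model are chosen (depending on $L$) so that, as $L\to\infty$, $\frac1L H(Lx,0)\to\chi(x)$ and $\frac1L H(0,Ly)\to\psi(y)$ uniformly in probability for $x\in[0,A]$ and $y\in[0,B]$. Then, as $L\to\infty$, $$\frac1L\sup_{(x,y)\in[0,A]\times[0,B]}\big|H(Lx,Ly)-L\,\mathbf h(x,y)\big|\to 0\quad\text{in probability},$$ where $\mathfrak q^{\mathbf h(x,y)}$ is the unique solution to the telegraph equation $$\frac{\partial^2}{\partial x\partial y}\mathfrak q^{\mathbf h(x,y)}+J\beta_2\frac{\partial}{\partial x}\mathfrak q^{\mathbf h(x,y)}+I\beta_1\frac{\partial}{\partial y}\mathfrak q^{\mathbf h(x,y)}=0$$ with boundary condition $\mathfrak q^{\mathbf h(x,0)}=\mathfrak q^{\chi(x)}$ and $\mathfrak q^{\mathbf h(0,y)}=\mathfrak q^{\psi(y)}$.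
   Context: $q$-Pochhammer symbols: $(a;q)_n=\prod_{k=0}^{n-1}(1-aq^k)$ for $n\ge0$ and $(a;q)_n=\prod_{k=1}^{-n}(1-aq^{-k})^{-1}$ for $n<0$. Regularized terminating basic hypergeometric series: $${}_{r+1}\bar\phi_r\Big(\begin{matrix}q^{-n};a_1,\dots,a_r\\ b_1,\dots,b_r\end{matrix}\Big|q,z\Big)=\sum_{k=0}^n z^k\frac{(q^{-n};q)_k}{(q;q)_k}\prod_{i=1}^r(a_i;q)_k(b_iq^k;q)_{n-k}.$$ Vertex weights. Let $\nu=q^{-I}$. The matrix $L^{(J)}_\alpha$, with rows and columns indexed by $\{0,\dots,I\}\times\{0,\dots,J\}$, is $$L^{(J)}_\alpha(i_1,j_1;i_2,j_2)=\mathbf 1_{\{i_1+j_1=i_2+j_2\}}\,q^{\frac{2j_1-j_1^2}{4}-\frac{2j_2-j_2^2}{4}+\frac{i_2^2+i_1^2}{4}+\frac{i_2(j_2-1)+i_1j_1}{2}}\,\frac{\nu^{j_1-i_2}\alpha^{j_2-j_1+i_2}(-\alpha\nu^{-1};q)_{j_2-i_1}}{(q;q)_{i_2}(-\alpha;q)_{i_2+j_2}(q^{J+1-j_1};q)_{j_1-j_2}}\;{}_4\bar\phi_3\Big(\begin{matrix}q^{-i_2};q^{-i_1},-\alpha q^J,-q\nu\alpha^{-1}\\ \nu,\,q^{1+j_2-i_1},\,q^{J+1-i_2-j_2}\end{matrix}\Big|q,q\Big).$$ It is stochastic (nonnegative entries, rows summing to 1) if $q\in(0,1)$, $\alpha<-q^{-I-J+1}$,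 or if $q>1$, $-q^{-I-J+1}<\alpha<0$; under the scaling in the claim one of these holds for all sufficiently large $L$. SHS6V model. Boundary data are $v_{x,0}\in\{0,\dots,I\}$ $(x\in\mathbb Z_{\ge0})$ and $h_{0,y}\in\{0,\dots,J\}$ $(y\in\mathbb Z_{\ge0})$. Going through the vertices $(x,y)\in\mathbb Z_{\ge0}^2$ sequentially along the successive diagonals $x+y=\text{const}$, given the numbers $v_{x,y}$ and $h_{x,y}$ of lines entering $(x,y)$ from the bottom and from the left, one samples the numbers $(v_{x,y+1},h_{x+1,y})$ of lines leaving to the top and to the right with probability $L^{(J)}_\alpha(v_{x,y},h_{x,y};\,\cdot,\cdot)$, independently of everything else given $(v_{x,y},h_{x,y})$. The height function is $$H(x,y)=\sum_{j=1}^y h_{0,j-1}-\sum_{i=1}^x v_{i-1,y},\qquad x,y\in\mathbb Z_{\ge0},$$ so $H(0,0)=0$, $H(x+1,y)-H(x,y)=-v_{x,y}$, $H(x,y+1)-H(x,y)=h_{x,y}$. It is extended to $\mathbb R_{\ge0}^2$ by linear interpolation first in the $x$-direction, then in the $y$-direction. Meaning of the equation. For Lipschitz boundary data the telegraph equation $u_{xy}+J\beta_2u_x+I\beta_1u_y=0$ is understood in integrated form: $u$ is continuous and for all $(X,Y)\in[0,A]\times[0,B]$ $$u(X,Y)-u(X,0)-u(0,Y)+u(0,0)+I\beta_1\int_0^X\big(u(x,Y)-u(x,0)\big)dx+J\beta_2\int_0^Y\big(u(X,y)-u(0,y)\big)dy=0.$$ *)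

theory Defs
  imports "HOL-Probability.Probability"
begin

section \<open>Vertex weights\<close>

definition qpoch :: "real \<Rightarrow> real \<Rightarrow> int \<Rightarrow> real" where
  "qpoch a q n =
    (if n \<ge> 0 then \<Prod>k<nat n. 1 - a * q ^ k
     else \<Prod>k=1..nat (- n). inverse (1 - a * q powi (- int k)))"

text \<open>
  The regularized terminating series with first upper parameter \<open>q powi (- n)\<close>; \<open>as\<close> and \<open>bs\<close>
  (of equal length) list the remaining upper and the lower parameters.
\<close>

definition qhyp_reg :: "nat \<Rightarrow> real list \<Rightarrow> real list \<Rightarrow> real \<Rightarrow> real \<Rightarrow> real" where
  "qhyp_reg n as bs q z =
    (\<Sum>k\<le>n. z ^ k * (qpoch (q powi (- int n)) q k / qpoch q q k) *
       (\<Prod>(a, b)\<leftarrow>zip as bs. qpoch a q k * qpoch (b * q ^ k) q (int n - int k)))"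

text \<open>
  \<open>i1\<close>, \<open>j1\<close> are the numbers of lines entering from the bottom and from the left,
  \<open>i2\<close>, \<open>j2\<close> those leaving to the top and to the right. Integer exponents use \<open>powi\<close> because
  \<open>\<alpha>\<close> is negative in the stochastic range; the quarter-integer power of \<open>q > 0\<close> uses \<open>powr\<close>.
\<close>

definition vertex_weight ::
    "nat \<Rightarrow> nat \<Rightarrow> real \<Rightarrow> real \<Rightarrow> nat \<Rightarrow> nat \<Rightarrow> nat \<Rightarrow> nat \<Rightarrow> real" where
  "vertex_weight I J q \<alpha> i1 j1 i2 j2 =
    (let \<nu> = q powi (- int I) in
     if i1 + j1 = i2 + j2 then
       q powr ((2 * real j1 - (real j1)\<^sup>2) / 4 - (2 * real j2 - (real j2)\<^sup>2) / 4
               + ((real i2)\<^sup>2 + (real i1)\<^sup>2) / 4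
               + (real i2 * (real j2 - 1) + real i1 * real j1) / 2)
       * (\<nu> powi (int j1 - int i2) * \<alpha> powi (int j2 - int j1 + int i2)
            * qpoch (- \<alpha> * inverse \<nu>) q (int j2 - int i1)
          / (qpoch q q i2 * qpoch (- \<alpha>) q (int i2 + int j2)
            * qpoch (q powi (int J + 1 - int j1)) q (int j1 - int j2)))
       * qhyp_reg i2
           [q powi (- int i1), - \<alpha> * q ^ J, - q * \<nu> * inverse \<alpha>]
           [\<nu>, q powi (1 + int j2 - int i1), q powi (int J + 1 - int i2 - int j2)] q q
     else 0)"


section \<open>The stochastic higher spin six vertex model\<close>

text \<open>
  \<open>V x y\<close> and \<open>E x y\<close> are the numbers of lines entering the vertex \<open>(x, y)\<close> from the bottom and
  from the left, so that \<open>V x (Suc y)\<close> and \<open>E (Suc x) y\<close> are the numbers of lines leaving it.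
  \<open>history\<close> is generated by all boundary data \<open>V a 0\<close>, \<open>E 0 b\<close> and by the outputs of all vertices
  \<open>(a, b) \<noteq> (x, y)\<close> with \<open>a + b \<le> x + y\<close>; including the other vertices on the same diagonal
  makes the outputs along a diagonal conditionally independent.
\<close>

definition history ::
    "'a measure \<Rightarrow> (nat \<Rightarrow> nat \<Rightarrow> 'a \<Rightarrow> nat) \<Rightarrow> (nat \<Rightarrow> nat \<Rightarrow> 'a \<Rightarrow> nat) \<Rightarrow> nat \<Rightarrow> nat \<Rightarrow> 'a measure" where
  "history M V E x y = sigma (space M)
    ({V a b -` {k} \<inter> space M | a b k.
        b = 0 \<or> (a + b \<le> Suc (x + y) \<and> (a, b) \<noteq> (x, Suc y))} \<union>
     {E a b -` {k} \<inter> space M | a b k.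
        a = 0 \<or> (a + b \<le> Suc (x + y) \<and> (a, b) \<noteq> (Suc x, y))})"

text \<open>The boundary data may be random, with an arbitrary joint law.\<close>

locale shs6v = prob_space M for M :: "'a measure" +
  fixes I J :: nat and q \<alpha> :: real
    and V E :: "nat \<Rightarrow> nat \<Rightarrow> 'a \<Rightarrow> nat"
  assumes V_measurable: "\<And>x y. V x y \<in> measurable M (count_space {..I})"
    and E_measurable: "\<And>x y. E x y \<in> measurable M (count_space {..J})"
    and transition: "\<And>x y i j. i \<le> I \<Longrightarrow> j \<le> J \<Longrightarrow>
      AE \<omega> in M.
        real_cond_exp M (history M V E x y)
          (indicator {\<omega> \<in> space M. V x (Suc y) \<omega> = i \<and> E (Suc x) y \<omega> = j}) \<omega>
        = vertex_weight I J q \<alpha> (V x y \<omega>) (E x y \<omega>) i j"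

definition height :: "(nat \<Rightarrow> nat \<Rightarrow> nat) \<Rightarrow> (nat \<Rightarrow> nat \<Rightarrow> nat) \<Rightarrow> nat \<Rightarrow> nat \<Rightarrow> real" where
  "height v e x y = (\<Sum>j=1..y. real (e 0 (j - 1))) - (\<Sum>i=1..x. real (v (i - 1) y))"

definition lin_interp :: "(nat \<Rightarrow> real) \<Rightarrow> real \<Rightarrow> real" where
  "lin_interp f x = (1 - frac x) * f (nat \<lfloor>x\<rfloor>) + frac x * f (Suc (nat \<lfloor>x\<rfloor>))"

definition height_ext ::
    "(nat \<Rightarrow> nat \<Rightarrow> nat) \<Rightarrow> (nat \<Rightarrow> nat \<Rightarrow> nat) \<Rightarrow> real \<Rightarrow> real \<Rightarrow> real" where
  "height_ext v e x y = lin_interp (\<lambda>n. lin_interp (\<lambda>m. height v e m n) x) y"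


section \<open>Convergence in probability\<close>

text \<open>The limit is deterministic, so each \<open>X L\<close> may live on its own probability space \<open>M L\<close>.\<close>

definition tendsto_in_prob ::
    "('i \<Rightarrow> 'a measure) \<Rightarrow> ('i \<Rightarrow> 'a \<Rightarrow> real) \<Rightarrow> real \<Rightarrow> 'i filter \<Rightarrow> bool" where
  "tendsto_in_prob M X c F \<longleftrightarrow>
    (\<forall>\<^sub>F L in F. X L \<in> borel_measurable (M L)) \<and>
    (\<forall>\<epsilon>>0. ((\<lambda>L. measure (M L) {\<omega> \<in> space (M L). \<bar>X L \<omega> - c\<bar> > \<epsilon>}) \<longlongrightarrow> 0) F)"


section \<open>The telegraph equation\<close>

text \<open>Integrated form of \<open>u\<^sub>x\<^sub>y + b u\<^sub>x + a u\<^sub>y = 0\<close>.\<close>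

definition telegraph_solution ::
    "real \<Rightarrow> real \<Rightarrow> real \<Rightarrow> real \<Rightarrow> (real \<Rightarrow> real \<Rightarrow> real) \<Rightarrow> bool" where
  "telegraph_solution a b A B u \<longleftrightarrow>
    continuous_on ({0..A} \<times> {0..B}) (\<lambda>(x, y). u x y) \<and>
    (\<forall>X\<in>{0..A}. \<forall>Y\<in>{0..B}.
       u X Y - u X 0 - u 0 Y + u 0 0
       + a * integral {0..X} (\<lambda>x. u x Y - u x 0)
       + b * integral {0..Y} (\<lambda>y. u X y - u 0 y) = 0)"

definition telegraph_bvp ::
    "real \<Rightarrow> real \<Rightarrow> real \<Rightarrow> real \<Rightarrow> (real \<Rightarrow> real) \<Rightarrow> (real \<Rightarrow> real) \<Rightarrow> (real \<Rightarrow> real \<Rightarrow> real) \<Rightarrow> bool" where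
  "telegraph_bvp a b A B f g u \<longleftrightarrow>
    telegraph_solution a b A B u \<and>
    (\<forall>x\<in>{0..A}. u x 0 = f x) \<and> (\<forall>y\<in>{0..B}. u 0 y = g y)"

end

theory Submission
  imports Defs
begin

text \<open>
  With \<open>u = \<qq> powr (H / L)\<close>, the mixed second difference of \<open>u\<close> around a vertex plus \<open>J \<beta>\<^sub>2 / L\<close>
  and \<open>I \<beta>\<^sub>1 / L\<close> times its first differences has conditional mean and conditional second
  moment \<open>o(1 / L\<^sup>2)\<close>. No exact \<open>q\<close>-series identity is needed for this: the \<open>k\<close>-th term of the
  hypergeometric sum in the weight \<open>(i\<^sub>1, j\<^sub>1; i\<^sub>2, j\<^sub>2)\<close> has order \<open>L powi (2 k - i\<^sub>1 - i\<^sub>2)\<close>, so to first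
  order a line is gained or lost vertically at rates \<open>(I - i\<^sub>1) j\<^sub>1 \<beta>\<^sub>1\<close> and \<open>i\<^sub>1 (J - j\<^sub>1) \<beta>\<^sub>2\<close>, while
  nonnegativity and row sums are read off from the conditional probabilities. Summing over the
  vertices of a rectangle and using Chebyshev's inequality, \<open>u\<close> satisfies the integrated telegraph
  equation up to a small error with high probability; \<open>u\<close> being uniformly Lipschitz, this holds
  simultaneously for all rectangles. The integrated equation is stable, by Gronwall's argument, which
  gives uniqueness and convergence. It also gives existence and positivity of the solution, as a
  uniform limit of realisations of \<open>u\<close>.
\<close>

section \<open>Stability of the integrated telegraph equation\<close>

text \<open>Exponentiating the height is what closes the equation. The drift of the height itself at
  a vertex with inputs \<open>a\<close>, \<open>b\<close> contains the product \<open>a * b\<close>,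
  whose macroscopic value would require knowledge of local equilibria. For \<open>u\<close> this
  product is cancelled by the second-order term of the mixed difference, since
  \<open>\<beta>\<^sub>1 - \<beta>\<^sub>2\<close> is the logarithm of \<open>\<qq>\<close>. The
  scaled mean therefore tends to 0 for every input pair separately, and no averaging over local
  states is needed. The weights that leave the vertical line count unchanged are never expanded. A
  stochastic row expresses them as one minus the others; the defect of an unchanged count is already
  of order 1/L^2, and a change is charged with a difference of order 1/L, so the remaining weights
  matter only to first order. The second moment of the sum involves about L^4 pairs of distinct
  vertices. Each pair costs an absolute moment O(1/L^2) times a conditional mean o(1/L^2), which is
  just enough.\<close>

definition telegraph_residual :: "real \<Rightarrow> real \<Rightarrow> (real \<Rightarrow> real \<Rightarrow> real) \<Rightarrow> real \<Rightarrow> real \<Rightarrow> real" where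
  "telegraph_residual a b u X Y = u X Y - u X 0 - u 0 Y + u 0 0
     + a * integral {0..X} (\<lambda>x. u x Y - u x 0) + b * integral {0..Y} (\<lambda>y. u X y - u 0 y)"

text \<open>One tolerance covers the residual and both boundary conditions: exact solutions have
  tolerance 0, random profiles a small one. A single stability estimate then serves uniqueness,
  existence and convergence.\<close>

definition telegraph_approx ::
    "real \<Rightarrow> real \<Rightarrow> real \<Rightarrow> real \<Rightarrow> (real \<Rightarrow> real) \<Rightarrow> (real \<Rightarrow> real) \<Rightarrow> real \<Rightarrow> (real \<Rightarrow> real \<Rightarrow> real) \<Rightarrow> bool" where
  "telegraph_approx a b A B f g \<epsilon> u \<longleftrightarrow>
    continuous_on ({0..A} \<times> {0..B}) (\<lambda>(x, y). u x y) \<and>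
    (\<forall>X\<in>{0..A}. \<forall>Y\<in>{0..B}. \<bar>telegraph_residual a b u X Y\<bar> \<le> \<epsilon>) \<and>
    (\<forall>x\<in>{0..A}. \<bar>u x 0 - f x\<bar> \<le> \<epsilon>) \<and> (\<forall>y\<in>{0..B}. \<bar>u 0 y - g y\<bar> \<le> \<epsilon>)"

lemma telegraph_approx_0_iff:
  "telegraph_approx a b A B f g 0 u \<longleftrightarrow> telegraph_bvp a b A B f g u"
  by (auto simp: telegraph_approx_def telegraph_bvp_def telegraph_solution_def telegraph_residual_def)

lemma continuous_on_slices:
  fixes u :: "real \<Rightarrow> real \<Rightarrow> real"
  assumes "continuous_on ({0..A} \<times> {0..B}) (\<lambda>(x, y). u x y)"
  shows "Y \<in> {0..B} \<Longrightarrow> S \<subseteq> {0..A} \<Longrightarrow> continuous_on S (\<lambda>x. u x Y)"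
    and "X \<in> {0..A} \<Longrightarrow> T \<subseteq> {0..B} \<Longrightarrow> continuous_on T (\<lambda>y. u X y)"
proof -
  show "continuous_on S (\<lambda>x. u x Y)" if "Y \<in> {0..B}" "S \<subseteq> {0..A}"
    by (rule continuous_on_compose2[OF assms, of S "\<lambda>x. (x, Y)", simplified])
      (use that in \<open>auto intro!: continuous_intros\<close>)
  show "continuous_on T (\<lambda>y. u X y)" if "X \<in> {0..A}" "T \<subseteq> {0..B}"
    by (rule continuous_on_compose2[OF assms, of T "\<lambda>y. (X, y)", simplified])
      (use that in \<open>auto intro!: continuous_intros\<close>)
qed

lemma telegraph_integrable:
  fixes u :: "real \<Rightarrow> real \<Rightarrow> real"
  assumes "continuous_on ({0..A} \<times> {0..B}) (\<lambda>(x, y). u x y)" "X \<in> {0..A}" "Y \<in> {0..B}"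
  shows "(\<lambda>x. u x Y - u x 0) integrable_on {0..X}" "(\<lambda>y. u X y - u 0 y) integrable_on {0..Y}"
  using assms(2,3)
  by (auto intro!: integrable_continuous_real continuous_on_diff continuous_on_slices[OF assms(1)])

lemma telegraph_residual_diff:
  assumes "continuous_on ({0..A} \<times> {0..B}) (\<lambda>(x, y). u x y)"
    and "continuous_on ({0..A} \<times> {0..B}) (\<lambda>(x, y). v x y)"
    and "X \<in> {0..A}" "Y \<in> {0..B}"
  shows "telegraph_residual a b (\<lambda>x y. u x y - v x y) X Y =
    telegraph_residual a b u X Y - telegraph_residual a b v X Y"
proof -
  have "integral {0..X} (\<lambda>x. (u x Y - v x Y) - (u x 0 - v x 0)) =
      integral {0..X} (\<lambda>x. u x Y - u x 0) - integral {0..X} (\<lambda>x. v x Y - v x 0)"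
    by (subst integral_diff[symmetric])
      (auto intro!: telegraph_integrable[OF assms(1,3,4)] telegraph_integrable[OF assms(2,3,4)]
        arg_cong2[where f = integral])
  moreover have "integral {0..Y} (\<lambda>y. (u X y - v X y) - (u 0 y - v 0 y)) =
      integral {0..Y} (\<lambda>y. u X y - u 0 y) - integral {0..Y} (\<lambda>y. v X y - v 0 y)"
    by (subst integral_diff[symmetric])
      (auto intro!: telegraph_integrable[OF assms(1,3,4)] telegraph_integrable[OF assms(2,3,4)]
        arg_cong2[where f = integral])
  ultimately show ?thesis
    unfolding telegraph_residual_def by (simp only: right_diff_distrib)
qed

lemma integral_abs_le:
  fixes f g :: "real \<Rightarrow> real"
  assumes "f integrable_on {0..X}" "g integrable_on {0..X}" "\<And>x. x \<in> {0..X} \<Longrightarrow> \<bar>f x\<bar> \<le> g x"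
  shows "\<bar>integral {0..X} f\<bar> \<le> integral {0..X} g"
  using integral_norm_bound_integral[OF assms(1,2)] assms(3) by simp

lemma integral_exp_le:
  fixes c X :: real
  assumes "c > 0" "X \<ge> 0"
  shows "integral {0..X} (\<lambda>x. exp (c * x)) \<le> exp (c * X) / c"
proof -
  have "((\<lambda>x. exp (c * x)) has_integral (exp (c * X) / c - exp (c * 0) / c)) {0..X}"
    using assms
    by (intro fundamental_theorem_of_calculus)
      (auto intro!: derivative_eq_intros simp: has_real_derivative_iff_has_vector_derivative[symmetric])
  then show ?thesis
    using assms by (simp add: integral_unique)
qed

text \<open>Four corner values and two integrands of size at most \<open>2 * K\<close>. Together
  with linearity this makes the residual continuous in the sup norm, which carries the equation to
  uniform limits.\<close>

lemma telegraph_residual_bound: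
  assumes cont: "continuous_on ({0..A} \<times> {0..B}) (\<lambda>(x, y). u x y)"
    and X: "X \<in> {0..A}" and Y: "Y \<in> {0..B}" and ab: "a \<ge> 0" "b \<ge> 0"
    and le: "\<And>x y. x \<in> {0..A} \<Longrightarrow> y \<in> {0..B} \<Longrightarrow> \<bar>u x y\<bar> \<le> K"
  shows "\<bar>telegraph_residual a b u X Y\<bar> \<le> (4 + 2 * a * A + 2 * b * B) * K"
proof -
  have K: "K \<ge> 0" using le[OF X Y] by linarith
  have "\<bar>integral {0..X} (\<lambda>x. u x Y - u x 0)\<bar> \<le> integral {0..X} (\<lambda>x. 2 * K)"
  proof (rule integral_abs_le[OF telegraph_integrable(1)[OF cont X Y]])
    show "\<bar>u x Y - u x 0\<bar> \<le> 2 * K" if "x \<in> {0..X}" for x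
      using le[of x Y] le[of x 0] that X Y by auto
  qed auto
  also have "\<dots> \<le> A * (2 * K)" using X K by (auto intro!: mult_right_mono)
  finally have 1: "a * \<bar>integral {0..X} (\<lambda>x. u x Y - u x 0)\<bar> \<le> a * (A * (2 * K))"
    using ab by (intro mult_left_mono)
  have "\<bar>integral {0..Y} (\<lambda>y. u X y - u 0 y)\<bar> \<le> integral {0..Y} (\<lambda>y. 2 * K)"
  proof (rule integral_abs_le[OF telegraph_integrable(2)[OF cont X Y]])
    show "\<bar>u X y - u 0 y\<bar> \<le> 2 * K" if "y \<in> {0..Y}" for y
      using le[of X y] le[of 0 y] that X Y by auto
  qed auto
  also have "\<dots> \<le> B * (2 * K)" using Y K by (auto intro!: mult_right_mono)
  finally have 2: "b * \<bar>integral {0..Y} (\<lambda>y. u X y - u 0 y)\<bar> \<le> b * (B * (2 * K))"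
    using ab by (intro mult_left_mono)
  have 3: "\<bar>u X Y\<bar> \<le> K" "\<bar>u X 0\<bar> \<le> K" "\<bar>u 0 Y\<bar> \<le> K" "\<bar>u 0 0\<bar> \<le> K"
    using X Y by (auto intro!: le)
  have "\<bar>telegraph_residual a b u X Y\<bar> \<le> \<bar>u X Y\<bar> + \<bar>u X 0\<bar> + \<bar>u 0 Y\<bar> + \<bar>u 0 0\<bar>
      + a * \<bar>integral {0..X} (\<lambda>x. u x Y - u x 0)\<bar> + b * \<bar>integral {0..Y} (\<lambda>y. u X y - u 0 y)\<bar>"
  proof -
    have "\<bar>p - r - s + t + a * P + b * Q\<bar> \<le> \<bar>p\<bar> + \<bar>r\<bar> + \<bar>s\<bar> + \<bar>t\<bar> + a * \<bar>P\<bar> + b * \<bar>Q\<bar>"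
      for p r s t P Q :: real
    proof -
      have "\<bar>p - r - s + t + a * P + b * Q\<bar> \<le> \<bar>p - r - s + t\<bar> + \<bar>a * P\<bar> + \<bar>b * Q\<bar>"
        by linarith
      moreover have "\<bar>a * P\<bar> = a * \<bar>P\<bar>" "\<bar>b * Q\<bar> = b * \<bar>Q\<bar>" using ab by (auto simp: abs_mult)
      ultimately show ?thesis by linarith
    qed
    then show ?thesis unfolding telegraph_residual_def .
  qed
  also have "\<dots> \<le> K + K + K + K + a * (A * (2 * K)) + b * (B * (2 * K))"
    using 1 2 3 by (intro add_mono)
  also have "\<dots> = (4 + 2 * a * A + 2 * b * B) * K"
    by (simp add: algebra_simps)
  finally show ?thesis .
qed

text \<open>
  In the sup norm weighted by \<open>exp (- c * (x + y))\<close> the two integral operators contract by the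
  factor \<open>(a + b) / c = 1/2\<close>.
\<close>

lemma telegraph_stability:
  fixes u v :: "real \<Rightarrow> real \<Rightarrow> real"
  assumes u: "telegraph_approx a b A B f g \<epsilon> u" and v: "telegraph_approx a b A B f g \<epsilon>' v"
    and pos: "a > 0" "b > 0" "A \<ge> 0" "B \<ge> 0"
    and x: "x \<in> {0..A}" and y: "y \<in> {0..B}"
  shows "\<bar>u x y - v x y\<bar> \<le>
    2 * (4 + a * A + b * B) * exp (2 * (a + b) * (A + B)) * (\<epsilon> + \<epsilon>')"
proof -
  define c where "c = 2 * (a + b)"
  have c: "c > 0" using pos by (simp add: c_def)
  define e where "e = \<epsilon> + \<epsilon>'"
  define D where "D = (\<lambda>x y. u x y - v x y)"
  define R where "R = {0..A} \<times> {0..B}"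
  have cu: "continuous_on R (\<lambda>(x, y). u x y)" and cv: "continuous_on R (\<lambda>(x, y). v x y)"
    using u v by (auto simp: telegraph_approx_def R_def)
  have cD: "continuous_on R (\<lambda>(x, y). D x y)"
    using continuous_on_diff[OF cu cv] by (simp add: D_def case_prod_unfold)
  \<comment> \<open>The weighted maximum is attained by compactness, so the contraction has to be
    carried out at a single point \<open>(X, Y)\<close> only.\<close>
  have "R \<noteq> {}" "compact R" using pos by (auto simp: R_def compact_Times)
  moreover have "continuous_on R (\<lambda>p. exp (- c * (fst p + snd p)) * \<bar>D (fst p) (snd p)\<bar>)"
    using cD by (auto simp: case_prod_unfold intro!: continuous_intros)
  ultimately obtain p where p: "p \<in> R"
    and max: "\<And>p'. p' \<in> R \<Longrightarrow> exp (- c * (fst p' + snd p')) * \<bar>D (fst p') (snd p')\<bar>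
      \<le> exp (- c * (fst p + snd p)) * \<bar>D (fst p) (snd p)\<bar>"
    by (metis (no_types, lifting) continuous_attains_sup)
  obtain X Y where XY: "p = (X, Y)" by (cases p)
  define S where "S = exp (- c * (X + Y)) * \<bar>D X Y\<bar>"
  have X: "X \<in> {0..A}" and Y: "Y \<in> {0..B}" using p XY by (auto simp: R_def)
  have S: "\<bar>D x y\<bar> \<le> S * exp (c * (x + y))" if "x \<in> {0..A}" "y \<in> {0..B}" for x y
  proof -
    have "\<bar>D x y\<bar> = exp (- c * (x + y)) * \<bar>D x y\<bar> * exp (c * (x + y))"
      by (simp add: exp_minus)
    also have "\<dots> \<le> S * exp (c * (x + y))"
      using max[of "(x, y)"] that by (intro mult_right_mono) (auto simp: XY S_def R_def)
    finally show ?thesis .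
  qed
  have S0: "S \<ge> 0" by (simp add: S_def)
  have Dx: "\<bar>D x 0\<bar> \<le> e" if "x \<in> {0..A}" for x
  proof -
    have "\<bar>u x 0 - f x\<bar> \<le> \<epsilon>" "\<bar>v x 0 - f x\<bar> \<le> \<epsilon>'"
      using that u v by (auto simp: telegraph_approx_def)
    then show ?thesis by (simp add: D_def e_def)
  qed
  have Dy: "\<bar>D 0 y\<bar> \<le> e" if "y \<in> {0..B}" for y
  proof -
    have "\<bar>u 0 y - g y\<bar> \<le> \<epsilon>" "\<bar>v 0 y - g y\<bar> \<le> \<epsilon>'"
      using that u v by (auto simp: telegraph_approx_def)
    then show ?thesis by (simp add: D_def e_def)
  qed
  have e0: "e \<ge> 0" using Dx[of 0] pos by simp
  have res: "\<bar>telegraph_residual a b D X Y\<bar> \<le> e"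
  proof -
    have "telegraph_residual a b D X Y = telegraph_residual a b u X Y - telegraph_residual a b v X Y"
      unfolding D_def using cu cv X Y by (intro telegraph_residual_diff[of A B]) (auto simp: R_def)
    moreover have "\<bar>telegraph_residual a b u X Y\<bar> \<le> \<epsilon>" "\<bar>telegraph_residual a b v X Y\<bar> \<le> \<epsilon>'"
      using u v X Y by (auto simp: telegraph_approx_def)
    ultimately show ?thesis by (simp add: e_def)
  qed
  \<comment> \<open>Stated with its own \<open>X\<close>, \<open>Y\<close> and \<open>A\<close> so
    that it serves both directions; the second use exchanges the coordinates.\<close>
  have part: "\<bar>integral {0..X} (\<lambda>x. d x - d' x)\<bar> \<le> A * e + S * exp (c * (X + Y)) / c"
    if int: "(\<lambda>x. d x - d' x) integrable_on {0..X}" and X: "X \<in> {0..A}"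
      and d: "\<And>x. x \<in> {0..X} \<Longrightarrow> \<bar>d x\<bar> \<le> S * exp (c * (x + Y))"
      and d': "\<And>x. x \<in> {0..X} \<Longrightarrow> \<bar>d' x\<bar> \<le> e"
    for d d' :: "real \<Rightarrow> real" and X Y A
  proof -
    have "\<bar>integral {0..X} (\<lambda>x. d x - d' x)\<bar> \<le> integral {0..X} (\<lambda>x. e + S * exp (c * Y) * exp (c * x))"
    proof (rule integral_abs_le[OF int])
      show "(\<lambda>x. e + S * exp (c * Y) * exp (c * x)) integrable_on {0..X}"
        by (intro integrable_continuous_real continuous_intros)
      show "\<bar>d x - d' x\<bar> \<le> e + S * exp (c * Y) * exp (c * x)" if "x \<in> {0..X}" for x
        using d[OF that] d'[OF that] by (auto simp: distrib_left exp_add mult_ac)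
    qed
    also have "\<dots> = X * e + S * exp (c * Y) * integral {0..X} (\<lambda>x. exp (c * x))"
      using X by (subst integral_add)
        (auto intro!: integrable_continuous_real continuous_intros)
    also have "\<dots> \<le> A * e + S * exp (c * Y) * (exp (c * X) / c)"
      using X e0 S0 c by (intro add_mono mult_right_mono mult_left_mono integral_exp_le) auto
    finally show ?thesis by (simp add: distrib_left exp_add mult_ac)
  qed
  have intx: "\<bar>integral {0..X} (\<lambda>x. D x Y - D x 0)\<bar> \<le> A * e + S * exp (c * (X + Y)) / c"
    by (rule part[OF telegraph_integrable(1)[OF cD[unfolded R_def] X Y] X S Dx]) (use X Y in auto)
  have inty: "\<bar>integral {0..Y} (\<lambda>y. D X y - D 0 y)\<bar> \<le> B * e + S * exp (c * (X + Y)) / c"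
    unfolding add.commute[of X Y]
    by (rule part[OF telegraph_integrable(2)[OF cD[unfolded R_def] X Y] Y S[unfolded add.commute[of _ Y], THEN order_trans] Dy])
      (use X Y in \<open>auto simp: add.commute\<close>)
  have D00: "\<bar>D X 0\<bar> \<le> e" "\<bar>D 0 Y\<bar> \<le> e" "\<bar>D 0 0\<bar> \<le> e" using Dx Dy X Y pos by auto
  define P Q where "P = integral {0..X} (\<lambda>x. D x Y - D x 0)"
    and "Q = integral {0..Y} (\<lambda>y. D X y - D 0 y)"
  have "D X Y = telegraph_residual a b D X Y + D X 0 + D 0 Y - D 0 0 - a * P - b * Q"
    by (simp add: telegraph_residual_def P_def Q_def)
  moreover have "\<bar>a * P\<bar> \<le> a * (A * e + S * exp (c * (X + Y)) / c)"
    "\<bar>b * Q\<bar> \<le> b * (B * e + S * exp (c * (X + Y)) / c)"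
    using intx inty pos by (auto simp: P_def Q_def abs_mult)
  ultimately have "\<bar>D X Y\<bar> \<le> e + e + e + e
      + a * (A * e + S * exp (c * (X + Y)) / c) + b * (B * e + S * exp (c * (X + Y)) / c)"
    using res D00 by linarith
  also have "\<dots> = (4 + a * A + b * B) * e + S * exp (c * (X + Y)) * ((a + b) / c)"
    by (simp add: algebra_simps add_divide_distrib)
  also have "(a + b) / c = 1 / 2" using pos by (simp add: c_def)
  \<comment> \<open>Multiplying by the weight at the maximizer turns the left side into
    \<open>S\<close>; half of \<open>S\<close> reappears on the right and is absorbed.\<close>
  finally have "S \<le> exp (- c * (X + Y)) * ((4 + a * A + b * B) * e + S * exp (c * (X + Y)) * (1 / 2))"
    unfolding S_def by (intro mult_left_mono) auto
  also have "\<dots> = exp (- (c * (X + Y))) * ((4 + a * A + b * B) * e) + S / 2"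
  proof -
    have "exp (- z) * (k + S * exp z * (1 / 2)) = exp (- z) * k + S / 2" for z k
      by (simp add: distrib_left exp_minus)
    from this[of "c * (X + Y)"] show ?thesis by simp
  qed
  also have "\<dots> \<le> 1 * ((4 + a * A + b * B) * e) + S / 2"
  proof (intro add_mono mult_right_mono order_refl)
    have "c * (X + Y) \<ge> 0" using c X Y by (intro mult_nonneg_nonneg) auto
    then show "exp (- (c * (X + Y))) \<le> 1" by simp
    show "0 \<le> (4 + a * A + b * B) * e"
      using e0 pos by (intro mult_nonneg_nonneg add_nonneg_nonneg) auto
  qed
  finally have "S \<le> 2 * ((4 + a * A + b * B) * e)" by linarith
  then have "S \<le> 2 * (4 + a * A + b * B) * e" by (simp only: mult.assoc)
  then have "S * exp (c * (x + y)) \<le> 2 * (4 + a * A + b * B) * e * exp (c * (A + B))"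
  proof (rule mult_mono)
    show "exp (c * (x + y)) \<le> exp (c * (A + B))" using x y c by (simp add: mult_left_mono add_mono)
    show "0 \<le> 2 * (4 + a * A + b * B) * e"
      using e0 pos by (intro mult_nonneg_nonneg add_nonneg_nonneg) auto
  qed simp
  then show ?thesis
    using S[OF x y] by (simp add: D_def e_def c_def mult_ac)
qed

section \<open>Uniqueness and existence for the boundary value problem\<close>

lemma telegraph_bvp_unique:
  assumes "telegraph_bvp a b A B f g u" "telegraph_bvp a b A B f g v"
    and "a > 0" "b > 0" "A \<ge> 0" "B \<ge> 0" "x \<in> {0..A}" "y \<in> {0..B}"
  shows "u x y = v x y"
  using telegraph_stability[of a b A B f g 0 u 0 v x y] assms
  by (simp add: telegraph_approx_0_iff)

text \<open>By stability, approximate solutions with tolerances tending to 0 form a uniform Cauchy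
  sequence, and the sup-norm bound on the residual yields the exact equation in the limit. The lower
  bound \<open>c\<close> is closed under limits; a positive value later permits taking
  logarithms.\<close>

lemma telegraph_bvp_exists:
  assumes approx: "\<And>\<epsilon>. \<epsilon> > 0 \<Longrightarrow> \<exists>u. telegraph_approx a b A B f g \<epsilon> u \<and>
      (\<forall>x\<in>{0..A}. \<forall>y\<in>{0..B}. u x y \<ge> c)"
    and pos: "a > 0" "b > 0" "A \<ge> 0" "B \<ge> 0"
  shows "\<exists>u. telegraph_bvp a b A B f g u \<and> (\<forall>x\<in>{0..A}. \<forall>y\<in>{0..B}. u x y \<ge> c)"
proof -
  define R where "R = {0..A} \<times> {0..B}"
  define C where "C = 2 * (4 + a * A + b * B) * exp (2 * (a + b) * (A + B))"
  have C: "C > 0" unfolding C_def using pos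
    by (intro mult_pos_pos add_pos_nonneg) auto
  have "\<forall>n::nat. \<exists>u. telegraph_approx a b A B f g (1 / (n + 1)) u \<and>
      (\<forall>x\<in>{0..A}. \<forall>y\<in>{0..B}. u x y \<ge> c)"
    using approx by simp
  then obtain u where u: "\<And>n. telegraph_approx a b A B f g (1 / (real n + 1)) (u n)"
    and ge: "\<And>n x y. x \<in> {0..A} \<Longrightarrow> y \<in> {0..B} \<Longrightarrow> u n x y \<ge> c"
    by metis
  have lim0: "(\<lambda>n. 1 / (real n + 1)) \<longlonglongrightarrow> 0"
    using LIMSEQ_Suc[OF lim_1_over_n[where 'a = real]] by (simp add: add.commute)
  have "uniformly_Cauchy_on R (\<lambda>n (x, y). u n x y)"
    unfolding uniformly_Cauchy_on_def
  proof (intro allI impI)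
    fix e :: real assume e: "e > 0"
    have "(\<lambda>n. C * (2 * (1 / (real n + 1)))) \<longlonglongrightarrow> 0"
      using tendsto_mult_left[OF tendsto_mult_left[OF lim0, of 2], of C] by simp
    then have "\<forall>\<^sub>F n in sequentially. C * (2 * (1 / (real n + 1))) < e"
      using e by (rule order_tendstoD)
    then obtain N where N: "C * (2 * (1 / (real N + 1))) < e"
      by (auto simp: eventually_sequentially)
    have "dist (u m x y) (u n x y) < e" if "x \<in> {0..A}" "y \<in> {0..B}" "m \<ge> N" "n \<ge> N" for x y m n
    proof -
      have "dist (u m x y) (u n x y) \<le> C * (1 / (real m + 1) + 1 / (real n + 1))"
        using telegraph_stability[OF u[of m] u[of n] pos that(1,2)]
        by (simp add: dist_real_def C_def)
      also have "\<dots> \<le> C * (1 / (real N + 1) + 1 / (real N + 1))"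
        using that C by (intro mult_left_mono add_mono divide_left_mono) auto
      finally show ?thesis using N by simp
    qed
    then show "\<exists>N. \<forall>x\<in>R. \<forall>m\<ge>N. \<forall>n\<ge>N.
        dist (case x of (x, y) \<Rightarrow> u m x y) (case x of (x, y) \<Rightarrow> u n x y) < e"
      by (intro exI[of _ N]) (auto simp: R_def)
  qed
  then obtain U' where "uniform_limit R (\<lambda>n (x, y). u n x y) U' sequentially"
    using Cauchy_uniformly_convergent uniformly_convergent_on_def by blast
  moreover define U where "U = (\<lambda>x y. U' (x, y))"
  ultimately have U: "uniform_limit R (\<lambda>n (x, y). u n x y) (\<lambda>(x, y). U x y) sequentially"
    by (simp add: case_prod_unfold)
  have cu: "continuous_on R (\<lambda>(x, y). u n x y)" for n
    using u by (auto simp: telegraph_approx_def R_def)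
  have cU: "continuous_on R (\<lambda>(x, y). U x y)"
    by (rule uniform_limit_theorem[OF always_eventually U]) (simp_all add: cu)
  have lim: "(\<lambda>n. u n x y) \<longlonglongrightarrow> U x y" if "x \<in> {0..A}" "y \<in> {0..B}" for x y
    using tendsto_uniform_limitI[OF U, of "(x, y)"] that by (simp add: R_def)
  have res: "telegraph_residual a b U X Y = 0" if XY: "X \<in> {0..A}" "Y \<in> {0..B}" for X Y
  proof -
    \<comment> \<open>The constant of \<open>telegraph_residual_bound\<close>: a sup distance
      \<open>e / (2 * K)\<close> costs half of \<open>e\<close>, and the tolerance of
      \<open>u n\<close> takes the other half.\<close>
    define K where "K = 4 + 2 * a * A + 2 * b * B"
    have K: "K > 0" unfolding K_def using pos by (intro add_pos_nonneg) auto
    have "\<bar>telegraph_residual a b U X Y\<bar> \<le> e" if e: "e > 0" for e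
    proof -
      have "\<forall>\<^sub>F n in sequentially. \<forall>p\<in>R. dist (case p of (x, y) \<Rightarrow> u n x y) (case p of (x, y) \<Rightarrow> U x y) < e / (2 * K)"
        using U e K unfolding uniform_limit_iff by (auto dest!: spec[of _ "e / (2 * K)"])
      moreover have "\<forall>\<^sub>F n in sequentially. 1 / (real n + 1) < e / 2"
        using order_tendstoD(2)[OF lim0, of "e / 2"] e by simp
      ultimately have "\<forall>\<^sub>F n in sequentially. \<bar>telegraph_residual a b U X Y\<bar> \<le> e"
      proof eventually_elim
        case (elim n)
        have "\<bar>telegraph_residual a b (\<lambda>x y. U x y - u n x y) X Y\<bar> \<le> K * (e / (2 * K))"
          unfolding K_def
        proof (rule telegraph_residual_bound[OF _ XY])
          show "continuous_on ({0..A} \<times> {0..B}) (\<lambda>(x, y). U x y - u n x y)"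
            using continuous_on_diff[OF cU cu[of n]] by (simp add: case_prod_unfold R_def)
          show "\<bar>U x y - u n x y\<bar> \<le> e / (2 * (4 + 2 * a * A + 2 * b * B))"
            if "x \<in> {0..A}" "y \<in> {0..B}" for x y
            using elim(1) that by (force simp: R_def K_def dist_real_def abs_minus_commute)
        qed (use pos in auto)
        moreover have "telegraph_residual a b (\<lambda>x y. U x y - u n x y) X Y =
            telegraph_residual a b U X Y - telegraph_residual a b (u n) X Y"
          by (rule telegraph_residual_diff[OF _ _ XY]) (use cU cu[of n] in \<open>auto simp: R_def\<close>)
        moreover have "\<bar>telegraph_residual a b (u n) X Y\<bar> \<le> 1 / (real n + 1)"
          using u[of n] XY by (auto simp: telegraph_approx_def)
        moreover have "K * (e / (2 * K)) = e / 2" using K by simp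
        ultimately show ?case using elim(2) by linarith
      qed
      then show ?thesis by simp
    qed
    then have "\<bar>telegraph_residual a b U X Y\<bar> \<le> 0"
      using field_le_epsilon[of "\<bar>telegraph_residual a b U X Y\<bar>" 0] by simp
    then show ?thesis by simp
  qed
  have lim_eq: "l = c" if "\<And>n. \<bar>X n - c\<bar> \<le> 1 / (real n + 1)" "X \<longlonglongrightarrow> l" for X and l c :: real
  proof -
    have "(\<lambda>n. X n - c) \<longlonglongrightarrow> 0" by (rule Lim_null_comparison[OF _ lim0]) (use that(1) in auto)
    then have "X \<longlonglongrightarrow> c" by (simp add: LIM_zero_iff)
    with that(2) show ?thesis by (rule LIMSEQ_unique)
  qed
  have bx: "U x 0 = f x" if "x \<in> {0..A}" for x
    using u that pos by (intro lim_eq[OF _ lim]) (auto simp: telegraph_approx_def)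
  have bnd_y: "U 0 y = g y" if "y \<in> {0..B}" for y
    using u that pos by (intro lim_eq[OF _ lim]) (auto simp: telegraph_approx_def)
  have "telegraph_approx a b A B f g 0 U"
    using cU res bx bnd_y by (simp add: telegraph_approx_def R_def)
  moreover have "U x y \<ge> c" if "x \<in> {0..A}" "y \<in> {0..B}" for x y
    using LIMSEQ_le_const[OF lim[OF that]] ge[OF that] by blast
  ultimately show ?thesis by (auto simp: telegraph_approx_0_iff)
qed

section \<open>Scaling limit of the vertex weights\<close>

lemma tendsto_mult_exp_minus_one: "((\<lambda>L::real. L * (exp (c / L) - 1)) \<longlongrightarrow> c) at_top"
proof -
  have "((\<lambda>h. (exp (c * h) - 1) / h) \<longlongrightarrow> c) (at_right 0)"
  proof -
    have "((\<lambda>h. exp (c * h)) has_real_derivative c) (at 0)"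
      by (auto intro!: derivative_eq_intros)
    then show ?thesis
      unfolding DERIV_def by (auto intro: tendsto_mono[OF at_le])
  qed
  then have "((\<lambda>L. (exp (c * inverse L) - 1) / inverse L) \<longlongrightarrow> c) at_top"
    by (rule filterlim_compose[OF _ filterlim_inverse_at_right_top])
  then show ?thesis
    by (simp add: divide_inverse mult.commute)
qed

text \<open>Limit of \<open>L powi n * qpoch (q powi p) q n\<close> for
  \<open>q = exp (\<delta> / L)\<close>: each factor \<open>1 - q powi (p + k)\<close> is replaced
  by its first-order coefficient \<open>- (p + k) * \<delta>\<close>. For \<open>n \<ge> 0\<close>
  this is \<open>(- \<delta>) ^ n\<close> times the rising factorial of \<open>p\<close>.\<close>

definition qpoch_lim :: "real \<Rightarrow> int \<Rightarrow> int \<Rightarrow> real" where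
  "qpoch_lim \<delta> p n =
    (if n \<ge> 0 then \<Prod>k<nat n. - (of_int p + real k) * \<delta>
     else \<Prod>k=1..nat (- n). inverse (- (of_int p - real k) * \<delta>))"

text \<open>Only the limit of \<open>\<alpha>\<close> is recorded: the symbols containing
  \<open>\<alpha>\<close> have bases tending to \<open>\<rho>\<close> or
  \<open>inverse \<rho>\<close>, away from 1, and converge without rescaling. Only symbols based at
  powers of \<open>q\<close> degenerate.\<close>

locale vertex_weight_scaling =
  fixes q \<alpha> :: "real \<Rightarrow> real" and \<delta> \<rho> :: real
  assumes q_eq: "\<forall>\<^sub>F L in at_top. q L = exp (\<delta> / L)"
    and \<alpha>_lim: "(\<alpha> \<longlongrightarrow> - \<rho>) at_top"
    and \<rho>: "\<rho> \<noteq> 0" "\<rho> \<noteq> 1"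
    and \<delta>: "\<delta> \<noteq> 0"
begin

lemma q_pos: "\<forall>\<^sub>F L in at_top. q L > 0"
  using q_eq by eventually_elim simp

lemma one_minus_q_powi_lim:
  "((\<lambda>L. L * (1 - q L powi m)) \<longlongrightarrow> - of_int m * \<delta>) at_top"
proof -
  have "((\<lambda>L. - (L * (exp (of_int m * \<delta> / L) - 1))) \<longlongrightarrow> - (of_int m * \<delta>)) at_top"
    by (intro tendsto_minus tendsto_mult_exp_minus_one)
  then show ?thesis
  proof (rule Lim_transform_eventually[OF tendsto_eq_rhs])
    show "\<forall>\<^sub>F L in at_top. - (L * (exp (of_int m * \<delta> / L) - 1)) = L * (1 - q L powi m)"
      using q_eq
    proof eventually_elim
      case (elim L)
      have "exp (of_int m * \<delta> / L) = q L powi m"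
        using elim by (simp add: exp_power_int field_simps)
      then show ?case by (simp add: algebra_simps)
    qed
  qed simp
qed

lemma q_powi_lim: "((\<lambda>L. q L powi m) \<longlongrightarrow> 1) at_top"
proof -
  have "((\<lambda>L. 1 - inverse L * (L * (1 - q L powi m))) \<longlongrightarrow> 1 - 0 * (- of_int m * \<delta>)) at_top"
    by (intro tendsto_intros one_minus_q_powi_lim tendsto_inverse_0_at_top filterlim_ident)
  then show ?thesis
  proof (rule Lim_transform_eventually[OF tendsto_eq_rhs])
    show "\<forall>\<^sub>F L in at_top. 1 - inverse L * (L * (1 - q L powi m)) = q L powi m"
      using eventually_gt_at_top[of 0] by eventually_elim (simp add: field_simps)
  qed simp
qed

lemma q_lim: "(q \<longlongrightarrow> 1) at_top"
  using q_powi_lim[of 1] by simp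

lemma qpoch_tendsto:
  assumes a: "(a \<longlongrightarrow> a') at_top" and "a' \<noteq> 1"
  shows "((\<lambda>L. qpoch (a L) (q L) n) \<longlongrightarrow> (1 - a') powi n) at_top"
proof (cases "n \<ge> 0")
  case True
  have "((\<lambda>L. \<Prod>k<nat n. 1 - a L * q L ^ k) \<longlongrightarrow> (\<Prod>k<nat n. 1 - a' * 1 ^ k)) at_top"
    by (intro tendsto_intros a q_lim)
  then show ?thesis using True by (simp add: qpoch_def power_int_def)
next
  case False
  have "((\<lambda>L. \<Prod>k=1..nat (-n). inverse (1 - a L * q L powi (- int k))) \<longlongrightarrow>
      (\<Prod>k=1..nat (-n). inverse (1 - a' * 1))) at_top"
    using assms by (intro tendsto_intros a q_powi_lim) auto
  then show ?thesis using False by (simp add: qpoch_def power_int_def)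
qed

text \<open>Every factor contributes exactly one power of \<open>L\<close>. For negative
  \<open>n\<close> the factors are inverted, and the assumption keeps their limits
  \<open>- (p - k) * \<delta>\<close> away from 0.\<close>

lemma qpoch_q_powi_tendsto:
  assumes "\<And>k. k \<in> {1..nat (- n)} \<Longrightarrow> p \<noteq> int k"
  shows "((\<lambda>L. L powi n * qpoch (q L powi p) (q L) n) \<longlongrightarrow> qpoch_lim \<delta> p n) at_top"
proof (cases "n \<ge> 0")
  case True
  have "((\<lambda>L. \<Prod>k<nat n. L * (1 - q L powi (p + int k))) \<longlongrightarrow>
      (\<Prod>k<nat n. - of_int (p + int k) * \<delta>)) at_top"
    by (intro tendsto_intros one_minus_q_powi_lim)
  then show ?thesis
  proof (rule Lim_transform_eventually[OF tendsto_eq_rhs])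
    show "\<forall>\<^sub>F L in at_top. (\<Prod>k<nat n. L * (1 - q L powi (p + int k))) =
        L powi n * qpoch (q L powi p) (q L) n"
      using q_pos by eventually_elim
        (use True in \<open>simp add: qpoch_def prod.distrib power_int_def[of _ n] power_int_add\<close>)
  qed (use True in \<open>simp add: qpoch_lim_def\<close>)
next
  case False
  have "((\<lambda>L. \<Prod>k=1..nat (-n). inverse (L * (1 - q L powi (p - int k)))) \<longlongrightarrow>
      (\<Prod>k=1..nat (-n). inverse (- of_int (p - int k) * \<delta>))) at_top"
  proof (intro tendsto_prod tendsto_inverse one_minus_q_powi_lim)
    fix k assume "k \<in> {1..nat (- n)}"
    then have "p - int k \<noteq> 0" using assms by force
    then show "- of_int (p - int k) * \<delta> \<noteq> 0" using \<delta> by (simp only: of_int_eq_0_iff mult_eq_0_iff neg_equal_0_iff_equal) simp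
  qed
  then show ?thesis
  proof (rule Lim_transform_eventually[OF tendsto_eq_rhs])
    show "\<forall>\<^sub>F L in at_top. (\<Prod>k=1..nat (-n). inverse (L * (1 - q L powi (p - int k)))) =
        L powi n * qpoch (q L powi p) (q L) n"
      using q_pos by eventually_elim
        (use False in \<open>simp add: qpoch_def prod.distrib power_int_def[of _ n] power_int_diff
            power_int_minus divide_inverse power_inverse\<close>)
  qed (use False in \<open>simp add: qpoch_lim_def\<close>)
qed

lemma qpoch_q_powi_shift_tendsto:
  "((\<lambda>L. L ^ m * qpoch (q L powi p * q L ^ k) (q L) (int m)) \<longlongrightarrow> qpoch_lim \<delta> (p + int k) (int m)) at_top"
proof (rule Lim_transform_eventually[OF qpoch_q_powi_tendsto])
  show "\<forall>\<^sub>F L in at_top. L powi (int m) * qpoch (q L powi (p + int k)) (q L) (int m) =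
      L ^ m * qpoch (q L powi p * q L ^ k) (q L) (int m)"
    using q_pos by eventually_elim (simp add: power_int_add)
qed simp

end

section \<open>Orders in L of the hypergeometric terms\<close>

text \<open>The prefactor is multiplied into each summand, because the orders of both have to be
  added before terms can be compared.\<close>

definition vertex_term ::
    "nat \<Rightarrow> nat \<Rightarrow> real \<Rightarrow> real \<Rightarrow> nat \<Rightarrow> nat \<Rightarrow> nat \<Rightarrow> nat \<Rightarrow> nat \<Rightarrow> real" where
  "vertex_term I J q \<alpha> i1 j1 i2 j2 k =
    q powr ((2 * real j1 - (real j1)\<^sup>2) / 4 - (2 * real j2 - (real j2)\<^sup>2) / 4
               + ((real i2)\<^sup>2 + (real i1)\<^sup>2) / 4
               + (real i2 * (real j2 - 1) + real i1 * real j1) / 2)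
    * ((q powi (- int I)) powi (int j1 - int i2) * \<alpha> powi (int j2 - int j1 + int i2)
            * qpoch (- \<alpha> * inverse (q powi (- int I))) q (int j2 - int i1)
          / (qpoch q q i2 * qpoch (- \<alpha>) q (int i2 + int j2)
            * qpoch (q powi (int J + 1 - int j1)) q (int j1 - int j2)))
    * (q ^ k * (qpoch (q powi (- int i2)) q k / qpoch q q k)
      * (qpoch (q powi (- int i1)) q k * qpoch (q powi (- int I) * q ^ k) q (int i2 - int k)
      * (qpoch (- \<alpha> * q ^ J) q k * qpoch (q powi (1 + int j2 - int i1) * q ^ k) q (int i2 - int k)
      * (qpoch (- q * (q powi (- int I)) * inverse \<alpha>) q k
        * qpoch (q powi (int J + 1 - int i2 - int j2) * q ^ k) q (int i2 - int k)))))"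

lemma vertex_weight_eq_sum:
  assumes "i1 + j1 = i2 + j2"
  shows "vertex_weight I J q \<alpha> i1 j1 i2 j2 = (\<Sum>k\<le>i2. vertex_term I J q \<alpha> i1 j1 i2 j2 k)"
  using assms by (simp add: vertex_weight_def Let_def qhyp_reg_def vertex_term_def sum_distrib_left mult.assoc)

text \<open>The symbol based at \<open>q powi (- int i1)\<close> contains the factor with index
  \<open>i1\<close>, which is 1 - 1. Hence only \<open>k\<close> up to the smaller of
  \<open>i1\<close> and \<open>i2\<close> contributes, and no term grows with L.\<close>

lemma vertex_term_eq_0:
  assumes "k > i1" "q > 0"
  shows "vertex_term I J q \<alpha> i1 j1 i2 j2 k = 0"
proof -
  have "qpoch (q powi (- int i1)) q (int k) = 0"
    using assms by (auto simp: qpoch_def power_int_minus intro!: bexI[of _ i1])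
  then show ?thesis by (simp add: vertex_term_def)
qed

definition vertex_term_lim ::
    "nat \<Rightarrow> nat \<Rightarrow> real \<Rightarrow> real \<Rightarrow> nat \<Rightarrow> nat \<Rightarrow> nat \<Rightarrow> nat \<Rightarrow> nat \<Rightarrow> real" where
  "vertex_term_lim I J \<delta> \<rho> i1 j1 i2 j2 k =
    ((- \<rho>) powi (int j2 - int j1 + int i2) * (1 - \<rho>) powi (int j2 - int i1)
      / (qpoch_lim \<delta> 1 i2 * (1 - \<rho>) powi (int i2 + int j2)
         * qpoch_lim \<delta> (int J + 1 - int j1) (int j1 - int j2)))
    * ((qpoch_lim \<delta> (- int i2) k / qpoch_lim \<delta> 1 k)
      * (qpoch_lim \<delta> (- int i1) k * qpoch_lim \<delta> (- int I + int k) (int (i2 - k))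
      * ((1 - \<rho>) ^ k * qpoch_lim \<delta> (1 + int j2 - int i1 + int k) (int (i2 - k))
      * ((1 - inverse \<rho>) ^ k * qpoch_lim \<delta> (int J + 1 - int i2 - int j2 + int k) (int (i2 - k))))))"

context vertex_weight_scaling
begin

text \<open>Power count over the symbols based at powers of \<open>q\<close>: the two in the
  denominator of the prefactor give exponents \<open>i2\<close> and \<open>j1 - j2\<close>; in the
  summand the first quotient is neutral, the symbol for \<open>i1\<close> gives \<open>- k\<close>,
  and the three lower parameters give \<open>- (i2 - k)\<close> each. By conservation the total is
  \<open>2 * k - i1 - i2\<close>.\<close>

lemma vertex_term_tendsto:
  assumes "i1 + j1 = i2 + j2" "j1 \<le> J" "j2 \<le> J" "k \<le> i2"
  shows "((\<lambda>L. L powi (int i1 + int i2 - 2 * int k) * vertex_term I J (q L) (\<alpha> L) i1 j1 i2 j2 k)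
    \<longlongrightarrow> vertex_term_lim I J \<delta> \<rho> i1 j1 i2 j2 k) at_top"
proof -
  define m where "m = i2 - k"
  have m: "int i2 - int k = int m" using assms by (simp add: m_def)
  define P where "P = (2 * real j1 - (real j1)\<^sup>2) / 4 - (2 * real j2 - (real j2)\<^sup>2) / 4
               + ((real i2)\<^sup>2 + (real i1)\<^sup>2) / 4
               + (real i2 * (real j2 - 1) + real i1 * real j1) / 2"
  have qn: "((\<lambda>L. L ^ n * qpoch (q L) (q L) (int n)) \<longlongrightarrow> qpoch_lim \<delta> 1 (int n)) at_top" for n
    using qpoch_q_powi_tendsto[of "int n" 1] by simp
  have qn': "((\<lambda>L. L ^ n * qpoch (q L powi p) (q L) (int n)) \<longlongrightarrow> qpoch_lim \<delta> p (int n)) at_top" for n p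
    using qpoch_q_powi_tendsto[of "int n" p] by simp
  have lim_pow: "((\<lambda>L. q L powr P) \<longlongrightarrow> 1) at_top"
    using tendsto_powr[OF q_lim tendsto_const[of P]] by simp
  have lim_nu: "((\<lambda>L. (q L powi (- int I)) powi (int j1 - int i2)) \<longlongrightarrow> 1) at_top"
    using tendsto_power_int[OF q_powi_lim] by force
  have lim_al: "((\<lambda>L. \<alpha> L powi (int j2 - int j1 + int i2)) \<longlongrightarrow> (- \<rho>) powi (int j2 - int j1 + int i2)) at_top"
    using \<rho> by (intro tendsto_power_int \<alpha>_lim) auto
  have lim1: "((\<lambda>L. qpoch (- \<alpha> L * inverse (q L powi (- int I))) (q L) (int j2 - int i1)) \<longlongrightarrow>
      (1 - \<rho>) powi (int j2 - int i1)) at_top"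
  proof (rule qpoch_tendsto)
    show "((\<lambda>L. - \<alpha> L * inverse (q L powi (- int I))) \<longlongrightarrow> \<rho>) at_top"
      using tendsto_mult[OF tendsto_minus[OF \<alpha>_lim] tendsto_inverse[OF q_powi_lim[of "- int I"]]] by simp
  qed (use \<rho> in auto)
  have lim2: "((\<lambda>L. qpoch (- \<alpha> L) (q L) (int i2 + int j2)) \<longlongrightarrow> (1 - \<rho>) powi (int i2 + int j2)) at_top"
    using qpoch_tendsto[OF tendsto_minus[OF \<alpha>_lim]] \<rho> by simp
  \<comment> \<open>For \<open>j1 < j2\<close> the index is negative. The inverted factors have
    exponents \<open>J + 1 - j1 - k\<close> with \<open>k \<le> j2 - j1\<close>, which are at least
    1 because \<open>j2 \<le> J\<close>.\<close>
  have lim3: "((\<lambda>L. L powi (int j1 - int j2) * qpoch (q L powi (int J + 1 - int j1)) (q L) (int j1 - int j2)) \<longlongrightarrow>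
      qpoch_lim \<delta> (int J + 1 - int j1) (int j1 - int j2)) at_top"
    using assms by (intro qpoch_q_powi_tendsto) auto
  have lim4: "((\<lambda>L. qpoch (- \<alpha> L * q L ^ J) (q L) (int k)) \<longlongrightarrow> (1 - \<rho>) ^ k) at_top"
  proof -
    have "((\<lambda>L. - \<alpha> L * q L ^ J) \<longlongrightarrow> \<rho>) at_top"
      using tendsto_mult[OF tendsto_minus[OF \<alpha>_lim] tendsto_power[OF q_lim, of J]] by simp
    from qpoch_tendsto[OF this, of k] show ?thesis using \<rho> by simp
  qed
  have lim5: "((\<lambda>L. qpoch (- q L * (q L powi (- int I)) * inverse (\<alpha> L)) (q L) (int k)) \<longlongrightarrow> (1 - inverse \<rho>) ^ k) at_top"
  proof -
    have "((\<lambda>L. - q L * (q L powi (- int I)) * inverse (\<alpha> L)) \<longlongrightarrow> - 1 * 1 * inverse (- \<rho>)) at_top"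
      using \<rho> by (intro tendsto_intros q_lim q_powi_lim \<alpha>_lim) auto
    from qpoch_tendsto[OF this, of k] show ?thesis using \<rho> by (simp add: field_simps)
  qed
  have nz: "qpoch_lim \<delta> 1 (int n) \<noteq> 0" for n using \<delta> by (auto simp: qpoch_lim_def)
  have nz': "qpoch_lim \<delta> (int J + 1 - int j1) (int j1 - int j2) \<noteq> 0"
    using \<delta> assms by (auto simp: qpoch_lim_def)
  have "((\<lambda>L. q L powr P *
      ((q L powi (- int I)) powi (int j1 - int i2) * \<alpha> L powi (int j2 - int j1 + int i2)
        * qpoch (- \<alpha> L * inverse (q L powi (- int I))) (q L) (int j2 - int i1)
        / ((L ^ i2 * qpoch (q L) (q L) (int i2)) * qpoch (- \<alpha> L) (q L) (int i2 + int j2)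
          * (L powi (int j1 - int j2) * qpoch (q L powi (int J + 1 - int j1)) (q L) (int j1 - int j2))))
      * (q L ^ k * ((L ^ k * qpoch (q L powi (- int i2)) (q L) (int k)) / (L ^ k * qpoch (q L) (q L) (int k)))
      * ((L ^ k * qpoch (q L powi (- int i1)) (q L) (int k)) * (L ^ m * qpoch (q L powi (- int I) * q L ^ k) (q L) (int m))
      * (qpoch (- \<alpha> L * q L ^ J) (q L) (int k) * (L ^ m * qpoch (q L powi (1 + int j2 - int i1) * q L ^ k) (q L) (int m))
      * (qpoch (- q L * (q L powi (- int I)) * inverse (\<alpha> L)) (q L) (int k)
        * (L ^ m * qpoch (q L powi (int J + 1 - int i2 - int j2) * q L ^ k) (q L) (int m)))))))
      \<longlongrightarrow> 1 * (1 * (- \<rho>) powi (int j2 - int j1 + int i2) * (1 - \<rho>) powi (int j2 - int i1)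
      / (qpoch_lim \<delta> 1 i2 * (1 - \<rho>) powi (int i2 + int j2)
         * qpoch_lim \<delta> (int J + 1 - int j1) (int j1 - int j2)))
    * (1 ^ k * (qpoch_lim \<delta> (- int i2) k / qpoch_lim \<delta> 1 k)
      * (qpoch_lim \<delta> (- int i1) k * qpoch_lim \<delta> (- int I + int k) m
      * ((1 - \<rho>) ^ k * qpoch_lim \<delta> (1 + int j2 - int i1 + int k) m
      * ((1 - inverse \<rho>) ^ k * qpoch_lim \<delta> (int J + 1 - int i2 - int j2 + int k) m))))) at_top" (is "(?f \<longlongrightarrow> _) _")
    using \<rho> nz nz'
    by (intro tendsto_mult tendsto_divide tendsto_power lim_pow lim_nu lim_al lim1 lim2 lim3 lim4 lim5
        qn qn' qpoch_q_powi_shift_tendsto q_lim) auto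
  then show ?thesis
  proof (rule Lim_transform_eventually[OF tendsto_eq_rhs])
    \<comment> \<open>Distributes the total power of L over the symbols it normalizes:
      \<open>z\<close> is \<open>L ^ k\<close>, \<open>w\<close> is \<open>L ^ m\<close>, and
      \<open>x\<close>, \<open>y\<close> are the two powers in the denominator. The quotient
      \<open>n1 / n2\<close> is expanded by \<open>z\<close>, hence
      \<open>z \<noteq> 0\<close>.\<close>
    have alg: "z * w ^ 3 / (x * y) * (Q * (c1 / (d1 * d2 * d3)) * (qk * (n1 / n2) * (f1 * g1 * (f2 * g2 * (f3 * g3)))))
      = Q * (c1 / ((x * d1) * d2 * (y * d3))) * (qk * ((z * n1) / (z * n2)) * ((z * f1) * (w * g1) * (f2 * (w * g2) * (f3 * (w * g3)))))"
      if "z \<noteq> 0" for z w x y Q c1 d1 d2 d3 qk n1 n2 f1 g1 f2 g2 f3 g3 :: real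
      using that by (simp add: divide_inverse inverse_mult_distrib power3_eq_cube mult_ac)
    have e: "L powi (int i1 + int i2 - 2 * int k) = L ^ k * (L ^ m) ^ 3 / (L ^ i2 * L powi (int j1 - int j2))"
      if "L > 0" for L :: real
    proof -
      have "int i1 + int i2 - 2 * int k = int k + 3 * int m - (int i2 + (int j1 - int j2))"
        using assms by (simp add: m_def)
      then show ?thesis using that
        by (simp only: power_int_diff power_int_add power_int_mult)
          (simp add: power_int_diff power_int_add power_int_mult flip: power_mult add: mult.commute)
    qed
    show "\<forall>\<^sub>F L in at_top. ?f L
      = L powi (int i1 + int i2 - 2 * int k) * vertex_term I J (q L) (\<alpha> L) i1 j1 i2 j2 k"
      using eventually_gt_at_top[of 0]
    proof eventually_elim
      case (elim L)
      show ?case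
        unfolding vertex_term_def e[OF elim] m P_def[symmetric]
        by (rule alg[symmetric]) (use elim in auto)
    qed
  qed (simp add: vertex_term_lim_def m_def)
qed

text \<open>For the contributing \<open>k\<close> the exponent \<open>i1 + i2 - 2 * k\<close> is at
  least the distance of \<open>i1\<close> and \<open>i2\<close>. One factor \<open>L\<close>
  compensates only the exponent 1, that is, neighbouring \<open>i1\<close>, \<open>i2\<close> with
  \<open>k\<close> the smaller of the two; larger exponents leave powers of 1/L.\<close>

lemma vertex_weight_offdiag_tendsto:
  assumes sum: "i1 + j1 = i2 + j2" and le: "j1 \<le> J" "j2 \<le> J" and neq: "i1 \<noteq> i2"
  shows "((\<lambda>L. L * vertex_weight I J (q L) (\<alpha> L) i1 j1 i2 j2) \<longlongrightarrow>
    (\<Sum>k\<le>i2. if k \<le> i1 \<and> i1 + i2 = 2 * k + 1 then vertex_term_lim I J \<delta> \<rho> i1 j1 i2 j2 k else 0)) at_top"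
proof -
  have "((\<lambda>L. L * vertex_term I J (q L) (\<alpha> L) i1 j1 i2 j2 k) \<longlongrightarrow>
      (if k \<le> i1 \<and> i1 + i2 = 2 * k + 1 then vertex_term_lim I J \<delta> \<rho> i1 j1 i2 j2 k else 0)) at_top"
    if k: "k \<le> i2" for k
  proof (cases "k \<le> i1")
    case False
    have "\<forall>\<^sub>F L in at_top. 0 = L * vertex_term I J (q L) (\<alpha> L) i1 j1 i2 j2 k"
      using q_pos by eventually_elim (use False in \<open>simp add: vertex_term_eq_0\<close>)
    then show ?thesis using False by (auto intro: Lim_transform_eventually)
  next
    case True
    define e where "e = i1 + i2 - 2 * k"
    have e: "int i1 + int i2 - 2 * int k = int e" using True k by (simp add: e_def)
    note lim = vertex_term_tendsto[OF sum le k, of I, unfolded e]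
    have "e \<ge> 1" using True k neq by (simp add: e_def)
    then consider "e = 1" | e' where "e = Suc (Suc e')" by (metis Suc_le_D One_nat_def not0_implies_Suc)
    then show ?thesis
    proof cases
      case 1
      then show ?thesis using lim True by (auto simp: e_def)
    next
      case 2
      have "((\<lambda>L::real. inverse L ^ Suc e' * (L powi (int e) * vertex_term I J (q L) (\<alpha> L) i1 j1 i2 j2 k)) \<longlongrightarrow>
          0 ^ Suc e' * vertex_term_lim I J \<delta> \<rho> i1 j1 i2 j2 k) at_top"
        by (intro tendsto_intros lim tendsto_inverse_0_at_top filterlim_ident)
      then have "((\<lambda>L. L * vertex_term I J (q L) (\<alpha> L) i1 j1 i2 j2 k) \<longlongrightarrow> 0) at_top"
      proof (rule Lim_transform_eventually[OF tendsto_eq_rhs])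
        show "\<forall>\<^sub>F L in at_top. inverse L ^ Suc e' * (L powi (int e) * vertex_term I J (q L) (\<alpha> L) i1 j1 i2 j2 k)
            = L * vertex_term I J (q L) (\<alpha> L) i1 j1 i2 j2 k"
          using eventually_gt_at_top[of 0]
          by eventually_elim (simp only: 2 power_int_of_nat, simp add: field_simps)
      qed simp
      moreover have "i1 + i2 \<noteq> 2 * k + 1" using 2 by (simp add: e_def)
      ultimately show ?thesis by simp
    qed
  qed
  then have "((\<lambda>L. \<Sum>k\<le>i2. L * vertex_term I J (q L) (\<alpha> L) i1 j1 i2 j2 k) \<longlongrightarrow>
      (\<Sum>k\<le>i2. if k \<le> i1 \<and> i1 + i2 = 2 * k + 1 then vertex_term_lim I J \<delta> \<rho> i1 j1 i2 j2 k else 0)) at_top"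
    by (intro tendsto_sum) auto
  then show ?thesis using sum by (simp add: vertex_weight_eq_sum sum_distrib_left)
qed

section \<open>Limiting rates of gaining or losing one line\<close>

lemma qpoch_lim_one: "qpoch_lim \<delta> 1 (int n) = (- \<delta>) ^ n * fact n"
proof -
  have "(\<Prod>k<n. (- 1 - real k) * \<delta>) = (- \<delta>) ^ n * fact n"
    by (induction n) (simp_all add: algebra_simps)
  then show ?thesis by (simp add: qpoch_lim_def)
qed

lemma qpoch_lim_minus: "qpoch_lim \<delta> (- int n) (int n) = \<delta> ^ n * fact n"
proof -
  have "(\<Prod>k<n. (real n - real k) * \<delta>) = \<delta> ^ n * fact n"
    by (induction n) (simp_all add: prod.lessThan_Suc_shift del: prod.lessThan_Suc)
  then show ?thesis by (simp add: qpoch_lim_def)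
qed

lemma qpoch_lim_minus_Suc: "qpoch_lim \<delta> (- int (Suc n)) (int n) = \<delta> ^ n * fact (Suc n)"
proof -
  have "(\<Prod>k<n. (real (Suc n) - real k) * \<delta>) = \<delta> ^ n * fact (Suc n)"
  proof (induction n)
    case (Suc n)
    have "real (Suc (Suc n)) - real (Suc k) = real (Suc n) - real k" for k by simp
    then have "(\<Prod>k<Suc n. (real (Suc (Suc n)) - real k) * \<delta>)
        = real (Suc (Suc n)) * \<delta> * (\<Prod>k<n. (real (Suc n) - real k) * \<delta>)"
      by (simp only: prod.lessThan_Suc_shift o_def) simp
    then show ?case unfolding Suc by (simp only: power_Suc fact_Suc of_nat_mult mult_ac)
  qed simp
  moreover have "- (of_int (- int (Suc n)) + real k) = real (Suc n) - real k" for k by simp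
  ultimately show ?thesis by (simp only: qpoch_lim_def of_nat_0_le_iff if_True nat_int)
qed

lemma qpoch_lim_single: "qpoch_lim \<delta> p (int (Suc 0)) = - of_int p * \<delta>"
  by (simp add: qpoch_lim_def)

text \<open>Only \<open>k = n\<close> survives, and the lower parameters have symbols of length 1,
  with limits \<open>(I - n) * \<delta>\<close>, \<open>- (j2 + 1) * \<delta>\<close> and
  \<open>- (J - j2) * \<delta>\<close>. The last one cancels against the prefactor, and the powers
  of \<open>1 - \<rho>\<close> leave one of them in the denominator.\<close>

lemma vertex_weight_up_tendsto:
  assumes "Suc j2 \<le> J"
  shows "((\<lambda>L. L * vertex_weight I J (q L) (\<alpha> L) n (Suc j2) (Suc n) j2) \<longlongrightarrow>
    (real I - real n) * real (Suc j2) * \<delta> / (1 - \<rho>)) at_top"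
proof -
  have "vertex_term_lim I J \<delta> \<rho> n (Suc j2) (Suc n) j2 n = (real I - real n) * real (Suc j2) * \<delta> / (1 - \<rho>)"
  proof -
    have e: "int j2 - int (Suc j2) + int (Suc n) = int n" "int (Suc j2) - int j2 = int (Suc 0)"
      "Suc n - n = Suc 0"
      by auto
    \<comment> \<open>The powers of \<open>\<alpha>\<close> in the prefactor combine with the symbol
      based at \<open>- q * \<nu> / \<alpha>\<close>, whose factors tend to
      \<open>1 - inverse \<rho>\<close>.\<close>
    have 1: "(- \<rho>) ^ n * (1 - inverse \<rho>) ^ n = (1 - \<rho>) ^ n"
      unfolding power_mult_distrib[symmetric] using \<rho> by (intro arg_cong[of _ _ "\<lambda>x. x ^ n"]) (simp add: field_simps)
    have J: "int J - int j2 \<noteq> 0" using assms by auto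
    define y where "y = 1 - \<rho>"
    have 2: "\<delta> ^ n * (- \<delta>) ^ n \<noteq> 0" "fact n \<noteq> (0::real)" "fact (Suc n) \<noteq> (0::real)" using \<delta> by auto
    have "vertex_term_lim I J \<delta> \<rho> n (Suc j2) (Suc n) j2 n =
      ((- \<rho>) ^ n * (1 - inverse \<rho>) ^ n) * ((1 - \<rho>) ^ j2 / (1 - \<rho>) ^ n) * (1 - \<rho>) ^ n / ((1 - \<rho>) ^ Suc n * (1 - \<rho>) ^ j2)
       * (\<delta> ^ n * \<delta> ^ n / ((- \<delta>) ^ n * (- \<delta>) ^ n)) * (fact (Suc n) * fact n / (fact (Suc n) * fact n))
       * ((int J - int j2) / (int J - int j2))
       * ((real I - real n) * real (Suc j2) * \<delta>)"
      unfolding vertex_term_lim_def e qpoch_lim_one qpoch_lim_minus qpoch_lim_minus_Suc qpoch_lim_single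
      using \<rho> \<delta> J by (simp add: power_int_diff power_int_add divide_simps) (simp add: algebra_simps)?
    also have "\<delta> ^ n * \<delta> ^ n / ((- \<delta>) ^ n * (- \<delta>) ^ n) = 1"
      unfolding power_mult_distrib[symmetric] using \<delta> by simp
    also have "fact (Suc n) * fact n / (fact (Suc n) * fact n) = (1 :: real)"
      using 2 by (intro divide_self) (metis mult_eq_0_iff)
    also have "(int J - int j2) / (int J - int j2) = (1 :: real)" using J by (intro divide_self) simp
    finally have *: "vertex_term_lim I J \<delta> \<rho> n (Suc j2) (Suc n) j2 n =
        y ^ n * (y ^ j2 / y ^ n) * y ^ n / (y ^ Suc n * y ^ j2) * 1 * 1 * 1 * ((real I - real n) * real (Suc j2) * \<delta>)"
      unfolding 1 y_def .
    have "y \<noteq> 0" using \<rho> by (simp add: y_def)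
    then show ?thesis unfolding * y_def[symmetric] by (simp add: divide_simps)
  qed
  moreover have "(\<Sum>k\<le>Suc n. if k \<le> n \<and> n + Suc n = 2 * k + 1 then vertex_term_lim I J \<delta> \<rho> n (Suc j2) (Suc n) j2 k else 0)
      = (\<Sum>k\<le>Suc n. if k = n then vertex_term_lim I J \<delta> \<rho> n (Suc j2) (Suc n) j2 k else 0)"
    by (intro sum.cong) auto
  ultimately show ?thesis
    using vertex_weight_offdiag_tendsto[of n "Suc j2" "Suc n" j2 J I] assms by simp
qed

text \<open>Now \<open>k = i2 = n\<close>, so the symbols of the lower parameters are empty. The
  factor \<open>J - j1\<close> comes from the prefactor symbol of index -1, and \<open>Suc n\<close>
  is the quotient of \<open>fact (Suc n)\<close> by \<open>fact n\<close>. The exponent of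
  \<open>\<alpha>\<close> exceeds that of the upward case by one, whence the extra
  \<open>\<rho>\<close>.\<close>

lemma vertex_weight_down_tendsto:
  assumes "Suc j1 \<le> J"
  shows "((\<lambda>L. L * vertex_weight I J (q L) (\<alpha> L) (Suc n) j1 n (Suc j1)) \<longlongrightarrow>
    real (Suc n) * (real J - real j1) * \<delta> * \<rho> / (1 - \<rho>)) at_top"
proof -
  have "vertex_term_lim I J \<delta> \<rho> (Suc n) j1 n (Suc j1) n = real (Suc n) * (real J - real j1) * \<delta> * \<rho> / (1 - \<rho>)"
  proof -
    have e: "int (Suc j1) - int j1 + int n = int (Suc n)" "int j1 - int (Suc j1) = - 1" "n - n = 0"
      by auto
    have 1: "(- \<rho>) ^ n * (1 - inverse \<rho>) ^ n = (1 - \<rho>) ^ n"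
      unfolding power_mult_distrib[symmetric] using \<rho> by (intro arg_cong[of _ _ "\<lambda>x. x ^ n"]) (simp add: field_simps)
    have J: "int J - int j1 \<noteq> 0" using assms by auto
    define y where "y = 1 - \<rho>"
    have z: "qpoch_lim \<delta> p (int 0) = 1" for p by (simp add: qpoch_lim_def)
    have m: "qpoch_lim \<delta> (int J + 1 - int j1) (- 1) = inverse (- (real J - real j1) * \<delta>)"
      by (simp add: qpoch_lim_def)
    have "vertex_term_lim I J \<delta> \<rho> (Suc n) j1 n (Suc j1) n =
      ((- \<rho>) ^ n * (1 - inverse \<rho>) ^ n) * ((1 - \<rho>) ^ Suc j1 / (1 - \<rho>) ^ Suc n) * (1 - \<rho>) ^ n / ((1 - \<rho>) ^ n * (1 - \<rho>) ^ Suc j1)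
       * (\<delta> ^ n * \<delta> ^ n / ((- \<delta>) ^ n * (- \<delta>) ^ n)) * (fact (Suc n) * fact n / (fact n * fact n))
       * ((real J - real j1) * \<delta> * \<rho>)"
      unfolding vertex_term_lim_def e z m qpoch_lim_one qpoch_lim_minus qpoch_lim_minus_Suc
      using \<rho> \<delta> by (simp add: power_int_diff power_int_add divide_simps) (simp add: algebra_simps)?
    also have "\<delta> ^ n * \<delta> ^ n / ((- \<delta>) ^ n * (- \<delta>) ^ n) = 1"
      unfolding power_mult_distrib[symmetric] using \<delta> by simp
    also have "fact (Suc n) * fact n / (fact n * fact n) = real (Suc n)" by simp
    finally have *: "vertex_term_lim I J \<delta> \<rho> (Suc n) j1 n (Suc j1) n =
        y ^ n * (y ^ Suc j1 / y ^ Suc n) * y ^ n / (y ^ n * y ^ Suc j1) * 1 * real (Suc n) * ((real J - real j1) * \<delta> * \<rho>)"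
      unfolding 1 y_def .
    have "y \<noteq> 0" using \<rho> by (simp add: y_def)
    then show ?thesis unfolding * y_def[symmetric] by (simp add: divide_simps)
  qed
  moreover have "(\<Sum>k\<le>n. if k \<le> Suc n \<and> Suc n + n = 2 * k + 1 then vertex_term_lim I J \<delta> \<rho> (Suc n) j1 n (Suc j1) k else 0)
      = (\<Sum>k\<le>n. if k = n then vertex_term_lim I J \<delta> \<rho> (Suc n) j1 n (Suc j1) k else 0)"
    by (intro sum.cong) auto
  ultimately show ?thesis
    using vertex_weight_offdiag_tendsto[of "Suc n" j1 n "Suc j1" J I] assms by simp
qed

lemma vertex_weight_far_tendsto:
  assumes "i1 + j1 = i2 + j2" "j1 \<le> J" "j2 \<le> J" "i1 \<noteq> i2" "i2 \<noteq> Suc i1" "i1 \<noteq> Suc i2"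
  shows "((\<lambda>L. L * vertex_weight I J (q L) (\<alpha> L) i1 j1 i2 j2) \<longlongrightarrow> 0) at_top"
proof -
  have "(\<Sum>k\<le>i2. if k \<le> i1 \<and> i1 + i2 = 2 * k + 1 then vertex_term_lim I J \<delta> \<rho> i1 j1 i2 j2 k else 0) = 0"
    using assms by (intro sum.neutral) auto
  then show ?thesis using vertex_weight_offdiag_tendsto[OF assms(1-4), of I] by simp
qed

end

section \<open>Second moments in the vertex model\<close>

lemma measurable_countable_pair:
  fixes \<phi> :: "nat \<Rightarrow> nat \<Rightarrow> real"
  assumes "f \<in> measurable N (count_space UNIV)" "g \<in> measurable N (count_space UNIV)"
  shows "(\<lambda>\<omega>. \<phi> (f \<omega>) (g \<omega>)) \<in> borel_measurable N"
  using assms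
  by (intro measurable_compose_countable[of "\<lambda>a \<omega>. \<phi> a (g \<omega>)" N borel f]
      measurable_compose_countable[of "\<lambda>b \<omega>. \<phi> _ b" N borel g]) auto

lemma integral_double_sum:
  fixes g :: "'b \<Rightarrow> 'c \<Rightarrow> 'a \<Rightarrow> real"
  assumes "\<And>i j. i \<in> S \<Longrightarrow> j \<in> T \<Longrightarrow> integrable M (g i j)"
  shows "(\<integral>\<omega>. (\<Sum>i\<in>S. \<Sum>j\<in>T. g i j \<omega>) \<partial>M) = (\<Sum>i\<in>S. \<Sum>j\<in>T. \<integral>\<omega>. g i j \<omega> \<partial>M)"
  using assms by (simp add: Bochner_Integration.integral_sum Bochner_Integration.integrable_sum)

text \<open>Stochasticity is a predicate of the input pair: it is established almost surely along
  the random inputs rather than for all rows from the q-series.\<close>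

definition stochastic_row :: "nat \<Rightarrow> nat \<Rightarrow> real \<Rightarrow> real \<Rightarrow> nat \<Rightarrow> nat \<Rightarrow> bool" where
  "stochastic_row I J q \<alpha> a b \<longleftrightarrow> (\<forall>i\<le>I. \<forall>j\<le>J. vertex_weight I J q \<alpha> a b i j \<ge> 0) \<and>
     (\<Sum>i\<le>I. \<Sum>j\<le>J. vertex_weight I J q \<alpha> a b i j) = 1"

text \<open>\<open>D\<close> may ignore the horizontal output because conservation determines it
  from \<open>a\<close>, \<open>b\<close>, \<open>i\<close>. The bounds are conditional on a
  stochastic row, which is the only kind that occurs with positive probability.\<close>

abbreviation moment_bounds ::
    "nat \<Rightarrow> nat \<Rightarrow> real \<Rightarrow> real \<Rightarrow> (nat \<Rightarrow> nat \<Rightarrow> nat \<Rightarrow> real) \<Rightarrow> real \<Rightarrow> real \<Rightarrow> real \<Rightarrow> nat \<Rightarrow> nat \<Rightarrow> bool" where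
  "moment_bounds I J q \<alpha> D c0 c1 c2 a b \<equiv> stochastic_row I J q \<alpha> a b \<longrightarrow>
    (\<Sum>i\<le>I. \<Sum>j\<le>J. vertex_weight I J q \<alpha> a b i j * \<bar>D a b i\<bar>) \<le> c0 \<and>
    \<bar>\<Sum>i\<le>I. \<Sum>j\<le>J. vertex_weight I J q \<alpha> a b i j * D a b i\<bar> \<le> c1 \<and>
    (\<Sum>i\<le>I. \<Sum>j\<le>J. vertex_weight I J q \<alpha> a b i j * (D a b i)\<^sup>2) \<le> c2"

context shs6v
begin

abbreviation ht :: "nat \<Rightarrow> nat \<Rightarrow> 'a \<Rightarrow> real" where
  "ht x y \<omega> \<equiv> height (\<lambda>a b. V a b \<omega>) (\<lambda>a b. E a b \<omega>) x y"

abbreviation weight :: "nat \<Rightarrow> nat \<Rightarrow> nat \<Rightarrow> nat \<Rightarrow> real" where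
  "weight \<equiv> vertex_weight I J q \<alpha>"

abbreviation hist :: "nat \<Rightarrow> nat \<Rightarrow> 'a measure" where
  "hist \<equiv> history M V E"

lemma V_le: "\<omega> \<in> space M \<Longrightarrow> V x y \<omega> \<le> I"
  using measurable_space[OF V_measurable] by simp

lemma E_le: "\<omega> \<in> space M \<Longrightarrow> E x y \<omega> \<le> J"
  using measurable_space[OF E_measurable] by simp

lemma V_meas [measurable]: "V x y \<in> measurable M (count_space UNIV)"
  using measurable_compose[OF V_measurable, of "\<lambda>x. x"] by simp

lemma E_meas [measurable]: "E x y \<in> measurable M (count_space UNIV)"
  using measurable_compose[OF E_measurable, of "\<lambda>x. x"] by simp

section \<open>The history as a sub-sigma-algebra\<close>

lemma space_history: "space (hist x y) = space M"
  by (simp add: history_def space_measure_of_conv)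

lemma subalgebra_history: "subalgebra M (hist x y)"
proof -
  let ?G = "{V a b -` {k} \<inter> space M | a b k.
        b = 0 \<or> (a + b \<le> Suc (x + y) \<and> (a, b) \<noteq> (x, Suc y))} \<union>
     {E a b -` {k} \<inter> space M | a b k.
        a = 0 \<or> (a + b \<le> Suc (x + y) \<and> (a, b) \<noteq> (Suc x, y))}"
  have "?G \<subseteq> sets M" "?G \<subseteq> Pow (space M)"
    using measurable_sets[OF V_meas] measurable_sets[OF E_meas] by auto
  then have "sets (hist x y) \<subseteq> sets M"
    unfolding history_def by (subst sigma_le_sets) auto
  then show ?thesis by (simp add: subalgebra_def space_history)
qed

lemma V_history:
  assumes "b = 0 \<or> (a + b \<le> Suc (x + y) \<and> (a, b) \<noteq> (x, Suc y))"
  shows "V a b \<in> measurable (hist x y) (count_space UNIV)"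
proof -
  have "V a b -` {k} \<inter> space M \<in> sets (hist x y)" for k
    unfolding history_def by (rule in_measure_of) (use assms in auto)
  then show ?thesis
    by (subst measurable_count_space_eq2_countable) (auto simp: space_history)
qed

lemma E_history:
  assumes "a = 0 \<or> (a + b \<le> Suc (x + y) \<and> (a, b) \<noteq> (Suc x, y))"
  shows "E a b \<in> measurable (hist x y) (count_space UNIV)"
proof -
  have "E a b -` {k} \<inter> space M \<in> sets (hist x y)" for k
    unfolding history_def by (rule in_measure_of[OF _ UnI2]) (use assms in auto)
  then show ?thesis
    by (subst measurable_count_space_eq2_countable) (auto simp: space_history)
qed

text \<open>The height at \<open>(x', y')\<close> reads the left boundary, contained in every
  history, and the vertical edges of row \<open>y'\<close> to the left of \<open>x'\<close>.\<close>

lemma ht_history: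
  assumes "\<And>i. i < x' \<Longrightarrow> i + y' \<le> Suc (x + y) \<and> (i, y') \<noteq> (x, Suc y)"
  shows "ht x' y' \<in> borel_measurable (hist x y)"
proof -
  have "(\<lambda>\<omega>. real (E 0 j \<omega>)) \<in> borel_measurable (hist x y)" for j
    by (rule measurable_compose[OF E_history]) auto
  moreover have "(\<lambda>\<omega>. real (V (i - 1) y' \<omega>)) \<in> borel_measurable (hist x y)" if "i \<in> {1..x'}" for i
  proof (rule measurable_compose[OF V_history])
    have "i - 1 < x'" using that by auto
    then show "y' = 0 \<or> (i - 1 + y' \<le> Suc (x + y) \<and> (i - 1, y') \<noteq> (x, Suc y))"
      using assms by blast
  qed simp
  ultimately show ?thesis
    unfolding height_def by (intro borel_measurable_diff borel_measurable_sum)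
qed

lemma finite_state_bound:
  fixes \<phi> :: "nat \<Rightarrow> nat \<Rightarrow> nat \<Rightarrow> nat \<Rightarrow> real"
  obtains K where "K \<ge> 0" "\<And>a b i j. a \<le> I \<Longrightarrow> b \<le> J \<Longrightarrow> i \<le> I \<Longrightarrow> j \<le> J \<Longrightarrow> \<bar>\<phi> a b i j\<bar> \<le> K"
proof
  let ?S = "(\<lambda>(a, b, i, j). \<bar>\<phi> a b i j\<bar>) ` ({..I} \<times> {..J} \<times> {..I} \<times> {..J})"
  have fin: "finite ?S" by simp
  show le: "\<bar>\<phi> a b i j\<bar> \<le> Max ?S" if "a \<le> I" "b \<le> J" "i \<le> I" "j \<le> J" for a b i j
    by (rule Max_ge[OF fin]) (use that in \<open>auto intro!: rev_image_eqI[of "(a, b, i, j)"]\<close>)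
  show "Max ?S \<ge> 0" using le[of 0 0 0 0] by linarith
qed

lemma integrable_bounded:
  assumes "f \<in> borel_measurable M" "\<And>\<omega>. \<omega> \<in> space M \<Longrightarrow> \<bar>f \<omega>\<bar> \<le> (K :: real)"
  shows "integrable M f"
  using assms by (intro integrable_const_bound[of _ K] AE_I2) auto

text \<open>Splitting over the finitely many outputs, each event indicator is replaced by its
  conditional expectation, the weight; \<open>Z\<close> and the dependence on the inputs are
  measurable for the history and can be pulled out. All later uses of the dynamics pass through this
  identity or through the transition law itself.\<close>

lemma transition_integral:
  fixes \<phi> :: "nat \<Rightarrow> nat \<Rightarrow> nat \<Rightarrow> nat \<Rightarrow> real"
  assumes Z: "Z \<in> borel_measurable (hist x y)"
    and KZ: "\<And>\<omega>. \<omega> \<in> space M \<Longrightarrow> \<bar>Z \<omega>\<bar> \<le> KZ"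
  shows "(\<integral>\<omega>. Z \<omega> * \<phi> (V x y \<omega>) (E x y \<omega>) (V x (Suc y) \<omega>) (E (Suc x) y \<omega>) \<partial>M) =
    (\<integral>\<omega>. Z \<omega> * (\<Sum>i\<le>I. \<Sum>j\<le>J. weight (V x y \<omega>) (E x y \<omega>) i j * \<phi> (V x y \<omega>) (E x y \<omega>) i j) \<partial>M)"
proof -
  interpret H: finite_measure_subalgebra M "hist x y"
    by unfold_locales (rule subalgebra_history)
  define A where "A i j = {\<omega> \<in> space M. V x (Suc y) \<omega> = i \<and> E (Suc x) y \<omega> = j}" for i j
  have A [measurable]: "A i j \<in> sets M" for i j unfolding A_def by measurable
  define f where "f i j \<omega> = Z \<omega> * \<phi> (V x y \<omega>) (E x y \<omega>) i j" for i j \<omega>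
  have VE: "V x y \<in> measurable (hist x y) (count_space UNIV)"
    "E x y \<in> measurable (hist x y) (count_space UNIV)"
    by (auto intro!: V_history E_history)
  have fH: "f i j \<in> borel_measurable (hist x y)" for i j
    unfolding f_def by (intro borel_measurable_times Z measurable_countable_pair VE)
  have fM [measurable]: "f i j \<in> borel_measurable M" for i j
    by (rule measurable_from_subalg[OF subalgebra_history fH])
  have wM [measurable]: "(\<lambda>\<omega>. weight (V x y \<omega>) (E x y \<omega>) i j) \<in> borel_measurable M" for i j
    by (intro measurable_countable_pair) measurable
  obtain K where K: "K \<ge> 0"
    "\<And>a b i j. a \<le> I \<Longrightarrow> b \<le> J \<Longrightarrow> i \<le> I \<Longrightarrow> j \<le> J \<Longrightarrow> \<bar>\<phi> a b i j\<bar> \<le> K"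
    using finite_state_bound[of \<phi>] by metis
  obtain K' where K': "K' \<ge> 0"
    "\<And>a b i j. a \<le> I \<Longrightarrow> b \<le> J \<Longrightarrow> i \<le> I \<Longrightarrow> j \<le> J \<Longrightarrow> \<bar>weight a b i j\<bar> \<le> K'"
    using finite_state_bound[of weight] by metis
  have f_le: "\<bar>f i j \<omega>\<bar> \<le> KZ * K" if "\<omega> \<in> space M" "i \<le> I" "j \<le> J" for i j \<omega>
    unfolding f_def abs_mult
    using KZ[OF that(1)] K V_le[OF that(1)] E_le[OF that(1)] that(2,3) abs_ge_zero[of "Z \<omega>"]
    by (intro mult_mono) auto
  have int1: "integrable M (\<lambda>\<omega>. f i j \<omega> * indicator (A i j) \<omega>)" if "i \<le> I" "j \<le> J" for i j
    by (rule integrable_bounded[of _ "KZ * K"])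
      (use f_le[OF _ that] in \<open>auto simp: abs_mult split: split_indicator intro: order_trans[OF abs_ge_zero]\<close>)
  have int2: "integrable M (\<lambda>\<omega>. f i j \<omega> * weight (V x y \<omega>) (E x y \<omega>) i j)" if "i \<le> I" "j \<le> J" for i j
  proof (rule integrable_bounded[of _ "(KZ * K) * K'"])
    fix \<omega> assume \<omega>: "\<omega> \<in> space M"
    show "\<bar>f i j \<omega> * weight (V x y \<omega>) (E x y \<omega>) i j\<bar> \<le> (KZ * K) * K'"
      unfolding abs_mult
      using f_le[OF \<omega> that] K'(2)[OF V_le[OF \<omega>] E_le[OF \<omega>] that]
      by (intro mult_mono order_trans[OF abs_ge_zero f_le[OF \<omega> that]]) auto
  qed measurable
  have eq: "(\<integral>\<omega>. f i j \<omega> * indicator (A i j) \<omega> \<partial>M) = (\<integral>\<omega>. f i j \<omega> * weight (V x y \<omega>) (E x y \<omega>) i j \<partial>M)"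
    if "i \<le> I" "j \<le> J" for i j
  proof -
    have "(\<integral>\<omega>. f i j \<omega> * indicator (A i j) \<omega> \<partial>M)
        = (\<integral>\<omega>. f i j \<omega> * real_cond_exp M (hist x y) (indicator (A i j)) \<omega> \<partial>M)"
      by (rule H.real_cond_exp_intg(2)[symmetric]) (use int1[OF that] fH in auto)
    also have "\<dots> = (\<integral>\<omega>. f i j \<omega> * weight (V x y \<omega>) (E x y \<omega>) i j \<partial>M)"
    proof (rule integral_cong_AE)
      show "AE \<omega> in M. f i j \<omega> * real_cond_exp M (hist x y) (indicator (A i j)) \<omega> =
          f i j \<omega> * weight (V x y \<omega>) (E x y \<omega>) i j"
        using transition[OF that, of x y] unfolding A_def by eventually_elim simp
    qed measurable
    finally show ?thesis .
  qed
  have "(\<integral>\<omega>. Z \<omega> * \<phi> (V x y \<omega>) (E x y \<omega>) (V x (Suc y) \<omega>) (E (Suc x) y \<omega>) \<partial>M)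
      = (\<integral>\<omega>. (\<Sum>i\<le>I. \<Sum>j\<le>J. f i j \<omega> * indicator (A i j) \<omega>) \<partial>M)"
  proof (rule Bochner_Integration.integral_cong)
    fix \<omega> assume \<omega>: "\<omega> \<in> space M"
    have "(\<Sum>i\<le>I. \<Sum>j\<le>J. f i j \<omega> * indicator (A i j) \<omega>)
        = (\<Sum>i\<le>I. \<Sum>j\<le>J. if i = V x (Suc y) \<omega> then if j = E (Suc x) y \<omega> then f i j \<omega> else 0 else 0)"
      using \<omega> by (intro sum.cong) (auto simp: A_def)
    also have "\<dots> = (\<Sum>i\<le>I. if i = V x (Suc y) \<omega> then \<Sum>j\<le>J. if j = E (Suc x) y \<omega> then f i j \<omega> else 0 else 0)"
      by (intro sum.cong) auto
    also have "\<dots> = f (V x (Suc y) \<omega>) (E (Suc x) y \<omega>) \<omega>"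
      using V_le[OF \<omega>, of x "Suc y"] E_le[OF \<omega>, of "Suc x" y] by simp
    finally show "Z \<omega> * \<phi> (V x y \<omega>) (E x y \<omega>) (V x (Suc y) \<omega>) (E (Suc x) y \<omega>) =
        (\<Sum>i\<le>I. \<Sum>j\<le>J. f i j \<omega> * indicator (A i j) \<omega>)"
      by (simp add: f_def)
  qed simp
  also have "\<dots> = (\<Sum>i\<le>I. \<Sum>j\<le>J. \<integral>\<omega>. f i j \<omega> * indicator (A i j) \<omega> \<partial>M)"
    by (rule integral_double_sum) (simp add: int1)
  also have "\<dots> = (\<Sum>i\<le>I. \<Sum>j\<le>J. \<integral>\<omega>. f i j \<omega> * weight (V x y \<omega>) (E x y \<omega>) i j \<partial>M)"
    by (intro sum.cong eq) auto
  also have "\<dots> = (\<integral>\<omega>. (\<Sum>i\<le>I. \<Sum>j\<le>J. f i j \<omega> * weight (V x y \<omega>) (E x y \<omega>) i j) \<partial>M)"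
    by (rule integral_double_sum[symmetric]) (simp add: int2)
  also have "\<dots> = (\<integral>\<omega>. Z \<omega> * (\<Sum>i\<le>I. \<Sum>j\<le>J. weight (V x y \<omega>) (E x y \<omega>) i j * \<phi> (V x y \<omega>) (E x y \<omega>) i j) \<partial>M)"
    by (simp add: f_def sum_distrib_left mult_ac)
  finally show ?thesis .
qed

text \<open>The transition law, tested against the indicator of a violated conservation law, gives 0
  because the weights vanish there. Countably many vertices make the statement simultaneous.\<close>

lemma conservation: "AE \<omega> in M. \<forall>x y. V x y \<omega> + E x y \<omega> = V x (Suc y) \<omega> + E (Suc x) y \<omega>"
proof -
  have "AE \<omega> in M. V x y \<omega> + E x y \<omega> = V x (Suc y) \<omega> + E (Suc x) y \<omega>" for x y
  proof -
    define \<phi> :: "nat \<Rightarrow> nat \<Rightarrow> nat \<Rightarrow> nat \<Rightarrow> real" where "\<phi> a b i j = of_bool (a + b \<noteq> i + j)" for a b i j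
    define f where "f \<omega> = \<phi> (V x y \<omega>) (E x y \<omega>) (V x (Suc y) \<omega>) (E (Suc x) y \<omega>)" for \<omega>
    have "(\<integral>\<omega>. 1 * f \<omega> \<partial>M) = (\<integral>\<omega>. 1 * (\<Sum>i\<le>I. \<Sum>j\<le>J. weight (V x y \<omega>) (E x y \<omega>) i j * \<phi> (V x y \<omega>) (E x y \<omega>) i j) \<partial>M)"
      unfolding f_def by (rule transition_integral[of _ _ _ 1]) auto
    also have "\<dots> = 0"
      by (simp add: \<phi>_def vertex_weight_def Let_def)
    finally have "(\<integral>\<omega>. f \<omega> \<partial>M) = 0" by simp
    moreover have "integrable M f"
    proof (rule integrable_bounded[of _ 1])
      have "f = (\<lambda>\<omega>. if real (V x y \<omega>) + real (E x y \<omega>) = real (V x (Suc y) \<omega>) + real (E (Suc x) y \<omega>) then 0 else 1)"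
        by (auto simp: f_def \<phi>_def fun_eq_iff simp flip: of_nat_add)
      then show "f \<in> borel_measurable M" by simp
    qed (auto simp: f_def \<phi>_def)
    ultimately have "AE \<omega> in M. f \<omega> = 0"
      by (subst (asm) integral_nonneg_eq_0_iff_AE) (auto simp: f_def \<phi>_def)
    then show ?thesis by eventually_elim (auto simp: f_def \<phi>_def)
  qed
  then show ?thesis by (simp add: AE_all_countable)
qed

text \<open>Nonnegativity is inherited from conditional expectations of indicators. If
  \<open>Z\<close> is the row sum minus one, testing the constant function 1 against
  \<open>Z\<close> gives E Z = E (Z (Z + 1)), so E Z^2 = 0.\<close>

lemma AE_stochastic_row: "AE \<omega> in M. stochastic_row I J q \<alpha> (V x y \<omega>) (E x y \<omega>)"
proof -
  interpret H: finite_measure_subalgebra M "hist x y"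
    by unfold_locales (rule subalgebra_history)
  have VE: "V x y \<in> measurable (hist x y) (count_space UNIV)"
    "E x y \<in> measurable (hist x y) (count_space UNIV)"
    by (auto intro!: V_history E_history)
  have nonneg: "AE \<omega> in M. weight (V x y \<omega>) (E x y \<omega>) i j \<ge> 0" if "i \<le> I" "j \<le> J" for i j
  proof -
    have "AE \<omega> in M. real_cond_exp M (hist x y)
        (indicator {\<omega> \<in> space M. V x (Suc y) \<omega> = i \<and> E (Suc x) y \<omega> = j}) \<omega> \<ge> 0"
      by (rule H.real_cond_exp_pos) (auto intro!: borel_measurable_indicator)
    with transition[OF that, of x y] show ?thesis by eventually_elim simp
  qed
  have all: "AE \<omega> in M. \<forall>i\<in>{..I}. \<forall>j\<in>{..J}. weight (V x y \<omega>) (E x y \<omega>) i j \<ge> 0"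
    by (intro AE_finite_allI finite_atMost nonneg) auto
  define Z where "Z \<omega> = (\<Sum>i\<le>I. \<Sum>j\<le>J. weight (V x y \<omega>) (E x y \<omega>) i j) - 1" for \<omega>
  have ZH: "Z \<in> borel_measurable (hist x y)"
    unfolding Z_def by (intro measurable_countable_pair[of _ _ _ "\<lambda>a b. (\<Sum>i\<le>I. \<Sum>j\<le>J. weight a b i j) - 1"] VE)
  have ZM: "Z \<in> borel_measurable M" by (rule measurable_from_subalg[OF subalgebra_history ZH])
  obtain K where K: "\<And>a b i j. a \<le> I \<Longrightarrow> b \<le> J \<Longrightarrow> i \<le> I \<Longrightarrow> j \<le> J \<Longrightarrow>
      \<bar>(\<Sum>i\<le>I. \<Sum>j\<le>J. weight a b i j) - 1\<bar> \<le> K"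
    using finite_state_bound[of "\<lambda>a b _ _. (\<Sum>i\<le>I. \<Sum>j\<le>J. weight a b i j) - 1"] by metis
  have ZK: "\<bar>Z \<omega>\<bar> \<le> K" if "\<omega> \<in> space M" for \<omega>
    unfolding Z_def using K[of "V x y \<omega>" "E x y \<omega>" 0 0] V_le[OF that] E_le[OF that] by simp
  have int_ZZ: "integrable M (\<lambda>\<omega>. Z \<omega> * Z \<omega>)"
  proof (rule integrable_bounded[of _ "K * K"])
    fix \<omega> assume "\<omega> \<in> space M"
    then show "\<bar>Z \<omega> * Z \<omega>\<bar> \<le> K * K"
      unfolding abs_mult using ZK[of \<omega>] by (intro mult_mono) auto
  qed (intro borel_measurable_times ZM)
  have "(\<integral>\<omega>. Z \<omega> * 1 \<partial>M) = (\<integral>\<omega>. Z \<omega> * (\<Sum>i\<le>I. \<Sum>j\<le>J. weight (V x y \<omega>) (E x y \<omega>) i j * 1) \<partial>M)"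
    using transition_integral[OF ZH ZK, of "\<lambda>_ _ _ _. 1"] by simp
  also have "\<dots> = (\<integral>\<omega>. Z \<omega> * Z \<omega> + Z \<omega> \<partial>M)"
    by (simp add: Z_def algebra_simps)
  also have "\<dots> = (\<integral>\<omega>. Z \<omega> * Z \<omega> \<partial>M) + (\<integral>\<omega>. Z \<omega> \<partial>M)"
    by (rule Bochner_Integration.integral_add[OF int_ZZ integrable_bounded[OF ZM ZK]])
  finally have "(\<integral>\<omega>. Z \<omega> * Z \<omega> \<partial>M) = 0" by simp
  moreover note int_ZZ
  ultimately have "AE \<omega> in M. Z \<omega> * Z \<omega> = 0"
    by (subst (asm) integral_nonneg_eq_0_iff_AE) auto
  with all show ?thesis
    by eventually_elim (auto simp: stochastic_row_def Z_def)
qed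

text \<open>
  Off the diagonal the two factors are decorrelated by conditioning on the history of the later
  vertex; this is why only the conditional mean \<open>c1\<close> and the first absolute moment \<open>c0\<close> enter there.
\<close>

lemma second_moment_bound:
  fixes F :: "nat \<Rightarrow> nat \<Rightarrow> nat \<Rightarrow> real" and s :: real
  defines "\<zeta> \<equiv> \<lambda>x y \<omega>. exp (s * ht x y \<omega>) * F (V x y \<omega>) (E x y \<omega>) (V x (Suc y) \<omega>)"
  assumes c: "c0 \<ge> 0" "c1 \<ge> 0" "c2 \<ge> 0"
    and c0: "\<And>a b. a \<le> I \<Longrightarrow> b \<le> J \<Longrightarrow> stochastic_row I J q \<alpha> a b \<Longrightarrow> (\<Sum>i\<le>I. \<Sum>j\<le>J. weight a b i j * \<bar>F a b i\<bar>) \<le> c0"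
    and c1: "\<And>a b. a \<le> I \<Longrightarrow> b \<le> J \<Longrightarrow> stochastic_row I J q \<alpha> a b \<Longrightarrow> \<bar>\<Sum>i\<le>I. \<Sum>j\<le>J. weight a b i j * F a b i\<bar> \<le> c1"
    and c2: "\<And>a b. a \<le> I \<Longrightarrow> b \<le> J \<Longrightarrow> stochastic_row I J q \<alpha> a b \<Longrightarrow> (\<Sum>i\<le>I. \<Sum>j\<le>J. weight a b i j * (F a b i)\<^sup>2) \<le> c2"
    and K: "K \<ge> 0" "\<And>x y \<omega>. x < X \<Longrightarrow> y < Y \<Longrightarrow> \<omega> \<in> space M \<Longrightarrow> exp (s * ht x y \<omega>) \<le> K"
  shows "integrable M (\<lambda>\<omega>. (\<Sum>x<X. \<Sum>y<Y. \<zeta> x y \<omega>)\<^sup>2)"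
    and "(\<integral>\<omega>. (\<Sum>x<X. \<Sum>y<Y. \<zeta> x y \<omega>)\<^sup>2 \<partial>M) \<le> (real X * real Y)\<^sup>2 * (K\<^sup>2 * c0 * c1) + real X * real Y * (K\<^sup>2 * c2)"
proof -
  let ?F = "\<lambda>x y \<omega>. F (V x y \<omega>) (E x y \<omega>) (V x (Suc y) \<omega>)"
  let ?mean = "\<lambda>g x y \<omega>. \<Sum>i\<le>I. \<Sum>j\<le>J.
    weight (V x y \<omega>) (E x y \<omega>) i j * g (V x y \<omega>) (E x y \<omega>) i"
  obtain KF where KF: "KF \<ge> 0" "\<And>a b i j. a \<le> I \<Longrightarrow> b \<le> J \<Longrightarrow> i \<le> I \<Longrightarrow> j \<le> J \<Longrightarrow> \<bar>F a b i\<bar> \<le> KF"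
    using finite_state_bound[of "\<lambda>a b i _. F a b i"] by metis
  define u where "u x y \<omega> = exp (s * ht x y \<omega>)" for x y \<omega>
  have u_pos: "u x y \<omega> > 0" for x y \<omega> by (simp add: u_def)
  have u_le: "\<bar>u x y \<omega>\<bar> \<le> K" if "x < X" "y < Y" "\<omega> \<in> space M" for x y \<omega>
    using K(2)[OF that] by (simp add: u_def)
  have u_hist: "u x' y' \<in> borel_measurable (hist x y)"
    if "x' + y' \<le> x + y" for x y x' y'
    unfolding u_def using that
    by (intro borel_measurable_exp measurable_compose[OF _ borel_measurable_exp] borel_measurable_times
        borel_measurable_const ht_history) auto
  have u_meas [measurable]: "u x y \<in> borel_measurable M" for x y
    by (rule measurable_from_subalg[OF subalgebra_history u_hist[of x y x y]]) simp
  have F_hist: "(\<lambda>\<omega>. ?F x' y' \<omega>) \<in> borel_measurable (hist x y)"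
    if "x' + y' \<le> x + y" "(x', y') \<noteq> (x, y)" for x y x' y'
  proof (rule measurable_compose_countable[of "\<lambda>i \<omega>. F (V x' y' \<omega>) (E x' y' \<omega>) i" _ _ "V x' (Suc y')"])
    show "(\<lambda>\<omega>. F (V x' y' \<omega>) (E x' y' \<omega>) i) \<in> borel_measurable (hist x y)" for i
      by (rule measurable_countable_pair[of _ _ _ "\<lambda>a b. F a b i"]) (use that in \<open>auto intro!: V_history E_history\<close>)
    show "V x' (Suc y') \<in> measurable (hist x y) (count_space UNIV)"
      using that by (intro V_history) auto
  qed
  \<comment> \<open>The history of the right neighbour already contains the outputs of
    \<open>(x, y)\<close>.\<close>
  have F_meas [measurable]: "(\<lambda>\<omega>. ?F x y \<omega>) \<in> borel_measurable M" for x y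
    by (rule measurable_from_subalg[OF subalgebra_history F_hist[of x y "Suc x" y]]) auto
  have F_le: "\<bar>?F x y \<omega>\<bar> \<le> KF" if "\<omega> \<in> space M" for x y \<omega>
    using KF(2)[of _ _ _ 0] V_le[OF that] E_le[OF that] by simp
  have \<zeta>: "\<zeta> x y \<omega> = u x y \<omega> * ?F x y \<omega>" for x y \<omega>
    by (simp add: \<zeta>_def u_def)
  have \<zeta>_meas [measurable]: "\<zeta> x y \<in> borel_measurable M" for x y
    unfolding \<zeta> by measurable
  have \<zeta>_le: "\<bar>\<zeta> x y \<omega>\<bar> \<le> K * KF" if "x < X" "y < Y" "\<omega> \<in> space M" for x y \<omega>
    unfolding \<zeta> abs_mult using u_le[OF that] F_le[OF that(3)] K(1) by (intro mult_mono) auto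
  have int_prod: "integrable M (\<lambda>\<omega>. \<zeta> x y \<omega> * \<zeta> x' y' \<omega>)"
    if "x < X" "y < Y" "x' < X" "y' < Y" for x y x' y'
  proof (rule integrable_bounded[of _ "(K * KF) * (K * KF)"])
    show "\<bar>\<zeta> x y \<omega> * \<zeta> x' y' \<omega>\<bar> \<le> (K * KF) * (K * KF)" if "\<omega> \<in> space M" for \<omega>
      unfolding abs_mult using \<zeta>_le \<open>x < X\<close> \<open>y < Y\<close> \<open>x' < X\<close> \<open>y' < Y\<close> that K(1) KF(1)
      by (intro mult_mono) auto
  qed measurable
  have mean: "(\<integral>\<omega>. \<bar>\<zeta> x y \<omega>\<bar> \<partial>M) \<le> K * c0" if "x < X" "y < Y" for x y
  proof -
    have "(\<integral>\<omega>. \<bar>\<zeta> x y \<omega>\<bar> \<partial>M) = (\<integral>\<omega>. u x y \<omega> * \<bar>?F x y \<omega>\<bar> \<partial>M)"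
      using less_imp_le[OF u_pos] by (simp add: \<zeta> abs_mult)
    also have "\<dots> = (\<integral>\<omega>. u x y \<omega> * ?mean (\<lambda>a b i. \<bar>F a b i\<bar>) x y \<omega> \<partial>M)"
      by (rule transition_integral[of _ _ _ K "\<lambda>a b i _. \<bar>F a b i\<bar>"]) (use u_hist u_le that in auto)
    also have "\<dots> \<le> (\<integral>\<omega>. K * c0 \<partial>M)"
    proof (rule integral_mono_AE')
      show "AE \<omega> in M. u x y \<omega> * ?mean (\<lambda>a b i. \<bar>F a b i\<bar>) x y \<omega> \<le> K * c0"
        using AE_stochastic_row[of x y] AE_space
      proof eventually_elim
        case (elim \<omega>)
        then show ?case
          using u_le[OF that elim(2)] less_imp_le[OF u_pos] c0[OF V_le[OF elim(2)] E_le[OF elim(2)] elim(1)] K(1) c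
          by (intro mult_mono') (auto intro!: sum_nonneg mult_nonneg_nonneg simp: stochastic_row_def)
      qed
    qed (use K c in auto)
    finally show ?thesis by (simp add: prob_space)
  qed
  have cross: "(\<integral>\<omega>. \<zeta> x y \<omega> * \<zeta> x' y' \<omega> \<partial>M) \<le> K\<^sup>2 * c0 * c1"
    if "x < X" "y < Y" "x' < X" "y' < Y" and neq: "(x', y') \<noteq> (x, y)" and le: "x' + y' \<le> x + y" for x y x' y'
  proof -
    \<comment> \<open>Everything but the \<open>F\<close> factor of the later vertex. The
      exponential there depends on edges entering before it, and the earlier summand is known to its
      history, even if both vertices lie on the same diagonal.\<close>
    define Z where "Z \<omega> = u x y \<omega> * \<zeta> x' y' \<omega>" for \<omega>
    have Z_hist: "Z \<in> borel_measurable (hist x y)"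
      unfolding Z_def \<zeta> using le neq by (intro borel_measurable_times u_hist F_hist) auto
    have Z_le: "\<bar>Z \<omega>\<bar> \<le> K * (K * KF)" if "\<omega> \<in> space M" for \<omega>
      unfolding Z_def abs_mult
      using u_le[of x y \<omega>] \<zeta>_le[of x' y' \<omega>] \<open>x < X\<close> \<open>y < Y\<close> \<open>x' < X\<close> \<open>y' < Y\<close> that K(1)
      by (intro mult_mono) auto
    have "(\<integral>\<omega>. \<zeta> x y \<omega> * \<zeta> x' y' \<omega> \<partial>M) = (\<integral>\<omega>. Z \<omega> * ?F x y \<omega> \<partial>M)"
      by (simp add: Z_def \<zeta> mult_ac)
    also have "\<dots> = (\<integral>\<omega>. Z \<omega> * ?mean F x y \<omega> \<partial>M)"
      by (rule transition_integral[OF Z_hist Z_le, of "\<lambda>a b i _. F a b i"])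
    also have "\<dots> \<le> (\<integral>\<omega>. K * c1 * \<bar>\<zeta> x' y' \<omega>\<bar> \<partial>M)"
    proof (rule integral_mono_AE')
      have "integrable M (\<lambda>\<omega>. \<bar>\<zeta> x' y' \<omega>\<bar>)"
        by (rule integrable_bounded[of _ "K * KF"]) (use \<zeta>_le that in auto)
      then show "integrable M (\<lambda>\<omega>. K * c1 * \<bar>\<zeta> x' y' \<omega>\<bar>)" by simp
      show "AE \<omega> in M. Z \<omega> * ?mean F x y \<omega>
          \<le> K * c1 * \<bar>\<zeta> x' y' \<omega>\<bar>"
        using AE_stochastic_row[of x y] AE_space
      proof eventually_elim
        case (elim \<omega>)
        define S where "S = ?mean F x y \<omega>"
        have S: "\<bar>S\<bar> \<le> c1" unfolding S_def using c1[OF V_le[OF elim(2)] E_le[OF elim(2)] elim(1)] .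
        have "Z \<omega> * S \<le> \<bar>Z \<omega>\<bar> * \<bar>S\<bar>" by (metis abs_ge_self abs_mult)
        also have "\<dots> = \<bar>u x y \<omega>\<bar> * \<bar>S\<bar> * \<bar>\<zeta> x' y' \<omega>\<bar>" by (simp add: Z_def abs_mult mult_ac)
        also have "\<dots> \<le> K * c1 * \<bar>\<zeta> x' y' \<omega>\<bar>"
          using u_le[OF that(1,2) elim(2)] S K(1) by (intro mult_right_mono mult_mono) auto
        finally show ?case by (simp add: S_def)
      qed
    qed (use K c in auto)
    also have "\<dots> = K * c1 * (\<integral>\<omega>. \<bar>\<zeta> x' y' \<omega>\<bar> \<partial>M)" by simp
    also have "\<dots> \<le> K * c1 * (K * c0)"
      using mean[OF that(3,4)] K c by (intro mult_left_mono) auto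
    finally show ?thesis by (simp add: power2_eq_square mult_ac)
  qed
  have diag: "(\<integral>\<omega>. \<zeta> x y \<omega> * \<zeta> x y \<omega> \<partial>M) \<le> K\<^sup>2 * c2" if "x < X" "y < Y" for x y
  proof -
    have u2: "\<bar>u x y \<omega> * u x y \<omega>\<bar> \<le> K * K" if "\<omega> \<in> space M" for \<omega>
      unfolding abs_mult using u_le[OF \<open>x < X\<close> \<open>y < Y\<close> that] K(1) by (intro mult_mono) auto
    have "(\<integral>\<omega>. \<zeta> x y \<omega> * \<zeta> x y \<omega> \<partial>M) = (\<integral>\<omega>. (u x y \<omega> * u x y \<omega>) * (?F x y \<omega>)\<^sup>2 \<partial>M)"
      by (simp add: \<zeta> power2_eq_square mult_ac)
    also have "\<dots> = (\<integral>\<omega>. (u x y \<omega> * u x y \<omega>) * ?mean (\<lambda>a b i. (F a b i)\<^sup>2) x y \<omega> \<partial>M)"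
      by (rule transition_integral[of _ _ _ "K * K" "\<lambda>a b i _. (F a b i)\<^sup>2"])
        (use u_hist u2 in \<open>auto intro!: borel_measurable_times\<close>)
    also have "\<dots> \<le> (\<integral>\<omega>. (K * K) * c2 \<partial>M)"
    proof (rule integral_mono_AE')
      show "AE \<omega> in M. (u x y \<omega> * u x y \<omega>) * ?mean (\<lambda>a b i. (F a b i)\<^sup>2) x y \<omega> \<le> (K * K) * c2"
        using AE_stochastic_row[of x y] AE_space
      proof eventually_elim
        case (elim \<omega>)
        have "u x y \<omega> * u x y \<omega> \<le> K * K" using u2[OF elim(2)] by linarith
        then show ?case
          using less_imp_le[OF u_pos] c2[OF V_le[OF elim(2)] E_le[OF elim(2)] elim(1)] K(1) c elim(1)
          by (intro mult_mono[of "u x y \<omega> * u x y \<omega>"]) (auto intro!: sum_nonneg mult_nonneg_nonneg simp: stochastic_row_def)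
      qed
    qed (use K c in auto)
    finally show ?thesis by (simp add: prob_space power2_eq_square)
  qed
  have pair: "(\<integral>\<omega>. \<zeta> x y \<omega> * \<zeta> x' y' \<omega> \<partial>M) \<le> K\<^sup>2 * c0 * c1 + (if (x, y) = (x', y') then K\<^sup>2 * c2 else 0)"
    if *: "x < X" "y < Y" "x' < X" "y' < Y" for x y x' y'
  proof (cases "(x, y) = (x', y')")
    case True
    then have eq: "x' = x" "y' = y" by auto
    have "0 \<le> K\<^sup>2 * c0 * c1" using c by simp
    then show ?thesis using diag[OF *(1,2)] unfolding eq by simp
  next
    case False
    then have eq: "(if (x, y) = (x', y') then K\<^sup>2 * c2 else 0) = 0" by (simp only: if_False)
    from False consider "x' + y' \<le> x + y" "(x', y') \<noteq> (x, y)" | "x + y \<le> x' + y'" "(x, y) \<noteq> (x', y')"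
      using nat_le_linear[of "x' + y'" "x + y"] False by auto
    then show ?thesis
    proof cases
      case 1
      then show ?thesis unfolding eq using cross[OF * 1(2,1)] by simp
    next
      case 2
      then show ?thesis unfolding eq using cross[OF *(3,4,1,2) 2(2,1)] by (simp add: mult.commute)
    qed
  qed
  define P where "P = {..<X} \<times> {..<Y}"
  have sq: "(\<Sum>x<X. \<Sum>y<Y. \<zeta> x y \<omega>)\<^sup>2 = (\<Sum>p\<in>P. \<Sum>p'\<in>P. \<zeta> (fst p) (snd p) \<omega> * \<zeta> (fst p') (snd p') \<omega>)" for \<omega>
    by (simp add: P_def sum.cartesian_product power2_eq_square sum_product case_prod_unfold)
  have intP: "integrable M (\<lambda>\<omega>. \<zeta> (fst p) (snd p) \<omega> * \<zeta> (fst p') (snd p') \<omega>)" if "p \<in> P" "p' \<in> P" for p p'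
    using that by (intro int_prod) (auto simp: P_def)
  show "integrable M (\<lambda>\<omega>. (\<Sum>x<X. \<Sum>y<Y. \<zeta> x y \<omega>)\<^sup>2)"
    unfolding sq by (intro Bochner_Integration.integrable_sum intP)
  have "(\<integral>\<omega>. (\<Sum>x<X. \<Sum>y<Y. \<zeta> x y \<omega>)\<^sup>2 \<partial>M) = (\<Sum>p\<in>P. \<Sum>p'\<in>P. \<integral>\<omega>. \<zeta> (fst p) (snd p) \<omega> * \<zeta> (fst p') (snd p') \<omega> \<partial>M)"
    unfolding sq by (rule integral_double_sum) (rule intP)
  also have "\<dots> \<le> (\<Sum>p\<in>P. \<Sum>p'\<in>P. K\<^sup>2 * c0 * c1 + (if p = p' then K\<^sup>2 * c2 else 0))"
  proof (intro sum_mono)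
    fix p p' assume "p \<in> P" "p' \<in> P"
    then show "(\<integral>\<omega>. \<zeta> (fst p) (snd p) \<omega> * \<zeta> (fst p') (snd p') \<omega> \<partial>M) \<le> K\<^sup>2 * c0 * c1 + (if p = p' then K\<^sup>2 * c2 else 0)"
      using pair[of "fst p" "snd p" "fst p'" "snd p'"] by (simp add: P_def mem_Times_iff prod_eq_iff)
  qed
  also have "\<dots> = real (card P) * (real (card P) * (K\<^sup>2 * c0 * c1)) + real (card P) * (K\<^sup>2 * c2)"
    by (simp add: sum.distrib P_def distrib_left)
  also have "real (card P) = real X * real Y" by (simp add: P_def)
  finally show "(\<integral>\<omega>. (\<Sum>x<X. \<Sum>y<Y. \<zeta> x y \<omega>)\<^sup>2 \<partial>M) \<le> (real X * real Y)\<^sup>2 * (K\<^sup>2 * c0 * c1) + real X * real Y * (K\<^sup>2 * c2)"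
    by (simp only: power2_eq_square mult.assoc)
qed

end

section \<open>Height functions and approximate residuals\<close>

lemma lin_interp_of_nat: "lin_interp f (real n) = f n"
  by (simp add: lin_interp_def frac_def)

text \<open>The cell formula is valid on the closed cell: at its right end the floor jumps, but the
  next cell gives the same value. This removes case distinctions at lattice points.\<close>

lemma lin_interp_eq:
  assumes "real n \<le> x" "x \<le> real (Suc n)"
  shows "lin_interp f x = f n + (x - real n) * (f (Suc n) - f n)"
proof (cases "x = real (Suc n)")
  case True
  then show ?thesis using lin_interp_of_nat[of f "Suc n"] by simp
next
  case False
  then have "\<lfloor>x\<rfloor> = int n" using assms by (intro floor_unique) auto
  then show ?thesis by (simp add: lin_interp_def frac_def algebra_simps)
qed

lemma lin_interp_lipschitz_cell:
  assumes C: "\<bar>f (Suc n) - f n\<bar> \<le> C"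
    and "real n \<le> x" "x \<le> real (Suc n)" "real n \<le> y" "y \<le> real (Suc n)"
  shows "\<bar>lin_interp f x - lin_interp f y\<bar> \<le> C * \<bar>x - y\<bar>"
proof -
  have "lin_interp f x - lin_interp f y = (f (Suc n) - f n) * (x - y)"
    using lin_interp_eq[of n x f] lin_interp_eq[of n y f] assms by (simp add: algebra_simps)
  then show ?thesis using C by (simp add: abs_mult mult_right_mono)
qed

lemma abs_diff_nat_le:
  fixes f :: "nat \<Rightarrow> real"
  assumes C: "\<And>n. \<bar>f (Suc n) - f n\<bar> \<le> C" and "m \<le> n"
  shows "\<bar>f n - f m\<bar> \<le> C * (real n - real m)"
  using \<open>m \<le> n\<close>
proof (induction n rule: dec_induct)
  case (step n)
  then show ?case using C[of n] by (simp add: algebra_simps)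
qed simp

lemma lin_interp_lipschitz:
  assumes C: "\<And>n. \<bar>f (Suc n) - f n\<bar> \<le> C" and "0 \<le> x" "0 \<le> y"
  shows "\<bar>lin_interp f x - lin_interp f y\<bar> \<le> C * \<bar>x - y\<bar>"
proof -
  have *: "\<bar>lin_interp f x - lin_interp f y\<bar> \<le> C * (y - x)" if "0 \<le> x" "x \<le> y" for x y
  proof -
    define m n where "m = nat \<lfloor>x\<rfloor>" and "n = nat \<lfloor>y\<rfloor>"
    have m: "real m \<le> x" "x \<le> real (Suc m)" and n: "real n \<le> y" "y \<le> real (Suc n)"
      using that unfolding m_def n_def by linarith+
    show ?thesis
    proof (cases "m = n")
      case True
      then show ?thesis
        using lin_interp_lipschitz_cell[of f m C x y, OF C m] n that by (simp add: abs_minus_commute)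
    next
      case False
      have "m \<le> n" unfolding m_def n_def using that by (intro nat_mono floor_mono)
      with False have mn: "Suc m \<le> n" by simp
      have 1: "\<bar>lin_interp f x - f (Suc m)\<bar> \<le> C * (real (Suc m) - x)"
        using lin_interp_lipschitz_cell[of f m C x "real (Suc m)", OF C m] m lin_interp_of_nat[of f "Suc m"] by simp
      have 2: "\<bar>f n - f (Suc m)\<bar> \<le> C * (real n - real (Suc m))" by (rule abs_diff_nat_le[of f C "Suc m" n, OF C mn])
      have 3: "\<bar>lin_interp f y - f n\<bar> \<le> C * (y - real n)"
        using lin_interp_lipschitz_cell[of f n C y "real n", OF C n] n lin_interp_of_nat[of f n] by simp
      have "C * (y - x) = C * (real (Suc m) - x) + C * (real n - real (Suc m)) + C * (y - real n)"
        by (simp add: algebra_simps)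
      then show ?thesis using 1 2 3 by linarith
    qed
  qed
  show ?thesis
    using *[of x y] *[of y x] assms(2,3) by (cases "x \<le> y") (auto simp: abs_minus_commute)
qed

lemma lin_interp_diff_le:
  assumes "\<And>n. \<bar>f n - g n\<bar> \<le> C"
  shows "\<bar>lin_interp f x - lin_interp g x\<bar> \<le> C"
proof -
  define t where "t = frac x"
  have t: "0 \<le> t" "t < 1" by (auto simp: t_def frac_lt_1)
  have "lin_interp f x - lin_interp g x =
      (1 - t) * (f (nat \<lfloor>x\<rfloor>) - g (nat \<lfloor>x\<rfloor>)) + t * (f (Suc (nat \<lfloor>x\<rfloor>)) - g (Suc (nat \<lfloor>x\<rfloor>)))"
    by (simp add: lin_interp_def t_def algebra_simps)
  also have "\<bar>\<dots>\<bar> \<le> (1 - t) * \<bar>f (nat \<lfloor>x\<rfloor>) - g (nat \<lfloor>x\<rfloor>)\<bar> + t * \<bar>f (Suc (nat \<lfloor>x\<rfloor>)) - g (Suc (nat \<lfloor>x\<rfloor>))\<bar>"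
    using t by (intro order_trans[OF abs_triangle_ineq]) (simp add: abs_mult)
  also have "\<dots> \<le> (1 - t) * C + t * C"
    using t assms by (intro add_mono mult_left_mono) auto
  finally show ?thesis by (simp add: algebra_simps)
qed

section \<open>Lattice heights and their extension\<close>

lemma height_Suc_x: "height v e (Suc x) y = height v e x y - real (v x y)"
  by (simp add: height_def)

lemma height_0_0: "height v e 0 0 = 0"
  by (simp add: height_def)

text \<open>The height is defined by going up the left boundary and then along row \<open>y\<close>;
  away from \<open>x = 0\<close> the vertical increment follows from conservation, propagated column
  by column.\<close>

lemma height_Suc_y:
  assumes cons: "\<And>x y. v x y + e x y = v x (Suc y) + e (Suc x) y"
  shows "height v e x (Suc y) = height v e x y + real (e x y)"
proof (induction x)
  case 0
  then show ?case by (simp add: height_def)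
next
  case (Suc x)
  have "real (v x y) + real (e x y) = real (v x (Suc y)) + real (e (Suc x) y)"
    using cons[of x y] by (simp flip: of_nat_add)
  then show ?case using Suc by (simp add: height_Suc_x)
qed

lemma height_bound:
  assumes "\<And>x y. v x y \<le> I" "\<And>x y. e x y \<le> J"
  shows "\<bar>height v e x y\<bar> \<le> real I * real x + real J * real y"
proof -
  have "(\<Sum>j=1..y. real (e 0 (j - 1))) \<le> (\<Sum>j=1..y. real J)"
    using assms by (intro sum_mono) auto
  moreover have "(\<Sum>i=1..x. real (v (i - 1) y)) \<le> (\<Sum>i=1..x. real I)"
    using assms by (intro sum_mono) auto
  moreover have "(\<Sum>j=1..y. real (e 0 (j - 1))) \<ge> 0" "(\<Sum>i=1..x. real (v (i - 1) y)) \<ge> 0"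
    by (auto intro: sum_nonneg)
  ultimately show ?thesis unfolding height_def by (simp add: mult.commute)
qed

lemma height_ext_of_nat: "height_ext v e (real m) (real n) = height v e m n"
  by (simp add: height_ext_def lin_interp_of_nat)

text \<open>Horizontally, the slope bound on lattice rows survives averaging. Vertically,
  consecutive rows differ by at most \<open>J\<close> at lattice points, hence also at interpolated
  ones.\<close>

lemma height_ext_lipschitz:
  assumes le: "\<And>x y. v x y \<le> I" "\<And>x y. e x y \<le> J"
    and cons: "\<And>x y. v x y + e x y = v x (Suc y) + e (Suc x) y"
    and nonneg: "0 \<le> x" "0 \<le> y" "0 \<le> x'" "0 \<le> y'"
  shows "\<bar>height_ext v e x y - height_ext v e x' y'\<bar> \<le> I * \<bar>x - x'\<bar> + J * \<bar>y - y'\<bar>"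
proof -
  have 1: "\<bar>height_ext v e x y - height_ext v e x' y\<bar> \<le> I * \<bar>x - x'\<bar>"
    unfolding height_ext_def
    by (intro lin_interp_diff_le lin_interp_lipschitz nonneg) (simp add: height_Suc_x le)
  have "\<bar>lin_interp (\<lambda>m. height v e m (Suc n)) x' - lin_interp (\<lambda>m. height v e m n) x'\<bar> \<le> J" for n
    by (rule lin_interp_diff_le) (simp add: height_Suc_y[of v e, OF cons] le)
  then have 2: "\<bar>height_ext v e x' y - height_ext v e x' y'\<bar> \<le> J * \<bar>y - y'\<bar>"
    unfolding height_ext_def by (intro lin_interp_lipschitz nonneg)
  show ?thesis using 1 2 by linarith
qed

lemma height_ext_bound:
  assumes "\<And>x y. v x y \<le> I" "\<And>x y. e x y \<le> J"
    and "\<And>x y. v x y + e x y = v x (Suc y) + e (Suc x) y"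
    and "0 \<le> x" "0 \<le> y"
  shows "\<bar>height_ext v e x y\<bar> \<le> I * x + J * y"
  using height_ext_lipschitz[of v I e J x y 0 0] height_ext_of_nat[of v e 0 0] assms
  by (simp add: height_0_0)

text \<open>Interpolation reaches one lattice point beyond the floor, which the margin of 2 covers.
  Dependence on a finite window will give measurability of the supremum.\<close>

lemma height_ext_cong:
  assumes "\<And>a b. a < N \<Longrightarrow> b < N \<Longrightarrow> v a b = v' a b \<and> e a b = e' a b"
    and "0 \<le> x" "x + 2 \<le> real N" "0 \<le> y" "y + 2 \<le> real N"
  shows "height_ext v e x y = height_ext v' e' x y"
proof -
  have fl: "Suc (nat \<lfloor>x\<rfloor>) < N" "Suc (nat \<lfloor>y\<rfloor>) < N" using assms by linarith+
  have "height v e m n = height v' e' m n" if "m \<le> N" "n < N" for m n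
    unfolding height_def using that by (intro arg_cong2[where f = minus] sum.cong) (auto simp: assms(1))
  then show ?thesis using fl unfolding height_ext_def lin_interp_def by simp
qed

section \<open>Residuals of Lipschitz functions and Riemann sums\<close>

lemma riemann_sum_error:
  fixes f :: "real \<Rightarrow> real"
  assumes L: "L > 0" and K: "K \<ge> 0"
    and lip: "\<And>x y. x \<in> {0..real m / L} \<Longrightarrow> y \<in> {0..real m / L} \<Longrightarrow> \<bar>f x - f y\<bar> \<le> K * \<bar>x - y\<bar>"
  shows "\<bar>integral {0..real m / L} f - 1 / L * (\<Sum>i<m. f (real i / L))\<bar> \<le> K * (real m / L) / L"
  using lip
proof (induction m)
  case 0
  then show ?case by simp
next
  case (Suc m)
  define a b where "a = real m / L" and "b = real (Suc m) / L"
  have ab: "0 \<le> a" "a \<le> b" "b - a = 1 / L" using L by (auto simp: a_def b_def field_simps)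
  have lip: "\<bar>f x - f y\<bar> \<le> K * \<bar>x - y\<bar>" if "x \<in> {0..b}" "y \<in> {0..b}" for x y
    using Suc.prems that by (simp add: b_def)
  have "continuous_on {0..b} f"
  proof (rule continuous_on_subset[OF lipschitz_on_continuous_on])
    show "K-lipschitz_on {0..b} f"
      using lip K by (intro lipschitz_onI) (auto simp: dist_real_def)
  qed simp
  then have int: "f integrable_on {0..b}" by (rule integrable_continuous_real)
  have int': "f integrable_on {a..b}" by (rule integrable_subinterval_real[OF int]) (use ab in auto)
  have split: "integral {0..b} f = integral {0..a} f + integral {a..b} f"
    using Henstock_Kurzweil_Integration.integral_combine[OF ab(1,2) int] by simp
  have "\<bar>integral {a..b} (\<lambda>x. f x - f a)\<bar> \<le> integral {a..b} (\<lambda>x. K * (1 / L))"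
    unfolding real_norm_def[symmetric]
  proof (rule integral_norm_bound_integral)
    show "norm (f x - f a) \<le> K * (1 / L)" if "x \<in> {a..b}" for x
    proof -
      have "\<bar>f x - f a\<bar> \<le> K * \<bar>x - a\<bar>" using lip[of x a] that ab by auto
      also have "\<dots> \<le> K * (1 / L)" using that ab K by (intro mult_left_mono) auto
      finally show ?thesis by simp
    qed
    show "(\<lambda>x. f x - f a) integrable_on {a..b}" by (intro integrable_diff int') auto
  qed auto
  also have "integral {a..b} (\<lambda>x. f x - f a) = integral {a..b} f - 1 / L * f a"
    using int' ab by (subst integral_diff) auto
  also have "integral {a..b} (\<lambda>x. K * (1 / L)) = K * (1 / L) / L" using ab by simp
  finally have last: "\<bar>integral {a..b} f - 1 / L * f a\<bar> \<le> K * (1 / L) / L" .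
  have prev: "\<bar>integral {0..a} f - 1 / L * (\<Sum>i<m. f (real i / L))\<bar> \<le> K * a / L"
    unfolding a_def by (rule Suc.IH) (use lip ab in \<open>auto simp: a_def\<close>)
  have "K * b / L = K * a / L + K * (1 / L) / L"
    using ab L by (simp add: a_def b_def field_simps)
  moreover have "1 / L * (\<Sum>i<Suc m. f (real i / L)) = 1 / L * (\<Sum>i<m. f (real i / L)) + 1 / L * f a"
    by (simp add: a_def distrib_left)
  ultimately show ?case using last prev split unfolding b_def[symmetric] by linarith
qed

text \<open>Deterministic setting for one realisation of the scaled profile. It will be used with
  \<open>K0\<close> and \<open>K1\<close> independent of L, which makes all derived constants
  uniform.\<close>

locale lipschitz_on_rectangle =
  fixes u :: "real \<Rightarrow> real \<Rightarrow> real" and A B K0 K1 a b :: real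
  assumes bound: "\<And>x y. x \<in> {0..A} \<Longrightarrow> y \<in> {0..B} \<Longrightarrow> \<bar>u x y\<bar> \<le> K0"
    and lip: "\<And>x y x' y'. x \<in> {0..A} \<Longrightarrow> y \<in> {0..B} \<Longrightarrow> x' \<in> {0..A} \<Longrightarrow> y' \<in> {0..B} \<Longrightarrow>
      \<bar>u x y - u x' y'\<bar> \<le> K1 * (\<bar>x - x'\<bar> + \<bar>y - y'\<bar>)"
    and nonneg: "A \<ge> 0" "B \<ge> 0" "K0 \<ge> 0" "K1 \<ge> 0" "a \<ge> 0" "b \<ge> 0"
begin

lemma cont: "continuous_on ({0..A} \<times> {0..B}) (\<lambda>(x, y). u x y)"
proof (rule lipschitz_on_continuous_on[of "2 * K1"], rule lipschitz_onI)
  fix p p' assume "p \<in> {0..A} \<times> {0..B}" "p' \<in> {0..A} \<times> {0..B}"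
  then obtain x y x' y' where p: "p = (x, y)" "p' = (x', y')"
    and *: "x \<in> {0..A}" "y \<in> {0..B}" "x' \<in> {0..A}" "y' \<in> {0..B}" by auto
  have "\<bar>x - x'\<bar> \<le> dist p p'" "\<bar>y - y'\<bar> \<le> dist p p'"
    using dist_fst_le[of p p'] dist_snd_le[of p p'] by (auto simp: p dist_real_def)
  then have "K1 * (\<bar>x - x'\<bar> + \<bar>y - y'\<bar>) \<le> K1 * (2 * dist p p')"
    using nonneg by (intro mult_left_mono) auto
  with lip[OF *] show "dist (case p of (x, y) \<Rightarrow> u x y) (case p' of (x, y) \<Rightarrow> u x y) \<le> 2 * K1 * dist p p'"
    by (simp add: p dist_real_def)
qed (use nonneg in auto)

lemma integral_x_diff:
  assumes "X \<in> {0..A}" "X' \<in> {0..A}" "Y \<in> {0..B}" "Y' \<in> {0..B}"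
  shows "\<bar>integral {0..X} (\<lambda>x. u x Y - u x 0) - integral {0..X'} (\<lambda>x. u x Y' - u x 0)\<bar>
    \<le> 2 * K0 * \<bar>X - X'\<bar> + A * K1 * \<bar>Y - Y'\<bar>"
proof -
  have int: "(\<lambda>x. u x Y - u x 0) integrable_on {0..X}" if "X \<in> {0..A}" "Y \<in> {0..B}" for X Y
    by (rule telegraph_integrable(1)[OF cont that])
  have *: "\<bar>integral {0..X} (\<lambda>x. u x Y - u x 0) - integral {0..X'} (\<lambda>x. u x Y - u x 0)\<bar> \<le> 2 * K0 * (X - X')"
    if "X \<in> {0..A}" "X' \<in> {0..A}" "Y \<in> {0..B}" "X' \<le> X" for X X' Y
  proof -
    have "integral {0..X} (\<lambda>x. u x Y - u x 0) - integral {0..X'} (\<lambda>x. u x Y - u x 0)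
        = integral {X'..X} (\<lambda>x. u x Y - u x 0)"
      using Henstock_Kurzweil_Integration.integral_combine[OF _ that(4) int[OF that(1,3)]] that by simp
    moreover have "norm (integral {X'..X} (\<lambda>x. u x Y - u x 0)) \<le> integral {X'..X} (\<lambda>x. 2 * K0)"
    proof (rule integral_norm_bound_integral)
      show "(\<lambda>x. u x Y - u x 0) integrable_on {X'..X}"
        by (rule integrable_subinterval_real[OF int[OF that(1,3)]]) (use that in auto)
      show "norm (u x Y - u x 0) \<le> 2 * K0" if "x \<in> {X'..X}" for x
        using bound[of x Y] bound[of x 0] that \<open>X \<in> {0..A}\<close> \<open>X' \<in> {0..A}\<close> \<open>Y \<in> {0..B}\<close> by auto
    qed auto
    ultimately show ?thesis using that by (simp add: mult_ac)
  qed
  have 1: "\<bar>integral {0..X} (\<lambda>x. u x Y - u x 0) - integral {0..X'} (\<lambda>x. u x Y - u x 0)\<bar> \<le> 2 * K0 * \<bar>X - X'\<bar>"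
    using *[of X X' Y] *[of X' X Y] assms by (cases "X' \<le> X") (auto simp: abs_minus_commute)
  have "norm (integral {0..X'} (\<lambda>x. (u x Y - u x 0) - (u x Y' - u x 0))) \<le> integral {0..X'} (\<lambda>x. K1 * \<bar>Y - Y'\<bar>)"
  proof (rule integral_norm_bound_integral)
    show "(\<lambda>x. (u x Y - u x 0) - (u x Y' - u x 0)) integrable_on {0..X'}"
      by (intro integrable_diff int assms)
    show "norm ((u x Y - u x 0) - (u x Y' - u x 0)) \<le> K1 * \<bar>Y - Y'\<bar>" if "x \<in> {0..X'}" for x
      using lip[of x Y x Y'] that assms by auto
  qed auto
  also have "\<dots> = X' * (K1 * \<bar>Y - Y'\<bar>)" using assms by simp
  also have "\<dots> \<le> A * (K1 * \<bar>Y - Y'\<bar>)"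
    using assms nonneg by (intro mult_right_mono) auto
  also have "integral {0..X'} (\<lambda>x. (u x Y - u x 0) - (u x Y' - u x 0)) =
      integral {0..X'} (\<lambda>x. u x Y - u x 0) - integral {0..X'} (\<lambda>x. u x Y' - u x 0)"
    by (rule integral_diff) (intro int assms)+
  finally have 2: "\<bar>integral {0..X'} (\<lambda>x. u x Y - u x 0) - integral {0..X'} (\<lambda>x. u x Y' - u x 0)\<bar> \<le> A * K1 * \<bar>Y - Y'\<bar>"
    by (simp add: mult.assoc)
  show ?thesis using 1 2 by linarith
qed

end

text \<open>Exchanging the coordinates also exchanges \<open>a\<close> and \<open>b\<close>, so only
  the integral over \<open>x\<close> needs a direct estimate.\<close>

lemma (in lipschitz_on_rectangle) transpose:
  "lipschitz_on_rectangle (\<lambda>x y. u y x) B A K0 K1 b a"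
proof
  fix x y x' y' assume "x \<in> {0..B}" "y \<in> {0..A}" "x' \<in> {0..B}" "y' \<in> {0..A}"
  then show "\<bar>u y x - u y' x'\<bar> \<le> K1 * (\<bar>x - x'\<bar> + \<bar>y - y'\<bar>)"
    using lip[of y x y' x'] by (simp add: add.commute)
qed (use bound nonneg in auto)

context lipschitz_on_rectangle
begin

text \<open>Moving the upper limit of an integral costs \<open>2 * K0\<close> per unit, moving the
  other coordinate costs \<open>K1\<close> per unit over a length of at most \<open>A\<close> or
  \<open>B\<close>. The three moving corner values account for \<open>2 * K1\<close>.\<close>

lemma residual_lipschitz:
  assumes "X \<in> {0..A}" "X' \<in> {0..A}" "Y \<in> {0..B}" "Y' \<in> {0..B}"
  shows "\<bar>telegraph_residual a b u X Y - telegraph_residual a b u X' Y'\<bar>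
    \<le> (2 * K1 + (a + b) * (2 * K0 + (A + B) * K1)) * (\<bar>X - X'\<bar> + \<bar>Y - Y'\<bar>)"
proof -
  define dx dy where "dx = \<bar>X - X'\<bar>" and "dy = \<bar>Y - Y'\<bar>"
  have d: "dx \<ge> 0" "dy \<ge> 0" by (auto simp: dx_def dy_def)
  interpret T: lipschitz_on_rectangle "\<lambda>x y. u y x" B A K0 K1 b a by (rule transpose)
  define P P' Q Q' where "P = integral {0..X} (\<lambda>x. u x Y - u x 0)"
    and "P' = integral {0..X'} (\<lambda>x. u x Y' - u x 0)"
    and "Q = integral {0..Y} (\<lambda>y. u X y - u 0 y)"
    and "Q' = integral {0..Y'} (\<lambda>y. u X' y - u 0 y)"
  have le: "2 * K0 * p + D * K1 * r \<le> (2 * K0 + (A + B) * K1) * (dx + dy)"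
    if "p \<le> dx + dy" "r \<le> dx + dy" "0 \<le> r" "D \<le> A + B" for p r D
  proof -
    have "2 * K0 * p + D * K1 * r \<le> 2 * K0 * (dx + dy) + (A + B) * K1 * (dx + dy)"
      using that nonneg d by (intro add_mono mult_mono mult_left_mono mult_right_mono) auto
    then show ?thesis by (simp add: distrib_right)
  qed
  have "\<bar>P - P'\<bar> \<le> 2 * K0 * dx + A * K1 * dy"
    using integral_x_diff[OF assms] by (simp add: P_def P'_def dx_def dy_def)
  also have "\<dots> \<le> (2 * K0 + (A + B) * K1) * (dx + dy)" using d nonneg by (intro le) auto
  finally have P: "\<bar>a * P - a * P'\<bar> \<le> a * ((2 * K0 + (A + B) * K1) * (dx + dy))"
    using nonneg by (simp add: abs_mult mult_left_mono flip: right_diff_distrib)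
  have "\<bar>Q - Q'\<bar> \<le> 2 * K0 * dy + B * K1 * dx"
    using T.integral_x_diff[OF assms(3,4,1,2)] by (simp add: Q_def Q'_def dx_def dy_def)
  also have "\<dots> \<le> (2 * K0 + (A + B) * K1) * (dx + dy)" using d nonneg by (intro le) auto
  finally have Q: "\<bar>b * Q - b * Q'\<bar> \<le> b * ((2 * K0 + (A + B) * K1) * (dx + dy))"
    using nonneg by (simp add: abs_mult mult_left_mono flip: right_diff_distrib)
  have u: "\<bar>u X Y - u X' Y'\<bar> \<le> K1 * (dx + dy)" "\<bar>u X 0 - u X' 0\<bar> \<le> K1 * dx" "\<bar>u 0 Y - u 0 Y'\<bar> \<le> K1 * dy"
    using lip[OF assms(1,3,2,4)] lip[OF assms(1) _ assms(2), of 0 0] lip[OF _ assms(3) _ assms(4), of 0 0] nonneg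
    by (auto simp: dx_def dy_def)
  have eq: "telegraph_residual a b u X Y - telegraph_residual a b u X' Y' =
      (u X Y - u X' Y') - (u X 0 - u X' 0) - (u 0 Y - u 0 Y') + (a * P - a * P') + (b * Q - b * Q')"
    by (simp add: telegraph_residual_def P_def P'_def Q_def Q'_def)
  have tri: "\<bar>p - r - s + t + w\<bar> \<le> \<bar>p\<bar> + \<bar>r\<bar> + \<bar>s\<bar> + \<bar>t\<bar> + \<bar>w\<bar>" for p r s t w :: real
    by linarith
  have alg: "K1 * (dx + dy) + K1 * dx + K1 * dy + a * (Z * (dx + dy)) + b * (Z * (dx + dy))
      = (2 * K1 + (a + b) * Z) * (dx + dy)" for Z
    by (simp add: algebra_simps)
  have "\<bar>telegraph_residual a b u X Y - telegraph_residual a b u X' Y'\<bar> \<le>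
      \<bar>u X Y - u X' Y'\<bar> + \<bar>u X 0 - u X' 0\<bar> + \<bar>u 0 Y - u 0 Y'\<bar> + \<bar>a * P - a * P'\<bar> + \<bar>b * Q - b * Q'\<bar>"
    unfolding eq by (rule tri)
  also have "\<dots> \<le>
      K1 * (dx + dy) + K1 * dx + K1 * dy + a * ((2 * K0 + (A + B) * K1) * (dx + dy)) + b * ((2 * K0 + (A + B) * K1) * (dx + dy))"
    by (intro add_mono u P Q)
  also note alg
  finally show ?thesis by (simp add: dx_def dy_def)
qed

text \<open>At lattice points the integrals are compared with left Riemann sums; the integrands are
  differences of two profile values, hence Lipschitz with constant \<open>2 * K1\<close>. What is
  left is the discrete operator, to which the second moment bound applies.\<close>

lemma residual_riemann:
  assumes L: "L > 0" and m: "real m \<le> L * A" and n: "real n \<le> L * B"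
  shows "\<bar>telegraph_residual a b u (real m / L) (real n / L) -
    (u (real m / L) (real n / L) - u (real m / L) 0 - u 0 (real n / L) + u 0 0
      + a / L * (\<Sum>i<m. u (real i / L) (real n / L) - u (real i / L) 0)
      + b / L * (\<Sum>j<n. u (real m / L) (real j / L) - u 0 (real j / L)))\<bar>
    \<le> 2 * K1 * (a * A + b * B) / L"
proof -
  have X: "real m / L \<in> {0..A}" and Y: "real n / L \<in> {0..B}"
    using L m n by (auto simp: field_simps)
  have 1: "\<bar>integral {0..real m / L} (\<lambda>x. u x (real n / L) - u x 0)
      - 1 / L * (\<Sum>i<m. u (real i / L) (real n / L) - u (real i / L) 0)\<bar> \<le> 2 * K1 * (real m / L) / L"
  proof (rule riemann_sum_error[OF L])
    fix x y assume "x \<in> {0..real m / L}" "y \<in> {0..real m / L}"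
    then show "\<bar>(u x (real n / L) - u x 0) - (u y (real n / L) - u y 0)\<bar> \<le> 2 * K1 * \<bar>x - y\<bar>"
      using lip[of x "real n / L" y "real n / L"] lip[of x 0 y 0] X Y nonneg by auto
  qed (use nonneg in auto)
  have 2: "\<bar>integral {0..real n / L} (\<lambda>y. u (real m / L) y - u 0 y)
      - 1 / L * (\<Sum>j<n. u (real m / L) (real j / L) - u 0 (real j / L))\<bar> \<le> 2 * K1 * (real n / L) / L"
  proof (rule riemann_sum_error[OF L])
    fix x y assume "x \<in> {0..real n / L}" "y \<in> {0..real n / L}"
    then show "\<bar>(u (real m / L) x - u 0 x) - (u (real m / L) y - u 0 y)\<bar> \<le> 2 * K1 * \<bar>x - y\<bar>"
      using lip[of "real m / L" x "real m / L" y] lip[of 0 x 0 y] X Y nonneg by auto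
  qed (use nonneg in auto)
  have weighted: "\<bar>c * S - c / L * T\<bar> \<le> c * (2 * K1 * D / L)"
    if "\<bar>S - 1 / L * T\<bar> \<le> 2 * K1 * d / L" "d \<le> D" "c \<ge> 0" for c S T d D
  proof -
    have "\<bar>c * S - c / L * T\<bar> = c * \<bar>S - 1 / L * T\<bar>"
    proof -
      have "c * S - c / L * T = c * (S - 1 / L * T)" by (simp add: right_diff_distrib)
      then show ?thesis using that(3) by (simp add: abs_mult)
    qed
    also have "2 * K1 * d / L \<le> 2 * K1 * D / L"
      using that(2) nonneg L by (intro divide_right_mono mult_left_mono) auto
    with that(1) have "c * \<bar>S - 1 / L * T\<bar> \<le> c * (2 * K1 * D / L)"
      using that(3) by (intro mult_left_mono) auto
    finally show ?thesis .
  qed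
  have "\<bar>(p - r - s + t + P' + Q') - (p - r - s + t + P + Q)\<bar> \<le> E1 + E2"
    if "\<bar>P' - P\<bar> \<le> E1" "\<bar>Q' - Q\<bar> \<le> E2" for p r s t P P' Q Q' E1 E2 :: real
    using that by linarith
  from this[OF weighted[OF 1, of A a] weighted[OF 2, of B b]] X Y nonneg
  have "\<bar>telegraph_residual a b u (real m / L) (real n / L) -
    (u (real m / L) (real n / L) - u (real m / L) 0 - u 0 (real n / L) + u 0 0
      + a / L * (\<Sum>i<m. u (real i / L) (real n / L) - u (real i / L) 0)
      + b / L * (\<Sum>j<n. u (real m / L) (real j / L) - u 0 (real j / L)))\<bar>
    \<le> a * (2 * K1 * A / L) + b * (2 * K1 * B / L)"
    unfolding telegraph_residual_def by (simp only: atLeastAtMost_iff simp_thms)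
  also have "\<dots> = 2 * K1 * (a * A + b * B) / L"
    by (simp add: algebra_simps add_divide_distrib)
  finally show ?thesis .
qed

end

section \<open>Conditional moments of the discrete telegraph operator\<close>

text \<open>
  For a height function of the form \<open>q powr H\<close> this is the discrete telegraph operator at a vertex
  with inputs \<open>a\<close>, \<open>b\<close> and vertical output \<open>i\<close>, divided by \<open>q powr H\<close> at the vertex.
\<close>

definition vertex_defect :: "real \<Rightarrow> real \<Rightarrow> real \<Rightarrow> nat \<Rightarrow> nat \<Rightarrow> nat \<Rightarrow> real" where
  "vertex_defect q \<kappa>\<^sub>1 \<kappa>\<^sub>2 a b i = q powi (int b - int i) - q powi (int b) - q powi (- int a) + 1
     + \<kappa>\<^sub>1 * (q powi (int b) - 1) + \<kappa>\<^sub>2 * (q powi (- int a) - 1)"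

section \<open>Marginal law of the vertical output\<close>

definition exit_weight :: "nat \<Rightarrow> nat \<Rightarrow> real \<Rightarrow> real \<Rightarrow> nat \<Rightarrow> nat \<Rightarrow> nat \<Rightarrow> real" where
  "exit_weight I J q \<alpha> a b i = (\<Sum>j\<le>J. vertex_weight I J q \<alpha> a b i j)"

lemma exit_weight_eq:
  assumes "a + b = i + j" "j \<le> J"
  shows "exit_weight I J q \<alpha> a b i = vertex_weight I J q \<alpha> a b i j"
proof -
  have "(\<Sum>j'\<le>J. vertex_weight I J q \<alpha> a b i j') =
      (\<Sum>j'\<le>J. if j' = j then vertex_weight I J q \<alpha> a b i j else 0)"
    using assms by (intro sum.cong) (auto simp: vertex_weight_def Let_def)
  then show ?thesis using assms by (simp add: exit_weight_def)
qed

lemma exit_weight_eq_0: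
  assumes "\<And>j. j \<le> J \<Longrightarrow> a + b \<noteq> i + j"
  shows "exit_weight I J q \<alpha> a b i = 0"
  unfolding exit_weight_def using assms by (intro sum.neutral) (auto simp: vertex_weight_def Let_def)

lemma stochastic_row_exit_weight:
  assumes "stochastic_row I J q \<alpha> a b"
  shows "i \<le> I \<Longrightarrow> exit_weight I J q \<alpha> a b i \<ge> 0" "(\<Sum>i\<le>I. exit_weight I J q \<alpha> a b i) = 1"
    "i \<le> I \<Longrightarrow> exit_weight I J q \<alpha> a b i \<le> 1"
proof -
  show nonneg: "exit_weight I J q \<alpha> a b i \<ge> 0" if "i \<le> I" for i
    using assms that unfolding exit_weight_def stochastic_row_def by (intro sum_nonneg) auto
  show sum: "(\<Sum>i\<le>I. exit_weight I J q \<alpha> a b i) = 1"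
    using assms unfolding exit_weight_def stochastic_row_def by simp
  show "exit_weight I J q \<alpha> a b i \<le> 1" if "i \<le> I"
    using member_le_sum[of i "{..I}" "exit_weight I J q \<alpha> a b"] nonneg sum that by simp
qed

context vertex_weight_scaling
begin

text \<open>Inverts \<open>\<delta> = \<beta>\<^sub>1 - \<beta>\<^sub>2\<close> and
  \<open>\<rho> = \<beta>\<^sub>2 / \<beta>\<^sub>1\<close>, the values with which the locale is
  finally interpreted.\<close>

definition "\<beta>\<^sub>1 = \<delta> / (1 - \<rho>)"
definition "\<beta>\<^sub>2 = \<delta> * \<rho> / (1 - \<rho>)"

lemma \<beta>_diff: "\<beta>\<^sub>1 - \<beta>\<^sub>2 = \<delta>"
proof -
  have "\<beta>\<^sub>1 - \<beta>\<^sub>2 = \<delta> * (1 - \<rho>) / (1 - \<rho>)"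
    by (simp add: \<beta>\<^sub>1_def \<beta>\<^sub>2_def diff_divide_distrib right_diff_distrib)
  then show ?thesis using \<rho> by simp
qed

definition jump_rate :: "nat \<Rightarrow> nat \<Rightarrow> nat \<Rightarrow> nat \<Rightarrow> nat \<Rightarrow> real" where
  "jump_rate I J a b i = (if i = Suc a then (real I - real a) * real b * \<beta>\<^sub>1 else 0)
     + (if a = Suc i then real a * (real J - real b) * \<beta>\<^sub>2 else 0)"

text \<open>A move whose horizontal output would leave \<open>{0..J}\<close> has weight 0. The rates
  agree with this: a line cannot be gained for \<open>b = 0\<close> nor lost for
  \<open>b = J\<close>, as the factors \<open>b\<close> and \<open>J - b\<close> express.\<close>

lemma exit_weight_tendsto:
  assumes "b \<le> J" "i \<noteq> a"
  shows "((\<lambda>L. L * exit_weight I J (q L) (\<alpha> L) a b i) \<longlongrightarrow> jump_rate I J a b i) at_top"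
proof (cases "\<exists>j\<le>J. a + b = i + j")
  case True
  then obtain j where j: "j \<le> J" "a + b = i + j" by blast
  have "((\<lambda>L. L * vertex_weight I J (q L) (\<alpha> L) a b i j) \<longlongrightarrow> jump_rate I J a b i) at_top"
  proof -
    consider "i = Suc a" "b = Suc j" | "a = Suc i" "j = Suc b" | "i \<noteq> Suc a" "a \<noteq> Suc i"
      using j by linarith
    then show ?thesis
    proof cases
      case 1
      then show ?thesis using vertex_weight_up_tendsto[of j J I a] assms
        by (simp add: jump_rate_def \<beta>\<^sub>1_def)
    next
      case 2
      then show ?thesis using vertex_weight_down_tendsto[of b J I i] j
        by (simp add: jump_rate_def \<beta>\<^sub>2_def mult.assoc)
    next
      case 3
      then show ?thesis using vertex_weight_far_tendsto[of a b i j J I] j assms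
        by (simp add: jump_rate_def)
    qed
  qed
  then show ?thesis using j by (simp add: exit_weight_eq)
next
  case False
  have "jump_rate I J a b i = 0"
  proof -
    have "b = 0" if "i = Suc a" using False that assms by (cases b) auto
    moreover have "b = J" if "a = Suc i"
    proof (rule ccontr)
      assume "b \<noteq> J"
      then have "Suc b \<le> J" "a + b = i + Suc b" using that assms by auto
      with False show False by blast
    qed
    ultimately show ?thesis by (auto simp: jump_rate_def)
  qed
  then show ?thesis using False by (simp add: exit_weight_eq_0)
qed

lemma jump_rate_drift:
  assumes "a \<le> I"
  shows "(\<Sum>i\<in>{..I} - {a}. jump_rate I J a b i * ((real a - real i) * \<delta>)) =
    (real a * (real J - real b) * \<beta>\<^sub>2 - (real I - real a) * real b * \<beta>\<^sub>1) * \<delta>"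
proof -
  \<comment> \<open>For \<open>a = I\<close> the index \<open>Suc a\<close> is outside the range,
    but then the factor \<open>I - a\<close> is 0.\<close>
  have up: "(\<Sum>i\<in>{..I} - {a}. if i = Suc a then - ((real I - real a) * real b * \<beta>\<^sub>1 * \<delta>) else 0)
      = - ((real I - real a) * real b * \<beta>\<^sub>1 * \<delta>)"
    using assms by auto
  have down: "(\<Sum>i\<in>{..I} - {a}. if a = Suc i then real a * (real J - real b) * \<beta>\<^sub>2 * \<delta> else 0)
      = real a * (real J - real b) * \<beta>\<^sub>2 * \<delta>"
  proof (cases a)
    case (Suc a')
    then have "(\<Sum>i\<in>{..I} - {a}. if a = Suc i then real a * (real J - real b) * \<beta>\<^sub>2 * \<delta> else 0)
      = (\<Sum>i\<in>{..I} - {a}. if i = a' then real a * (real J - real b) * \<beta>\<^sub>2 * \<delta> else 0)"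
      by (intro sum.cong) auto
    then show ?thesis using Suc assms by simp
  qed simp
  have "(\<Sum>i\<in>{..I} - {a}. jump_rate I J a b i * ((real a - real i) * \<delta>)) =
      (\<Sum>i\<in>{..I} - {a}. (if i = Suc a then - ((real I - real a) * real b * \<beta>\<^sub>1 * \<delta>) else 0)
        + (if a = Suc i then real a * (real J - real b) * \<beta>\<^sub>2 * \<delta> else 0))"
    by (intro sum.cong) (auto simp: jump_rate_def algebra_simps)
  then show ?thesis unfolding sum.distrib up down by (simp add: algebra_simps)
qed

section \<open>Expansion of the defect at fixed inputs\<close>

context
  fixes I J a b :: nat
  assumes a: "a \<le> I" and b: "b \<le> J"
begin

abbreviation defect :: "real \<Rightarrow> nat \<Rightarrow> real" where
  "defect L i \<equiv> vertex_defect (q L) (real I * \<beta>\<^sub>1 / L) (real J * \<beta>\<^sub>2 / L) a b i"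

abbreviation wt :: "real \<Rightarrow> nat \<Rightarrow> nat \<Rightarrow> real" where
  "wt L \<equiv> vertex_weight I J (q L) (\<alpha> L) a b"

abbreviation W :: "real \<Rightarrow> nat \<Rightarrow> real" where
  "W L i \<equiv> exit_weight I J (q L) (\<alpha> L) a b i"

text \<open>For \<open>i = a\<close> the first four terms factor as
  \<open>(1 - q powi b) * (1 - q powi (- a))\<close>, a product of two quantities of order 1/L; the
  last two terms carry coefficients of order 1/L.\<close>

lemma defect_diag_tendsto:
  "((\<lambda>L. L\<^sup>2 * defect L a) \<longlongrightarrow> (real I * \<beta>\<^sub>1 * real b - real J * \<beta>\<^sub>2 * real a - real a * real b * \<delta>) * \<delta>) at_top"
proof -
  have "((\<lambda>L. (L * (1 - q L powi int b)) * (L * (1 - q L powi (- int a)))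
      - real I * \<beta>\<^sub>1 * (L * (1 - q L powi int b)) - real J * \<beta>\<^sub>2 * (L * (1 - q L powi (- int a))))
      \<longlongrightarrow> (- of_int (int b) * \<delta>) * (- of_int (- int a) * \<delta>)
        - real I * \<beta>\<^sub>1 * (- of_int (int b) * \<delta>) - real J * \<beta>\<^sub>2 * (- of_int (- int a) * \<delta>)) at_top"
    by (intro tendsto_intros one_minus_q_powi_lim)
  then show ?thesis
  proof (rule Lim_transform_eventually[OF tendsto_eq_rhs])
    show "\<forall>\<^sub>F L in at_top. (L * (1 - q L powi int b)) * (L * (1 - q L powi (- int a)))
      - real I * \<beta>\<^sub>1 * (L * (1 - q L powi int b)) - real J * \<beta>\<^sub>2 * (L * (1 - q L powi (- int a)))
      = L\<^sup>2 * defect L a"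
      using q_pos eventually_gt_at_top[of 0]
    proof eventually_elim
      case (elim L)
      define x y where "x = q L powi int b" and "y = q L powi (- int a)"
      have "q L powi (int b - int a) = x * y"
        using elim by (simp add: x_def y_def power_int_diff power_int_minus divide_inverse)
      then have "defect L a = x * y - x - y + 1 + real I * \<beta>\<^sub>1 / L * (x - 1) + real J * \<beta>\<^sub>2 / L * (y - 1)"
        by (simp add: vertex_defect_def x_def y_def)
      then show ?case unfolding x_def[symmetric] y_def[symmetric]
        using elim by (simp add: field_simps power2_eq_square)
    qed
  qed (simp add: algebra_simps)
qed

text \<open>Only the first term of the defect depends on \<open>i\<close>, so the difference is a
  difference of two powers of \<open>q\<close>.\<close>

lemma defect_diff_tendsto: "((\<lambda>L. L * (defect L i - defect L a)) \<longlongrightarrow> (real a - real i) * \<delta>) at_top"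
proof -
  have "((\<lambda>L. L * (1 - q L powi (int b - int a)) - L * (1 - q L powi (int b - int i)))
      \<longlongrightarrow> - of_int (int b - int a) * \<delta> - (- of_int (int b - int i) * \<delta>)) at_top"
    by (intro tendsto_intros one_minus_q_powi_lim)
  then show ?thesis
    by (rule tendsto_eq_rhs[OF tendsto_cong[THEN iffD1, rotated]])
      (auto simp: vertex_defect_def algebra_simps)
qed

lemma defect_tendsto: "((\<lambda>L. L * defect L i) \<longlongrightarrow> (real a - real i) * \<delta>) at_top"
proof -
  have "((\<lambda>L. L * (defect L i - defect L a) + inverse L * (L\<^sup>2 * defect L a)) \<longlongrightarrow> (real a - real i) * \<delta> + 
      0 * ((real I * \<beta>\<^sub>1 * real b - real J * \<beta>\<^sub>2 * real a - real a * real b * \<delta>) * \<delta>)) at_top"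
    by (intro tendsto_add tendsto_mult defect_diff_tendsto defect_diag_tendsto tendsto_inverse_0_at_top filterlim_ident)
  then show ?thesis
  proof (rule Lim_transform_eventually[OF tendsto_eq_rhs])
    show "\<forall>\<^sub>F L in at_top. L * (defect L i - defect L a) + inverse L * (L\<^sup>2 * defect L a) = L * defect L i"
      using eventually_gt_at_top[of 0] by eventually_elim (simp add: power2_eq_square algebra_simps)
  qed simp
qed

lemma defect_tendsto_0: "((\<lambda>L. defect L i) \<longlongrightarrow> 0) at_top"
proof -
  have "((\<lambda>L. inverse L * (L * defect L i)) \<longlongrightarrow> 0 * ((real a - real i) * \<delta>)) at_top"
    by (intro tendsto_mult defect_tendsto tendsto_inverse_0_at_top filterlim_ident)
  then show ?thesis
  proof (rule Lim_transform_eventually[OF tendsto_eq_rhs])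
    show "\<forall>\<^sub>F L in at_top. inverse L * (L * defect L i) = defect L i"
      using eventually_gt_at_top[of 0] by eventually_elim simp
  qed simp
qed

lemma W_tendsto: "i \<in> {..I} - {a} \<Longrightarrow> ((\<lambda>L. L * W L i) \<longlongrightarrow> jump_rate I J a b i) at_top"
  using b by (intro exit_weight_tendsto) auto

text \<open>The terms of order \<open>1 / L\<^sup>2\<close> cancel because \<open>\<beta>\<^sub>1 - \<beta>\<^sub>2 = \<delta>\<close>.\<close>

lemma mean_defect_tendsto:
  "((\<lambda>L. L\<^sup>2 * (defect L a + (\<Sum>i\<in>{..I} - {a}. W L i * (defect L i - defect L a)))) \<longlongrightarrow> 0) at_top"
proof -
  have "((\<lambda>L. L\<^sup>2 * defect L a + (\<Sum>i\<in>{..I} - {a}. (L * W L i) * (L * (defect L i - defect L a)))) \<longlongrightarrow>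
      (real I * \<beta>\<^sub>1 * real b - real J * \<beta>\<^sub>2 * real a - real a * real b * \<delta>) * \<delta>
      + (\<Sum>i\<in>{..I} - {a}. jump_rate I J a b i * ((real a - real i) * \<delta>))) at_top"
    by (intro tendsto_add tendsto_sum tendsto_mult defect_diag_tendsto defect_diff_tendsto W_tendsto)
  moreover have "(real I * \<beta>\<^sub>1 * real b - real J * \<beta>\<^sub>2 * real a - real a * real b * \<delta>) * \<delta>
      + (\<Sum>i\<in>{..I} - {a}. jump_rate I J a b i * ((real a - real i) * \<delta>)) = 0"
  proof -
    have "(real I * \<beta>\<^sub>1 * real b - real J * \<beta>\<^sub>2 * real a - real a * real b * (\<beta>\<^sub>1 - \<beta>\<^sub>2))
        + (real a * (real J - real b) * \<beta>\<^sub>2 - (real I - real a) * real b * \<beta>\<^sub>1) = 0"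
      by (simp add: algebra_simps)
    then show ?thesis unfolding jump_rate_drift[OF a] \<beta>_diff distrib_right[symmetric] by simp
  qed
  moreover have "L\<^sup>2 * defect L a + (\<Sum>i\<in>{..I} - {a}. (L * W L i) * (L * (defect L i - defect L a)))
      = L\<^sup>2 * (defect L a + (\<Sum>i\<in>{..I} - {a}. W L i * (defect L i - defect L a)))" for L
    by (simp add: distrib_left sum_distrib_left power2_eq_square mult_ac)
  ultimately show ?thesis by simp
qed

text \<open>A changed line count has weight and defect of order 1/L each; an unchanged one has a
  defect of order 1/L^2. Without cancellation this gives a finite limit, and only its existence is
  used.\<close>

lemma abs_defect_tendsto:
  "((\<lambda>L. L\<^sup>2 * (\<bar>defect L a\<bar> + (\<Sum>i\<in>{..I} - {a}. \<bar>W L i\<bar> * \<bar>defect L i\<bar>))) \<longlongrightarrow>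
    \<bar>(real I * \<beta>\<^sub>1 * real b - real J * \<beta>\<^sub>2 * real a - real a * real b * \<delta>) * \<delta>\<bar>
      + (\<Sum>i\<in>{..I} - {a}. \<bar>jump_rate I J a b i\<bar> * \<bar>(real a - real i) * \<delta>\<bar>)) at_top"
proof -
  have "((\<lambda>L. \<bar>L\<^sup>2 * defect L a\<bar> + (\<Sum>i\<in>{..I} - {a}. \<bar>L * W L i\<bar> * \<bar>L * defect L i\<bar>)) \<longlongrightarrow>
    \<bar>(real I * \<beta>\<^sub>1 * real b - real J * \<beta>\<^sub>2 * real a - real a * real b * \<delta>) * \<delta>\<bar>
      + (\<Sum>i\<in>{..I} - {a}. \<bar>jump_rate I J a b i\<bar> * \<bar>(real a - real i) * \<delta>\<bar>)) at_top"
    by (intro tendsto_add tendsto_sum tendsto_mult tendsto_rabs defect_diag_tendsto defect_tendsto W_tendsto)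
  moreover have "\<bar>L\<^sup>2 * defect L a\<bar> + (\<Sum>i\<in>{..I} - {a}. \<bar>L * W L i\<bar> * \<bar>L * defect L i\<bar>)
      = L\<^sup>2 * (\<bar>defect L a\<bar> + (\<Sum>i\<in>{..I} - {a}. \<bar>W L i\<bar> * \<bar>defect L i\<bar>))" for L
  proof -
    have *: "\<bar>L * W L i\<bar> * \<bar>L * defect L i\<bar> = L\<^sup>2 * (\<bar>W L i\<bar> * \<bar>defect L i\<bar>)" for i
    proof -
      have "\<bar>L * W L i\<bar> * \<bar>L * defect L i\<bar> = (\<bar>L\<bar> * \<bar>L\<bar>) * (\<bar>W L i\<bar> * \<bar>defect L i\<bar>)"
        unfolding abs_mult by (simp only: mult_ac)
      then show ?thesis by (simp add: power2_eq_square)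
    qed
    have "\<bar>L\<^sup>2 * defect L a\<bar> = L\<^sup>2 * \<bar>defect L a\<bar>" by (simp add: abs_mult)
    then show ?thesis unfolding * by (simp only: distrib_left sum_distrib_left)
  qed
  ultimately show ?thesis by simp
qed

text \<open>Compared with the absolute moment there is one more factor \<open>defect\<close>, which
  tends to 0.\<close>

lemma square_defect_tendsto:
  "((\<lambda>L. L\<^sup>2 * ((defect L a)\<^sup>2 + (\<Sum>i\<in>{..I} - {a}. \<bar>W L i\<bar> * (defect L i)\<^sup>2))) \<longlongrightarrow> 0) at_top"
proof -
  have "((\<lambda>L. (L\<^sup>2 * defect L a) * defect L a + (\<Sum>i\<in>{..I} - {a}. \<bar>L * W L i\<bar> * (\<bar>L * defect L i\<bar> * \<bar>defect L i\<bar>))) \<longlongrightarrow>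
    ((real I * \<beta>\<^sub>1 * real b - real J * \<beta>\<^sub>2 * real a - real a * real b * \<delta>) * \<delta>) * 0
      + (\<Sum>i\<in>{..I} - {a}. \<bar>jump_rate I J a b i\<bar> * (\<bar>(real a - real i) * \<delta>\<bar> * \<bar>0\<bar>))) at_top"
    by (intro tendsto_add tendsto_sum tendsto_mult tendsto_rabs defect_diag_tendsto defect_tendsto
        defect_tendsto_0 W_tendsto)
  moreover have "(L\<^sup>2 * defect L a) * defect L a + (\<Sum>i\<in>{..I} - {a}. \<bar>L * W L i\<bar> * (\<bar>L * defect L i\<bar> * \<bar>defect L i\<bar>))
      = L\<^sup>2 * ((defect L a)\<^sup>2 + (\<Sum>i\<in>{..I} - {a}. \<bar>W L i\<bar> * (defect L i)\<^sup>2))" for L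
  proof -
    have "\<bar>L * W L i\<bar> * (\<bar>L * defect L i\<bar> * \<bar>defect L i\<bar>) = L\<^sup>2 * (\<bar>W L i\<bar> * (defect L i)\<^sup>2)" for i
    proof -
      have "\<bar>L * W L i\<bar> * (\<bar>L * defect L i\<bar> * \<bar>defect L i\<bar>) = (\<bar>L\<bar> * \<bar>L\<bar>) * (\<bar>W L i\<bar> * (\<bar>defect L i\<bar> * \<bar>defect L i\<bar>))"
        unfolding abs_mult by (simp only: mult_ac)
      then show ?thesis by (simp add: power2_eq_square)
    qed
    then show ?thesis by (simp add: distrib_left sum_distrib_left power2_eq_square[of "defect L a"] mult.assoc)
  qed
  ultimately show ?thesis by simp
qed

text \<open>The identity uses the row sum 1 to eliminate the weight of \<open>i = a\<close>; the two
  inequalities use that this weight is at most 1.\<close>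

lemma stochastic_row_defect:
  assumes row: "stochastic_row I J (q L) (\<alpha> L) a b"
  shows "\<bar>\<Sum>i\<le>I. \<Sum>j\<le>J. wt L i j * defect L i\<bar>
      = \<bar>defect L a + (\<Sum>i\<in>{..I} - {a}. W L i * (defect L i - defect L a))\<bar>"
    and "(\<Sum>i\<le>I. \<Sum>j\<le>J. wt L i j * \<bar>defect L i\<bar>)
      \<le> \<bar>defect L a\<bar> + (\<Sum>i\<in>{..I} - {a}. \<bar>W L i\<bar> * \<bar>defect L i\<bar>)"
    and "(\<Sum>i\<le>I. \<Sum>j\<le>J. wt L i j * (defect L i)\<^sup>2)
      \<le> (defect L a)\<^sup>2 + (\<Sum>i\<in>{..I} - {a}. \<bar>W L i\<bar> * (defect L i)\<^sup>2)"
proof -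
  note W = stochastic_row_exit_weight[OF row]
  have sum_W: "(\<Sum>i\<le>I. \<Sum>j\<le>J. wt L i j * g i) = (\<Sum>i\<le>I. W L i * g i)" for g
    by (simp add: exit_weight_def sum_distrib_right)
  have "(\<Sum>i\<le>I. W L i * (defect L i - defect L a)) = (\<Sum>i\<le>I. W L i * defect L i) - defect L a"
    using W(2) by (simp add: right_diff_distrib sum_subtractf flip: sum_distrib_right)
  moreover have "(\<Sum>i\<le>I. W L i * (defect L i - defect L a)) = (\<Sum>i\<in>{..I} - {a}. W L i * (defect L i - defect L a))"
    using a by (subst sum.remove[of _ a]) auto
  ultimately show "\<bar>\<Sum>i\<le>I. \<Sum>j\<le>J. wt L i j * defect L i\<bar>
      = \<bar>defect L a + (\<Sum>i\<in>{..I} - {a}. W L i * (defect L i - defect L a))\<bar>"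
    unfolding sum_W by simp
  have le: "(\<Sum>i\<le>I. W L i * g i) \<le> g a + (\<Sum>i\<in>{..I} - {a}. \<bar>W L i\<bar> * g i)" if "\<And>i. g i \<ge> 0" for g
  proof -
    have "(\<Sum>i\<le>I. W L i * g i) = W L a * g a + (\<Sum>i\<in>{..I} - {a}. W L i * g i)"
      using a by (subst sum.remove[of _ a]) auto
    also have "\<dots> \<le> 1 * g a + (\<Sum>i\<in>{..I} - {a}. \<bar>W L i\<bar> * g i)"
      using W(3)[OF a] that by (intro add_mono sum_mono mult_right_mono) auto
    finally show ?thesis by simp
  qed
  show "(\<Sum>i\<le>I. \<Sum>j\<le>J. wt L i j * \<bar>defect L i\<bar>)
      \<le> \<bar>defect L a\<bar> + (\<Sum>i\<in>{..I} - {a}. \<bar>W L i\<bar> * \<bar>defect L i\<bar>)"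
    unfolding sum_W by (rule le) simp
  show "(\<Sum>i\<le>I. \<Sum>j\<le>J. wt L i j * (defect L i)\<^sup>2)
      \<le> (defect L a)\<^sup>2 + (\<Sum>i\<in>{..I} - {a}. \<bar>W L i\<bar> * (defect L i)\<^sup>2)"
    unfolding sum_W by (rule le) simp
qed

text \<open>\<open>C\<close> is chosen before \<open>\<eta>\<close>: the second moment multiplies
  the absolute moment by the mean, so the first constant has to stay fixed while the second is made
  small.\<close>

lemma eventually_defect_bounds:
  "\<exists>C. \<forall>\<eta>>0. \<forall>\<^sub>F L in at_top. moment_bounds I J (q L) (\<alpha> L) (vertex_defect (q L) (real I * \<beta>\<^sub>1 / L) (real J * \<beta>\<^sub>2 / L))
      (C / L\<^sup>2) (\<eta> / L\<^sup>2) (\<eta> / L\<^sup>2) a b"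
proof -
  obtain C where C: "((\<lambda>L. L\<^sup>2 * (\<bar>defect L a\<bar> + (\<Sum>i\<in>{..I} - {a}. \<bar>W L i\<bar> * \<bar>defect L i\<bar>))) \<longlongrightarrow> C) at_top"
    using abs_defect_tendsto by blast
  have "\<forall>\<^sub>F L in at_top. moment_bounds I J (q L) (\<alpha> L) (vertex_defect (q L) (real I * \<beta>\<^sub>1 / L) (real J * \<beta>\<^sub>2 / L))
      ((C + 1) / L\<^sup>2) (\<eta> / L\<^sup>2) (\<eta> / L\<^sup>2) a b"
    if \<eta>: "\<eta> > 0" for \<eta>
  proof -
    have "\<forall>\<^sub>F L in at_top. L\<^sup>2 * (\<bar>defect L a\<bar> + (\<Sum>i\<in>{..I} - {a}. \<bar>W L i\<bar> * \<bar>defect L i\<bar>)) < C + 1"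
      using order_tendstoD(2)[OF C, of "C + 1"] by simp
    moreover have "\<forall>\<^sub>F L in at_top. L\<^sup>2 * \<bar>defect L a + (\<Sum>i\<in>{..I} - {a}. W L i * (defect L i - defect L a))\<bar> < \<eta>"
      using order_tendstoD(2)[OF tendsto_rabs_zero[OF mean_defect_tendsto] \<eta>] by (simp add: abs_mult)
    moreover have "\<forall>\<^sub>F L in at_top. L\<^sup>2 * ((defect L a)\<^sup>2 + (\<Sum>i\<in>{..I} - {a}. \<bar>W L i\<bar> * (defect L i)\<^sup>2)) < \<eta>"
      using order_tendstoD(2)[OF square_defect_tendsto \<eta>] .
    ultimately show ?thesis
      using eventually_gt_at_top[of 0]
    proof eventually_elim
      case (elim L)
      have L: "L\<^sup>2 > 0" using elim by simp
      have conv: "x \<le> y / L\<^sup>2" if "L\<^sup>2 * z < y" "x \<le> z" for x y z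
      proof -
        have "L\<^sup>2 * x \<le> L\<^sup>2 * z" using that L by (intro mult_left_mono) auto
        with that have "L\<^sup>2 * x \<le> y" by linarith
        then show ?thesis using L by (simp only: pos_le_divide_eq mult.commute)
      qed
      show ?case
      proof (intro impI conjI)
        assume row: "stochastic_row I J (q L) (\<alpha> L) a b"
        show "(\<Sum>i\<le>I. \<Sum>j\<le>J. wt L i j * \<bar>defect L i\<bar>) \<le> (C + 1) / L\<^sup>2"
          by (rule conv[OF elim(1) stochastic_row_defect(2)[OF row]])
        show "\<bar>\<Sum>i\<le>I. \<Sum>j\<le>J. wt L i j * defect L i\<bar> \<le> \<eta> / L\<^sup>2"
          by (rule conv[OF elim(2) eq_refl[OF stochastic_row_defect(1)[OF row]]])
        show "(\<Sum>i\<le>I. \<Sum>j\<le>J. wt L i j * (defect L i)\<^sup>2) \<le> \<eta> / L\<^sup>2"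
          by (rule conv[OF elim(3) stochastic_row_defect(3)[OF row]])
      qed
    qed
  qed
  then show ?thesis by blast
qed

end

lemma uniform_defect_bounds:
  fixes I J :: nat
  defines "D \<equiv> \<lambda>L. vertex_defect (q L) (real I * \<beta>\<^sub>1 / L) (real J * \<beta>\<^sub>2 / L)"
  shows "\<exists>C\<ge>0. \<forall>\<eta>>0. \<forall>\<^sub>F L in at_top. \<forall>a\<le>I. \<forall>b\<le>J. moment_bounds I J (q L) (\<alpha> L) (D L)
      (C / L\<^sup>2) (\<eta> / L\<^sup>2) (\<eta> / L\<^sup>2) a b"
proof -
  define P where "P a b C \<eta> L \<longleftrightarrow> (moment_bounds I J (q L) (\<alpha> L) (D L)
      (C / L\<^sup>2) (\<eta> / L\<^sup>2) (\<eta> / L\<^sup>2) a b)" for a b C \<eta> L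
  have mono: "P a b C' \<eta> L" if "P a b C \<eta> L" "C \<le> C'" for a b C C' \<eta> L
    using that divide_right_mono[OF that(2), of "L\<^sup>2"] unfolding P_def by (meson order_trans zero_le_power2)
  have "\<exists>C. \<forall>\<eta>>0. \<forall>\<^sub>F L in at_top. P a b C \<eta> L" if "a \<le> I" "b \<le> J" for a b
    using eventually_defect_bounds[OF that] unfolding P_def D_def .
  then obtain C where C: "\<And>a b \<eta>. a \<le> I \<Longrightarrow> b \<le> J \<Longrightarrow> \<eta> > 0 \<Longrightarrow> \<forall>\<^sub>F L in at_top. P a b (C a b) \<eta> L"
    by metis
  \<comment> \<open>There are finitely many input pairs, and the sum of absolute values dominates
    each constant.\<close>
  define C' where "C' = (\<Sum>a\<le>I. \<Sum>b\<le>J. \<bar>C a b\<bar>)"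
  have le: "C a b \<le> C'" if "a \<le> I" "b \<le> J" for a b
  proof -
    have "\<bar>C a b\<bar> \<le> (\<Sum>b\<le>J. \<bar>C a b\<bar>)" using that by (intro member_le_sum) auto
    also have "\<dots> \<le> C'" unfolding C'_def using that
      by (intro member_le_sum[of a "{..I}" "\<lambda>a. \<Sum>b\<le>J. \<bar>C a b\<bar>"]) (auto intro: sum_nonneg)
    finally show ?thesis by simp
  qed
  have "\<forall>\<^sub>F L in at_top. \<forall>a\<in>{..I}. \<forall>b\<in>{..J}. P a b C' \<eta> L" if "\<eta> > 0" for \<eta>
    using that by (intro eventually_ball_finite ballI finite_atMost eventually_mono[OF C mono[OF _ le]]) auto
  then have "\<forall>\<eta>>0. \<forall>\<^sub>F L in at_top. \<forall>a\<le>I. \<forall>b\<le>J. P a b C' \<eta> L"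
    unfolding Ball_def atMost_iff by blast
  moreover have "C' \<ge> 0" unfolding C'_def by (intro sum_nonneg) auto
  ultimately show ?thesis unfolding P_def by blast
qed

end

section \<open>Convergence in probability\<close>

text \<open>The heights at the three further corners of a vertex arise by adding
  \<open>e x y\<close> and subtracting \<open>v\<close>, so \<open>U x y\<close> times the defect is
  exactly the mixed difference plus weighted first differences of \<open>U\<close>. The mixed
  difference telescopes in both directions, the others in one.\<close>

lemma lattice_telegraph_sum:
  fixes v e :: "nat \<Rightarrow> nat \<Rightarrow> nat" and s \<kappa>\<^sub>1 \<kappa>\<^sub>2 :: real
  defines "U \<equiv> \<lambda>x y. exp (s * height v e x y)"
  assumes cons: "\<And>x y. v x y + e x y = v x (Suc y) + e (Suc x) y"
  shows "U m n - U m 0 - U 0 n + U 0 0 + \<kappa>\<^sub>1 * (\<Sum>x<m. U x n - U x 0) + \<kappa>\<^sub>2 * (\<Sum>y<n. U m y - U 0 y)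
    = (\<Sum>x<m. \<Sum>y<n. U x y * vertex_defect (exp s) \<kappa>\<^sub>1 \<kappa>\<^sub>2 (v x y) (e x y) (v x (Suc y)))"
proof -
  have hx: "height v e (Suc x) y = height v e x y - real (v x y)" for x y by (rule height_Suc_x)
  have hy: "height v e x (Suc y) = height v e x y + real (e x y)" for x y
    by (rule height_Suc_y[of v e, OF cons])
  have p: "exp s powi k = exp (s * of_int k)" for k
    by (simp add: exp_power_int mult.commute)
  have defect: "U x y * vertex_defect (exp s) \<kappa>\<^sub>1 \<kappa>\<^sub>2 (v x y) (e x y) (v x (Suc y)) =
      (U (Suc x) (Suc y) - U x (Suc y)) - (U (Suc x) y - U x y)
      + \<kappa>\<^sub>1 * (U x (Suc y) - U x y) + \<kappa>\<^sub>2 * (U (Suc x) y - U x y)" for x y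
  proof -
    have "U (Suc x) (Suc y) = U x y * exp s powi (int (e x y) - int (v x (Suc y)))"
      unfolding U_def p hx hy exp_add[symmetric] by (simp add: algebra_simps)
    moreover have "U x (Suc y) = U x y * exp s powi (int (e x y))"
      unfolding U_def p hy exp_add[symmetric] by (simp add: algebra_simps)
    moreover have "U (Suc x) y = U x y * exp s powi (- int (v x y))"
      unfolding U_def p hx exp_add[symmetric] by (simp add: algebra_simps)
    ultimately show ?thesis unfolding vertex_defect_def by (simp add: algebra_simps)
  qed
  have tx: "(\<Sum>x<m. f (Suc x) - f x) = f m - f 0" for f :: "nat \<Rightarrow> real"
    by (rule sum_lessThan_telescope)
  have ty: "(\<Sum>y<n. f (Suc y) - f y) = f n - f 0" for f :: "nat \<Rightarrow> real"
    by (rule sum_lessThan_telescope)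
  have "(\<Sum>x<m. \<Sum>y<n. (U (Suc x) (Suc y) - U x (Suc y)) - (U (Suc x) y - U x y))
      = (\<Sum>x<m. (U (Suc x) n - U (Suc x) 0) - (U x n - U x 0))"
    using ty[of "\<lambda>y. U (Suc _) y - U _ y"] by (intro sum.cong) auto
  also have "\<dots> = U m n - U m 0 - U 0 n + U 0 0"
    using tx[of "\<lambda>x. U x n - U x 0"] by simp
  finally have 1: "(\<Sum>x<m. \<Sum>y<n. (U (Suc x) (Suc y) - U x (Suc y)) - (U (Suc x) y - U x y))
      = U m n - U m 0 - U 0 n + U 0 0" .
  have 2: "(\<Sum>x<m. \<Sum>y<n. \<kappa>\<^sub>1 * (U x (Suc y) - U x y)) = \<kappa>\<^sub>1 * (\<Sum>x<m. U x n - U x 0)"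
    unfolding sum_distrib_left[symmetric] using ty by simp
  have 3: "(\<Sum>x<m. \<Sum>y<n. \<kappa>\<^sub>2 * (U (Suc x) y - U x y)) = \<kappa>\<^sub>2 * (\<Sum>y<n. U m y - U 0 y)"
    unfolding sum_distrib_left[symmetric] by (subst sum.swap) (simp add: tx[of "\<lambda>x. U x _"])
  show ?thesis unfolding defect sum.distrib 1 2 3 ..
qed

lemma exp_diff_le:
  fixes x y r :: real
  assumes "x \<le> r" "y \<le> r"
  shows "\<bar>exp x - exp y\<bar> \<le> exp r * \<bar>x - y\<bar>"
proof -
  have *: "exp y - exp x \<le> exp r * (y - x)" if "x \<le> y" "y \<le> r" for x y
  proof -
    have "1 + (x - y) \<le> exp (x - y)" by (rule exp_ge_add_one_self)
    then have "exp y * (1 + (x - y)) \<le> exp y * exp (x - y)" by (intro mult_left_mono) auto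
    then have "exp y - exp x \<le> exp y * (y - x)" by (simp add: algebra_simps flip: exp_add)
    also have "\<dots> \<le> exp r * (y - x)" using that by (intro mult_right_mono) auto
    finally show ?thesis .
  qed
  show ?thesis using *[of x y] *[of y x] assms by (cases "x \<le> y") auto
qed

text \<open>To the right of \<open>- r\<close> the slope of \<open>exp\<close> is at least
  \<open>exp (- r)\<close>. This returns from exponentials to heights.\<close>

lemma diff_le_exp_diff:
  fixes x y r :: real
  assumes "- r \<le> x" "- r \<le> y"
  shows "\<bar>x - y\<bar> \<le> exp r * \<bar>exp x - exp y\<bar>"
proof -
  have *: "y - x \<le> exp r * (exp y - exp x)" if "x \<le> y" "- r \<le> x" for x y
  proof -
    have "1 + (y - x) \<le> exp (y - x)" by (rule exp_ge_add_one_self)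
    then have "exp x * (1 + (y - x)) \<le> exp x * exp (y - x)" by (intro mult_left_mono) auto
    then have "exp x * (y - x) \<le> exp y - exp x" by (simp add: algebra_simps flip: exp_add)
    then have le: "exp r * (exp x * (y - x)) \<le> exp r * (exp y - exp x)" by (intro mult_left_mono) auto
    have "y - x \<le> exp (r + x) * (y - x)"
      using mult_right_mono[of 1 "exp (r + x)" "y - x"] that by simp
    also have "\<dots> = exp r * (exp x * (y - x))"
      by (simp add: exp_add mult.assoc)
    also note le
    finally show ?thesis .
  qed
  show ?thesis
  proof (cases "x \<le> y")
    case True
    then have "\<bar>x - y\<bar> = y - x" "\<bar>exp x - exp y\<bar> = exp y - exp x"
      using abs_of_nonpos[of "x - y"] abs_of_nonpos[of "exp x - exp y"] by simp_all
    then show ?thesis using *[OF True assms(1)] by (simp only:)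
  next
    case False
    then have "\<bar>x - y\<bar> = x - y" "\<bar>exp x - exp y\<bar> = exp x - exp y"
      using abs_of_nonneg[of "x - y"] abs_of_nonneg[of "exp x - exp y"] by simp_all
    then show ?thesis using *[OF _ assms(2)] False by (simp only:)
  qed
qed

text \<open>The logarithm of a solution recovers it only where it is known to be positive, inside
  the rectangle; values outside must not matter.\<close>

lemma telegraph_bvp_cong:
  assumes "telegraph_bvp a b A B f g u"
    and "\<And>x y. x \<in> {0..A} \<Longrightarrow> y \<in> {0..B} \<Longrightarrow> v x y = u x y"
    and "A \<ge> 0" "B \<ge> 0"
  shows "telegraph_bvp a b A B f g v"
proof -
  have "integral {0..X} (\<lambda>x. v x Y - v x 0) = integral {0..X} (\<lambda>x. u x Y - u x 0)"
    "integral {0..Y} (\<lambda>y. v X y - v 0 y) = integral {0..Y} (\<lambda>y. u X y - u 0 y)"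
    if "X \<in> {0..A}" "Y \<in> {0..B}" for X Y
    using that assms(3,4) by (auto intro!: Henstock_Kurzweil_Integration.integral_cong simp: assms(2))
  moreover have "continuous_on ({0..A} \<times> {0..B}) (\<lambda>(x, y). v x y) \<longleftrightarrow> continuous_on ({0..A} \<times> {0..B}) (\<lambda>(x, y). u x y)"
    by (intro continuous_on_cong) (auto simp: assms(2))
  ultimately show ?thesis
    using assms unfolding telegraph_bvp_def telegraph_solution_def by auto
qed

text \<open>A functional of finitely many of the edge variables takes only countably many values.\<close>

lemma (in shs6v) finite_window_measurable:
  fixes X :: "'a \<Rightarrow> real"
  assumes cong: "\<And>\<omega> \<omega>'. (\<And>a b. a < N \<Longrightarrow> b < N \<Longrightarrow> V a b \<omega> = V a b \<omega>' \<and> E a b \<omega> = E a b \<omega>') \<Longrightarrow> X \<omega> = X \<omega>'"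
  shows "X \<in> borel_measurable M"
proof -
  define ps where "ps = List.product [0..<N] [0..<N]"
  define c where "c \<omega> = map (\<lambda>(a, b). (V a b \<omega>, E a b \<omega>)) ps" for \<omega>
  have c_eq: "c \<omega> = l \<longleftrightarrow> length l = length ps \<and> (\<forall>k\<in>{..<length ps}.
      V (fst (ps ! k)) (snd (ps ! k)) \<omega> = fst (l ! k) \<and> E (fst (ps ! k)) (snd (ps ! k)) \<omega> = snd (l ! k))" for \<omega> l
    by (auto simp: c_def list_eq_iff_nth_eq case_prod_unfold prod_eq_iff)
  have "c \<in> measurable M (count_space UNIV)"
  proof (subst measurable_count_space_eq2_countable, intro conjI ballI)
    fix l
    have "c -` {l} \<inter> space M = {\<omega> \<in> space M. length l = length ps \<and> (\<forall>k\<in>{..<length ps}.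
      V (fst (ps ! k)) (snd (ps ! k)) \<omega> = fst (l ! k) \<and> E (fst (ps ! k)) (snd (ps ! k)) \<omega> = snd (l ! k))}"
      unfolding c_eq[symmetric] by auto
    also have "\<dots> \<in> sets M"
    proof -
      have [simp]: "{\<omega> \<in> space M. V a b \<omega> = k} \<in> sets M" "{\<omega> \<in> space M. E a b \<omega> = k} \<in> sets M" for a b k
        by measurable
      show ?thesis
        by (intro sets.sets_Collect_conj sets.sets_Collect_const sets.sets_Collect_finite_All) simp_all
    qed
    finally show "c -` {l} \<inter> space M \<in> sets M" .
  qed simp
  \<comment> \<open>A representative depending only on the code \<open>c \<omega>\<close> replaces
    \<open>\<omega>\<close>, so \<open>X\<close> factors through a measurable map into a countable
    type.\<close>
  then have "(\<lambda>\<omega>. X (SOME \<omega>'. c \<omega>' = c \<omega>)) \<in> borel_measurable M"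
    by (rule measurable_compose) simp
  also have "(\<lambda>\<omega>. X (SOME \<omega>'. c \<omega>' = c \<omega>)) = X"
  proof
    fix \<omega>
    have "c (SOME \<omega>'. c \<omega>' = c \<omega>) = c \<omega>" by (rule someI[of _ \<omega>]) simp
    then show "X (SOME \<omega>'. c \<omega>' = c \<omega>) = X \<omega>"
      by (intro cong) (auto simp: c_def ps_def)
  qed
  finally show ?thesis .
qed

section \<open>The rescaled model and its uniform bounds\<close>

locale shs6v_scaling = vertex_weight_scaling q \<alpha> \<delta> \<rho>
  for q \<alpha> :: "real \<Rightarrow> real" and \<delta> \<rho> :: real +
  fixes I J :: nat and M :: "real \<Rightarrow> 'a measure" and V E :: "real \<Rightarrow> nat \<Rightarrow> nat \<Rightarrow> 'a \<Rightarrow> nat"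
    and A B :: real and chi psi :: "real \<Rightarrow> real"
  assumes AB: "A > 0" "B > 0"
    and rates: "real I * \<beta>\<^sub>1 > 0" "real J * \<beta>\<^sub>2 > 0"
    and model: "\<forall>\<^sub>F L in at_top. shs6v (M L) I J (q L) (\<alpha> L) (V L) (E L)"
    and chi_limit: "tendsto_in_prob M (\<lambda>L \<omega>. SUP x\<in>{0..A}.
      \<bar>1 / L * height_ext (\<lambda>a b. V L a b \<omega>) (\<lambda>a b. E L a b \<omega>) (L * x) 0 - chi x\<bar>) 0 at_top"
    and psi_limit: "tendsto_in_prob M (\<lambda>L \<omega>. SUP y\<in>{0..B}.
      \<bar>1 / L * height_ext (\<lambda>a b. V L a b \<omega>) (\<lambda>a b. E L a b \<omega>) 0 (L * y) - psi y\<bar>) 0 at_top"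
    and chi_bdd: "\<exists>c. \<forall>x\<in>{0..A}. \<bar>chi x\<bar> \<le> c" and psi_bdd: "\<exists>c. \<forall>y\<in>{0..B}. \<bar>psi y\<bar> \<le> c"
begin

abbreviation H :: "real \<Rightarrow> real \<Rightarrow> real \<Rightarrow> 'a \<Rightarrow> real" where
  "H L x y \<omega> \<equiv> height_ext (\<lambda>a b. V L a b \<omega>) (\<lambda>a b. E L a b \<omega>) x y"

abbreviation ht :: "real \<Rightarrow> nat \<Rightarrow> nat \<Rightarrow> 'a \<Rightarrow> real" where
  "ht L x y \<omega> \<equiv> height (\<lambda>a b. V L a b \<omega>) (\<lambda>a b. E L a b \<omega>) x y"

definition w :: "real \<Rightarrow> 'a \<Rightarrow> real \<Rightarrow> real \<Rightarrow> real" where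
  "w L \<omega> x y = H L (L * x) (L * y) \<omega> / L"

definition u :: "real \<Rightarrow> 'a \<Rightarrow> real \<Rightarrow> real \<Rightarrow> real" where
  "u L \<omega> x y = exp (\<delta> * w L \<omega> x y)"

definition "\<kappa>\<^sub>1 = real I * \<beta>\<^sub>1"
definition "\<kappa>\<^sub>2 = real J * \<beta>\<^sub>2"
text \<open>\<open>R\<close> bounds the rescaled height by counting lines, \<open>K0\<close> bounds
  its exponential, and \<open>K1\<close> is a Lipschitz constant of that exponential; none of them
  depends on L.\<close>

definition "R = real I * A + real J * B"
definition "K0 = exp (\<bar>\<delta>\<bar> * R)"
definition "K1 = K0 * \<bar>\<delta>\<bar> * (real I + real J)"

text \<open>Conservation holds almost surely only. On regular configurations all estimates of
  heights become deterministic.\<close>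

definition regular :: "real \<Rightarrow> 'a \<Rightarrow> bool" where
  "regular L \<omega> \<longleftrightarrow> (\<forall>x y. V L x y \<omega> \<le> I \<and> E L x y \<omega> \<le> J \<and>
     V L x y \<omega> + E L x y \<omega> = V L x (Suc y) \<omega> + E L (Suc x) y \<omega>)"

text \<open>By exact summation this is the discrete telegraph residual of the rectangle with upper
  corner \<open>(m, n)\<close>, written as a sum of vertex contributions.\<close>

definition T :: "real \<Rightarrow> nat \<Rightarrow> nat \<Rightarrow> 'a \<Rightarrow> real" where
  "T L m n \<omega> = (\<Sum>x<m. \<Sum>y<n. exp (\<delta> / L * ht L x y \<omega>) *
     vertex_defect (q L) (\<kappa>\<^sub>1 / L) (\<kappa>\<^sub>2 / L) (V L x y \<omega>) (E L x y \<omega>) (V L x (Suc y) \<omega>))"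

abbreviation T_grid :: "nat \<Rightarrow> real \<Rightarrow> nat \<Rightarrow> nat \<Rightarrow> 'a \<Rightarrow> real" where
  "T_grid N L i j \<omega> \<equiv> T L (nat \<lfloor>L * (real i * A / real N)\<rfloor>) (nat \<lfloor>L * (real j * B / real N)\<rfloor>) \<omega>"

abbreviation approx :: "real \<Rightarrow> (real \<Rightarrow> real \<Rightarrow> real) \<Rightarrow> bool" where
  "approx \<epsilon> v \<equiv> telegraph_approx \<kappa>\<^sub>1 \<kappa>\<^sub>2 A B (\<lambda>x. exp (\<delta> * chi x)) (\<lambda>y. exp (\<delta> * psi y)) \<epsilon> v"

abbreviation bvp :: "(real \<Rightarrow> real \<Rightarrow> real) \<Rightarrow> bool" where
  "bvp v \<equiv> telegraph_bvp \<kappa>\<^sub>1 \<kappa>\<^sub>2 A B (\<lambda>x. exp (\<delta> * chi x)) (\<lambda>y. exp (\<delta> * psi y)) v"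

abbreviation residual :: "(real \<Rightarrow> real \<Rightarrow> real) \<Rightarrow> real \<Rightarrow> real \<Rightarrow> real" where
  "residual \<equiv> telegraph_residual \<kappa>\<^sub>1 \<kappa>\<^sub>2"

abbreviation deviation :: "(real \<Rightarrow> real \<Rightarrow> real) \<Rightarrow> real \<Rightarrow> 'a \<Rightarrow> real" where
  "deviation h L \<omega> \<equiv> SUP (x, y)\<in>{0..A} \<times> {0..B}. \<bar>H L (L * x) (L * y) \<omega> - L * h x y\<bar>"

lemma \<kappa>: "\<kappa>\<^sub>1 > 0" "\<kappa>\<^sub>2 > 0" using rates by (auto simp: \<kappa>\<^sub>1_def \<kappa>\<^sub>2_def)

lemma R: "R \<ge> 0" using AB by (simp add: R_def)

lemma K0: "K0 > 0" by (simp add: K0_def)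

lemma K1: "K1 \<ge> 0" using K0 by (simp add: K1_def)

lemma w_bound:
  assumes "regular L \<omega>" "L > 0" "x \<in> {0..A}" "y \<in> {0..B}"
  shows "\<bar>w L \<omega> x y\<bar> \<le> R"
proof -
  have "\<bar>H L (L * x) (L * y) \<omega>\<bar> \<le> real I * (L * x) + real J * (L * y)"
    using assms by (intro height_ext_bound) (auto simp: regular_def)
  also have "\<dots> = L * (real I * x + real J * y)" by (simp add: algebra_simps)
  also have "\<dots> \<le> L * R"
    unfolding R_def using assms by (intro mult_left_mono add_mono) auto
  finally show ?thesis using assms by (simp add: w_def field_simps)
qed

lemma w_lipschitz:
  assumes "regular L \<omega>" "L > 0" "x \<ge> 0" "y \<ge> 0" "x' \<ge> 0" "y' \<ge> 0"
  shows "\<bar>w L \<omega> x y - w L \<omega> x' y'\<bar> \<le> (real I + real J) * (\<bar>x - x'\<bar> + \<bar>y - y'\<bar>)"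
proof -
  have scale: "\<bar>L * p - L * p'\<bar> = L * \<bar>p - p'\<bar>" for p p'
  proof -
    have "L * p - L * p' = L * (p - p')" by (simp add: right_diff_distrib)
    then show ?thesis using assms(2) by (simp add: abs_mult)
  qed
  have "\<bar>w L \<omega> x y - w L \<omega> x' y'\<bar> = \<bar>H L (L * x) (L * y) \<omega> - H L (L * x') (L * y') \<omega>\<bar> / L"
    using assms(2) by (simp add: w_def flip: diff_divide_distrib)
  also have "\<dots> \<le> (real I * \<bar>L * x - L * x'\<bar> + real J * \<bar>L * y - L * y'\<bar>) / L"
    using assms by (intro divide_right_mono height_ext_lipschitz) (auto simp: regular_def)
  also have "\<dots> = real I * \<bar>x - x'\<bar> + real J * \<bar>y - y'\<bar>"
    unfolding scale using assms(2) by (simp add: add_divide_distrib)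
  also have "\<dots> \<le> (real I + real J) * \<bar>x - x'\<bar> + (real I + real J) * \<bar>y - y'\<bar>"
    by (intro add_mono mult_right_mono) auto
  finally show ?thesis by (simp add: distrib_left)
qed

lemma \<delta>_w_le:
  assumes "\<bar>z\<bar> \<le> r"
  shows "\<bar>\<delta> * z\<bar> \<le> \<bar>\<delta>\<bar> * r"
  using assms by (simp add: abs_mult mult_left_mono)

lemma u_lipschitz:
  assumes reg: "regular L \<omega>" and L: "L > 0"
  shows "lipschitz_on_rectangle (u L \<omega>) A B K0 K1 \<kappa>\<^sub>1 \<kappa>\<^sub>2"
proof
  fix x y assume xy: "x \<in> {0..A}" "y \<in> {0..B}"
  have le: "\<delta> * w L \<omega> x y \<le> \<bar>\<delta>\<bar> * R" using \<delta>_w_le[OF w_bound[OF reg L xy]] by simp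
  then show "\<bar>u L \<omega> x y\<bar> \<le> K0" by (simp add: u_def K0_def)
  fix x' y' assume xy': "x' \<in> {0..A}" "y' \<in> {0..B}"
  have le': "\<delta> * w L \<omega> x' y' \<le> \<bar>\<delta>\<bar> * R" using \<delta>_w_le[OF w_bound[OF reg L xy']] by simp
  have "\<bar>u L \<omega> x y - u L \<omega> x' y'\<bar> \<le> K0 * \<bar>\<delta> * w L \<omega> x y - \<delta> * w L \<omega> x' y'\<bar>"
    unfolding u_def K0_def by (rule exp_diff_le[OF le le'])
  also have "\<dots> = K0 * (\<bar>\<delta>\<bar> * \<bar>w L \<omega> x y - w L \<omega> x' y'\<bar>)"
    by (simp add: abs_mult flip: right_diff_distrib)
  also have "\<dots> \<le> K0 * (\<bar>\<delta>\<bar> * ((real I + real J) * (\<bar>x - x'\<bar> + \<bar>y - y'\<bar>)))"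
    using w_lipschitz[OF reg L] xy xy' K0 by (intro mult_left_mono) auto
  finally show "\<bar>u L \<omega> x y - u L \<omega> x' y'\<bar> \<le> K1 * (\<bar>x - x'\<bar> + \<bar>y - y'\<bar>)"
    by (simp add: K1_def mult.assoc)
qed (use AB K0 K1 \<kappa> in auto)

lemma u_lattice: "L > 0 \<Longrightarrow> u L \<omega> (real m / L) (real n / L) = exp (\<delta> / L * ht L m n \<omega>)"
  using height_ext_of_nat[of _ _ m n] by (simp add: u_def w_def)

lemma residual_lattice:
  assumes reg: "regular L \<omega>" and L: "L > 0" and qL: "q L = exp (\<delta> / L)"
    and m: "real m \<le> L * A" and n: "real n \<le> L * B"
  shows "\<bar>residual (u L \<omega>) (real m / L) (real n / L)\<bar>
    \<le> \<bar>T L m n \<omega>\<bar> + 2 * K1 * (\<kappa>\<^sub>1 * A + \<kappa>\<^sub>2 * B) / L"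
proof -
  interpret lipschitz_on_rectangle "u L \<omega>" A B K0 K1 \<kappa>\<^sub>1 \<kappa>\<^sub>2 by (rule u_lipschitz[OF reg L])
  have z: "u L \<omega> x 0 = u L \<omega> x (real 0 / L)" "u L \<omega> 0 y = u L \<omega> (real 0 / L) y" for x y by auto
  have "u L \<omega> (real m / L) (real n / L) - u L \<omega> (real m / L) 0 - u L \<omega> 0 (real n / L) + u L \<omega> 0 0
      + \<kappa>\<^sub>1 / L * (\<Sum>i<m. u L \<omega> (real i / L) (real n / L) - u L \<omega> (real i / L) 0)
      + \<kappa>\<^sub>2 / L * (\<Sum>j<n. u L \<omega> (real m / L) (real j / L) - u L \<omega> 0 (real j / L)) = T L m n \<omega>"
    unfolding z u_lattice[OF L] T_def qL
    by (rule lattice_telegraph_sum) (use reg in \<open>auto simp: regular_def\<close>)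
  then show ?thesis using residual_riemann[OF L m n] by linarith
qed

lemma T_small:
  assumes X: "X \<in> {0..A}" and Y: "Y \<in> {0..B}" and \<epsilon>: "\<epsilon> > 0" and \<eta>: "\<eta> > 0"
  shows "\<forall>\<^sub>F L in at_top. {\<omega> \<in> space (M L). (T L (nat \<lfloor>L * X\<rfloor>) (nat \<lfloor>L * Y\<rfloor>) \<omega>)\<^sup>2 \<ge> \<epsilon>} \<in> sets (M L) \<and>
    measure (M L) {\<omega> \<in> space (M L). (T L (nat \<lfloor>L * X\<rfloor>) (nat \<lfloor>L * Y\<rfloor>) \<omega>)\<^sup>2 \<ge> \<epsilon>} \<le> \<eta>"
proof -
  define D where "D = (\<lambda>L. vertex_defect (q L) (real I * \<beta>\<^sub>1 / L) (real J * \<beta>\<^sub>2 / L))"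
  obtain C where C: "C \<ge> 0" and bounds: "\<And>\<eta>. \<eta> > 0 \<Longrightarrow> \<forall>\<^sub>F L in at_top. \<forall>a\<le>I. \<forall>b\<le>J. moment_bounds I J (q L) (\<alpha> L) (D L)
      (C / L\<^sup>2) (\<eta> / L\<^sup>2) (\<eta> / L\<^sup>2) a b"
    using uniform_defect_bounds[of I J] unfolding D_def by blast
  \<comment> \<open>\<open>Q * \<eta>'\<close> is what remains of the second moment bound after
    inserting \<open>m \<le> L * A\<close> and \<open>n \<le> L * B\<close>: all powers of L cancel.
    \<open>\<eta>'\<close> is chosen to make it \<open>\<eta> * \<epsilon>\<close>, as Markov's
    inequality for the square requires.\<close>
  define Q where "Q = (A * B)\<^sup>2 * (K0\<^sup>2 * C) + A * B * K0\<^sup>2"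
  have Q: "Q > 0" unfolding Q_def using AB C K0 by (intro add_nonneg_pos mult_nonneg_nonneg mult_pos_pos) auto
  define \<eta>' where "\<eta>' = \<eta> * \<epsilon> / Q"
  have \<eta>': "\<eta>' > 0" using Q \<epsilon> \<eta> by (simp add: \<eta>'_def)
  show ?thesis
    using bounds[OF \<eta>'] model eventually_gt_at_top[of 0]
  proof eventually_elim
    case (elim L)
    interpret S: shs6v "M L" I J "q L" "\<alpha> L" "V L" "E L" by (rule elim(2))
    define m n where "m = nat \<lfloor>L * X\<rfloor>" and "n = nat \<lfloor>L * Y\<rfloor>"
    have m: "real m \<le> L * A" and n: "real n \<le> L * B"
    proof -
      have "real m \<le> L * X" "real n \<le> L * Y" using X Y elim(3) by (auto simp: m_def n_def)
      moreover have "L * X \<le> L * A" "L * Y \<le> L * B" using X Y elim(3) by (auto intro!: mult_left_mono)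
      ultimately show "real m \<le> L * A" "real n \<le> L * B" by linarith+
    qed
    have u_le: "exp (\<delta> / L * ht L x y \<omega>) \<le> K0" if "x < m" "y < n" "\<omega> \<in> space (M L)" for x y \<omega>
    proof -
      have "\<bar>ht L x y \<omega>\<bar> \<le> real I * real x + real J * real y"
        using S.V_le[OF that(3)] S.E_le[OF that(3)] by (intro height_bound)
      also have "\<dots> \<le> real I * (L * A) + real J * (L * B)"
        using that m n by (intro add_mono mult_left_mono) auto
      also have "\<dots> = L * R" by (simp add: R_def algebra_simps)
      finally have "\<bar>ht L x y \<omega> / L\<bar> \<le> R" using elim(3) by (simp add: field_simps)
      from order_trans[OF abs_ge_self \<delta>_w_le[OF this]] show ?thesis by (simp add: K0_def)
    qed
    have c: "0 \<le> C / L\<^sup>2" "0 \<le> \<eta>' / L\<^sup>2" using C \<eta>' by auto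
    have moment: "integrable (M L) (\<lambda>\<omega>. (T L m n \<omega>)\<^sup>2)"
      "(\<integral>\<omega>. (T L m n \<omega>)\<^sup>2 \<partial>M L) \<le> (real m * real n)\<^sup>2 * (K0\<^sup>2 * (C / L\<^sup>2) * (\<eta>' / L\<^sup>2)) + real m * real n * (K0\<^sup>2 * (\<eta>' / L\<^sup>2))"
    proof -
      have b: "(\<Sum>i\<le>I. \<Sum>j\<le>J. S.weight a b i j * \<bar>D L a b i\<bar>) \<le> C / L\<^sup>2"
        "\<bar>\<Sum>i\<le>I. \<Sum>j\<le>J. S.weight a b i j * D L a b i\<bar> \<le> \<eta>' / L\<^sup>2"
        "(\<Sum>i\<le>I. \<Sum>j\<le>J. S.weight a b i j * (D L a b i)\<^sup>2) \<le> \<eta>' / L\<^sup>2"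
        if "a \<le> I" "b \<le> J" "stochastic_row I J (q L) (\<alpha> L) a b" for a b
        using elim(1) that by blast+
      have T: "T L m n = (\<lambda>\<omega>. \<Sum>x<m. \<Sum>y<n. exp (\<delta> / L * ht L x y \<omega>) * D L (V L x y \<omega>) (E L x y \<omega>) (V L x (Suc y) \<omega>))"
        by (simp add: T_def D_def \<kappa>\<^sub>1_def \<kappa>\<^sub>2_def fun_eq_iff)
      show "integrable (M L) (\<lambda>\<omega>. (T L m n \<omega>)\<^sup>2)"
        unfolding T by (rule S.second_moment_bound(1)[OF c(1) c(2) c(2) b less_imp_le[OF K0] u_le])
      show "(\<integral>\<omega>. (T L m n \<omega>)\<^sup>2 \<partial>M L) \<le> (real m * real n)\<^sup>2 * (K0\<^sup>2 * (C / L\<^sup>2) * (\<eta>' / L\<^sup>2)) + real m * real n * (K0\<^sup>2 * (\<eta>' / L\<^sup>2))"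
        unfolding T by (rule S.second_moment_bound(2)[OF c(1) c(2) c(2) b less_imp_le[OF K0] u_le])
    qed
    note moment(2)
    also have "(real m * real n)\<^sup>2 * (K0\<^sup>2 * (C / L\<^sup>2) * (\<eta>' / L\<^sup>2)) + real m * real n * (K0\<^sup>2 * (\<eta>' / L\<^sup>2))
        \<le> ((L * A) * (L * B))\<^sup>2 * (K0\<^sup>2 * (C / L\<^sup>2) * (\<eta>' / L\<^sup>2)) + (L * A) * (L * B) * (K0\<^sup>2 * (\<eta>' / L\<^sup>2))"
    proof -
      have mn: "real m * real n \<le> (L * A) * (L * B)"
        using m n elim(3) AB by (intro mult_mono) auto
      then have "(real m * real n)\<^sup>2 \<le> ((L * A) * (L * B))\<^sup>2" by (intro power_mono) auto
      then show ?thesis using mn c K0 by (intro add_mono mult_right_mono mult_nonneg_nonneg) auto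
    qed
    also have "\<dots> = Q * \<eta>'"
      using elim(3) by (simp add: Q_def field_simps power2_eq_square)
    also have "\<dots> = \<eta> * \<epsilon>" using Q by (simp add: \<eta>'_def)
    finally have le: "(\<integral>\<omega>. (T L m n \<omega>)\<^sup>2 \<partial>M L) \<le> \<eta> * \<epsilon>" .
    have meas: "(\<lambda>\<omega>. (T L m n \<omega>)\<^sup>2) \<in> borel_measurable (M L)"
      by (rule borel_measurable_integrable[OF moment(1)])
    have "measure (M L) {\<omega> \<in> space (M L). (T L m n \<omega>)\<^sup>2 \<ge> \<epsilon>} \<le> (\<integral>\<omega>. (T L m n \<omega>)\<^sup>2 \<partial>M L) / \<epsilon>"
      by (rule integral_Markov_inequality_measure[OF moment(1), of "{}"]) (use \<epsilon> in auto)
    also have "\<dots> \<le> \<eta>" using le \<epsilon> by (simp add: field_simps)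
    finally show ?case using meas unfolding m_def n_def by auto
  qed
qed

lemma eventually_good_boundary:
  assumes "tendsto_in_prob M X 0 at_top" "\<epsilon> > 0" "\<eta> > 0"
  shows "\<forall>\<^sub>F L in at_top. {\<omega> \<in> space (M L). \<bar>X L \<omega> - 0\<bar> > \<epsilon>} \<in> sets (M L) \<and>
    measure (M L) {\<omega> \<in> space (M L). \<bar>X L \<omega> - 0\<bar> > \<epsilon>} \<le> \<eta>"
proof -
  have "\<forall>\<^sub>F L in at_top. X L \<in> borel_measurable (M L)"
    using assms(1) by (simp add: tendsto_in_prob_def)
  moreover have "((\<lambda>L. measure (M L) {\<omega> \<in> space (M L). \<bar>X L \<omega> - 0\<bar> > \<epsilon>}) \<longlongrightarrow> 0) at_top"
    using assms(1,2) unfolding tendsto_in_prob_def by blast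
  then have "\<forall>\<^sub>F L in at_top. measure (M L) {\<omega> \<in> space (M L). \<bar>X L \<omega> - 0\<bar> > \<epsilon>} < \<eta>"
    using assms(3) by (rule order_tendstoD)
  ultimately show ?thesis
  proof eventually_elim
    case (elim L)
    have "{\<omega> \<in> space (M L). \<bar>X L \<omega> - 0\<bar> > \<epsilon>} \<in> sets (M L)"
      using elim(1) by measurable
    with elim(2) show ?case by simp
  qed
qed

text \<open>Boundedness of \<open>f\<close> and \<open>g\<close> makes the supremum an upper bound
  of its members; otherwise its value would say nothing about single points.\<close>

lemma SUP_close:
  fixes f g :: "real \<Rightarrow> real"
  assumes "\<bar>(SUP x\<in>{0..D}. \<bar>f x - g x\<bar>) - 0\<bar> \<le> \<epsilon>" "x \<in> {0..D}"
    and "\<And>x. x \<in> {0..D} \<Longrightarrow> \<bar>f x\<bar> \<le> r" "\<And>x. x \<in> {0..D} \<Longrightarrow> \<bar>g x\<bar> \<le> c"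
  shows "\<bar>f x - g x\<bar> \<le> \<epsilon>"
proof -
  have "\<bar>f x - g x\<bar> \<le> (SUP x\<in>{0..D}. \<bar>f x - g x\<bar>)"
  proof (rule cSUP_upper[OF assms(2)])
    have "\<bar>f x - g x\<bar> \<le> r + c" if "x \<in> {0..D}" for x
      using assms(3,4)[OF that] by linarith
    then show "bdd_above ((\<lambda>x. \<bar>f x - g x\<bar>) ` {0..D})" by (intro bdd_aboveI2)
  qed
  then show ?thesis using assms(1) by linarith
qed

lemma exp_boundary_close:
  assumes "\<bar>z - c\<bar> \<le> \<epsilon>" "\<bar>z\<bar> \<le> R" "\<epsilon> \<le> 1"
  shows "\<bar>exp (\<delta> * z) - exp (\<delta> * c)\<bar> \<le> exp (\<bar>\<delta>\<bar> * (R + 1)) * \<bar>\<delta>\<bar> * \<epsilon>"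
proof -
  have "\<bar>z\<bar> \<le> R + 1" "\<bar>c\<bar> \<le> R + 1" using assms by linarith+
  then have "\<delta> * z \<le> \<bar>\<delta>\<bar> * (R + 1)" "\<delta> * c \<le> \<bar>\<delta>\<bar> * (R + 1)"
    using \<delta>_w_le by (metis abs_le_D1)+
  then have "\<bar>exp (\<delta> * z) - exp (\<delta> * c)\<bar> \<le> exp (\<bar>\<delta>\<bar> * (R + 1)) * \<bar>\<delta> * z - \<delta> * c\<bar>"
    by (rule exp_diff_le)
  also have "\<bar>\<delta> * z - \<delta> * c\<bar> = \<bar>\<delta>\<bar> * \<bar>z - c\<bar>" by (simp add: abs_mult flip: right_diff_distrib)
  also have "exp (\<bar>\<delta>\<bar> * (R + 1)) * (\<bar>\<delta>\<bar> * \<bar>z - c\<bar>) \<le> exp (\<bar>\<delta>\<bar> * (R + 1)) * (\<bar>\<delta>\<bar> * \<epsilon>)"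
    using assms by (intro mult_left_mono) auto
  finally show ?thesis by (simp add: mult.assoc)
qed

text \<open>
  The residual is Lipschitz uniformly in \<open>L\<close>, so it suffices to control it at the points of a grid
  whose mesh does not depend on \<open>L\<close>.
\<close>

lemma residual_from_grid:
  assumes reg: "regular L \<omega>" and L: "L > 0" and qL: "q L = exp (\<delta> / L)" and N: "N > 0"
    and T: "\<And>i j. i \<le> N \<Longrightarrow> j \<le> N \<Longrightarrow>
      \<bar>T_grid N L i j \<omega>\<bar> \<le> \<epsilon>"
    and X: "X \<in> {0..A}" and Y: "Y \<in> {0..B}"
  shows "\<bar>residual (u L \<omega>) X Y\<bar> \<le> \<epsilon> + 2 * K1 * (\<kappa>\<^sub>1 * A + \<kappa>\<^sub>2 * B) / L
    + (2 * K1 + (\<kappa>\<^sub>1 + \<kappa>\<^sub>2) * (2 * K0 + (A + B) * K1)) * ((A + B) / real N + 2 / L)"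
proof -
  interpret lipschitz_on_rectangle "u L \<omega>" A B K0 K1 \<kappa>\<^sub>1 \<kappa>\<^sub>2 by (rule u_lipschitz[OF reg L])
  define C where "C = 2 * K1 + (\<kappa>\<^sub>1 + \<kappa>\<^sub>2) * (2 * K0 + (A + B) * K1)"
  have C: "C \<ge> 0" unfolding C_def using nonneg by (intro add_nonneg_nonneg mult_nonneg_nonneg) auto
  \<comment> \<open>Round down twice: to the coarse grid of mesh \<open>D / N\<close>, then to the
    lattice of mesh \<open>1 / L\<close>; the errors add.\<close>
  have grid: "\<exists>i m. i \<le> N \<and> m = nat \<lfloor>L * (real i * D / real N)\<rfloor> \<and> real m / L \<in> {0..D} \<and>
      \<bar>Z - real m / L\<bar> \<le> D / real N + 1 / L" if D: "D > 0" and Z: "Z \<in> {0..D}" for D Z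
  proof -
    define i where "i = nat \<lfloor>Z * real N / D\<rfloor>"
    define m where "m = nat \<lfloor>L * (real i * D / real N)\<rfloor>"
    have i: "real i \<le> Z * real N / D" "Z * real N / D \<le> real i + 1"
      using D Z by (auto simp: i_def)
    have "Z * real N / D \<le> real N" using D Z N by (simp add: field_simps)
    then have iN: "i \<le> N" using i(1) by linarith
    have m: "real m \<le> L * (real i * D / real N)" "L * (real i * D / real N) \<le> real m + 1"
      using D L by (auto simp: m_def)
    have 1: "real i * D / real N \<le> Z" "Z \<le> real i * D / real N + D / real N"
      using i D N by (simp_all add: field_simps)
    have 2: "real m / L \<le> real i * D / real N" "real i * D / real N \<le> real m / L + 1 / L"
      using m L by (simp_all add: field_simps)
    have "real m / L \<ge> 0" using L by simp
    then have "real m / L \<in> {0..D}" "\<bar>Z - real m / L\<bar> \<le> D / real N + 1 / L"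
      using 1 2 Z D N L by (auto simp: abs_le_iff intro: order_trans)
    with iN show ?thesis unfolding m_def by blast
  qed
  obtain i m where i: "i \<le> N" and m: "m = nat \<lfloor>L * (real i * A / real N)\<rfloor>" "real m / L \<in> {0..A}"
    "\<bar>X - real m / L\<bar> \<le> A / real N + 1 / L"
    using grid[OF AB(1) X] by blast
  obtain j n where j: "j \<le> N" and n: "n = nat \<lfloor>L * (real j * B / real N)\<rfloor>" "real n / L \<in> {0..B}"
    "\<bar>Y - real n / L\<bar> \<le> B / real N + 1 / L"
    using grid[OF AB(2) Y] by blast
  have mn: "real m \<le> L * A" "real n \<le> L * B" using m(2) n(2) L by (auto simp: field_simps)
  have "\<bar>residual (u L \<omega>) X Y - residual (u L \<omega>) (real m / L) (real n / L)\<bar>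
      \<le> C * (\<bar>X - real m / L\<bar> + \<bar>Y - real n / L\<bar>)"
    unfolding C_def by (rule residual_lipschitz[OF X m(2) Y n(2)])
  also have "\<dots> \<le> C * ((A + B) / real N + 2 / L)"
  proof (rule mult_left_mono[OF _ C])
    have "(A + B) / real N + 2 / L = (A / real N + 1 / L) + (B / real N + 1 / L)"
      by (simp add: add_divide_distrib)
    then show "\<bar>X - real m / L\<bar> + \<bar>Y - real n / L\<bar> \<le> (A + B) / real N + 2 / L"
      using m(3) n(3) by linarith
  qed
  finally have "\<bar>residual (u L \<omega>) X Y - residual (u L \<omega>) (real m / L) (real n / L)\<bar>
      \<le> C * ((A + B) / real N + 2 / L)" .
  moreover have "\<bar>p\<bar> \<le> \<epsilon> + e + e'" if "\<bar>p - r\<bar> \<le> e'" "\<bar>r\<bar> \<le> t + e" "t \<le> \<epsilon>" for p r t e e' :: real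
    using that by linarith
  ultimately show ?thesis
    using residual_lattice[OF reg L qL mn] T[OF i j] unfolding C_def m(1)[symmetric] n(1)[symmetric] by blast
qed

section \<open>Approximate solutions with high probability\<close>

lemma good_configuration:
  assumes reg: "regular L \<omega>" and L: "L > 0" and qL: "q L = exp (\<delta> / L)" and N: "N > 0"
    and T: "\<And>i j. i \<le> N \<Longrightarrow> j \<le> N \<Longrightarrow>
      \<bar>T_grid N L i j \<omega>\<bar> \<le> \<epsilon> / 2"
    and err: "2 * K1 * (\<kappa>\<^sub>1 * A + \<kappa>\<^sub>2 * B) / L +
      (2 * K1 + (\<kappa>\<^sub>1 + \<kappa>\<^sub>2) * (2 * K0 + (A + B) * K1)) * ((A + B) / real N + 2 / L) < \<epsilon> / 2"
    and x_close: "\<bar>(SUP x\<in>{0..A}. \<bar>1 / L * H L (L * x) 0 \<omega> - chi x\<bar>) - 0\<bar> \<le> \<epsilon>1"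
    and y_close: "\<bar>(SUP y\<in>{0..B}. \<bar>1 / L * H L 0 (L * y) \<omega> - psi y\<bar>) - 0\<bar> \<le> \<epsilon>1"
    and \<epsilon>1: "\<epsilon>1 \<le> 1" "exp (\<bar>\<delta>\<bar> * (R + 1)) * \<bar>\<delta>\<bar> * \<epsilon>1 \<le> \<epsilon>"
  shows "approx \<epsilon> (u L \<omega>)"
proof -
  interpret U: lipschitz_on_rectangle "u L \<omega>" A B K0 K1 \<kappa>\<^sub>1 \<kappa>\<^sub>2 by (rule u_lipschitz[OF reg L])
  have wb: "\<bar>w L \<omega> x y\<bar> \<le> R" if "x \<in> {0..A}" "y \<in> {0..B}" for x y
    by (rule w_bound[OF reg L that])
  obtain c where c: "\<And>x. x \<in> {0..A} \<Longrightarrow> \<bar>chi x\<bar> \<le> c" using chi_bdd by blast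
  obtain c' where c': "\<And>y. y \<in> {0..B} \<Longrightarrow> \<bar>psi y\<bar> \<le> c'" using psi_bdd by blast
  have "\<bar>residual (u L \<omega>) X Y\<bar> \<le> \<epsilon>" if "X \<in> {0..A}" "Y \<in> {0..B}" for X Y
    using residual_from_grid[OF reg L qL N T that] err by linarith
  moreover have "\<bar>u L \<omega> x 0 - exp (\<delta> * chi x)\<bar> \<le> \<epsilon>" if x: "x \<in> {0..A}" for x
  proof -
    have b: "\<bar>w L \<omega> x 0\<bar> \<le> R" if "x \<in> {0..A}" for x using wb[OF that, of 0] AB by simp
    have "\<bar>(SUP x\<in>{0..A}. \<bar>w L \<omega> x 0 - chi x\<bar>) - 0\<bar> \<le> \<epsilon>1"
      using x_close by (simp add: w_def)
    then have "\<bar>w L \<omega> x 0 - chi x\<bar> \<le> \<epsilon>1"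
      by (rule SUP_close[OF _ x b c])
    then have "\<bar>u L \<omega> x 0 - exp (\<delta> * chi x)\<bar> \<le> exp (\<bar>\<delta>\<bar> * (R + 1)) * \<bar>\<delta>\<bar> * \<epsilon>1"
      unfolding u_def by (rule exp_boundary_close[OF _ b[OF x] \<epsilon>1(1)])
    then show ?thesis using \<epsilon>1(2) by linarith
  qed
  moreover have "\<bar>u L \<omega> 0 y - exp (\<delta> * psi y)\<bar> \<le> \<epsilon>" if y: "y \<in> {0..B}" for y
  proof -
    have b: "\<bar>w L \<omega> 0 y\<bar> \<le> R" if "y \<in> {0..B}" for y using wb[OF _ that, of 0] AB by simp
    have "\<bar>(SUP y\<in>{0..B}. \<bar>w L \<omega> 0 y - psi y\<bar>) - 0\<bar> \<le> \<epsilon>1"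
      using y_close by (simp add: w_def)
    then have "\<bar>w L \<omega> 0 y - psi y\<bar> \<le> \<epsilon>1"
      by (rule SUP_close[OF _ y b c'])
    then have "\<bar>u L \<omega> 0 y - exp (\<delta> * psi y)\<bar> \<le> exp (\<bar>\<delta>\<bar> * (R + 1)) * \<bar>\<delta>\<bar> * \<epsilon>1"
      unfolding u_def by (rule exp_boundary_close[OF _ b[OF y] \<epsilon>1(1)])
    then show ?thesis using \<epsilon>1(2) by linarith
  qed
  ultimately show ?thesis using U.cont unfolding telegraph_approx_def by blast
qed

text \<open>Union bound over a null set, the two boundary events and the \<open>(N + 1) ^ 2\<close>
  grid events. \<open>N\<close> is fixed before L grows, so their number stays bounded.\<close>

lemma good_event:
  assumes \<epsilon>: "\<epsilon> > 0" and \<eta>: "\<eta> > 0"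
  shows "\<forall>\<^sub>F L in at_top. \<exists>Bad\<in>sets (M L). measure (M L) Bad \<le> \<eta> \<and>
    (\<forall>\<omega>\<in>space (M L) - Bad. approx \<epsilon> (u L \<omega>) \<and>
      (\<forall>x\<in>{0..A}. \<forall>y\<in>{0..B}. \<bar>w L \<omega> x y\<bar> \<le> R))"
proof -
  define K2 where "K2 = exp (\<bar>\<delta>\<bar> * (R + 1)) * \<bar>\<delta>\<bar>"
  have K2: "K2 > 0" using \<delta> by (simp add: K2_def)
  \<comment> \<open>The bound 1 keeps the boundary limits within \<open>R + 1\<close>, the range on
    which \<open>K2\<close> is a Lipschitz constant; the quotient turns closeness of heights into
    closeness of exponentials.\<close>
  define \<epsilon>1 where "\<epsilon>1 = min 1 (\<epsilon> / K2)"
  have \<epsilon>1: "\<epsilon>1 > 0" "\<epsilon>1 \<le> 1" "K2 * \<epsilon>1 \<le> \<epsilon>" using K2 \<epsilon> by (auto simp: \<epsilon>1_def min_def field_simps)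
  define C where "C = 2 * K1 + (\<kappa>\<^sub>1 + \<kappa>\<^sub>2) * (2 * K0 + (A + B) * K1)"
  define err where "err N L = 2 * K1 * (\<kappa>\<^sub>1 * A + \<kappa>\<^sub>2 * B) / L + C * ((A + B) / real N + 2 / L)" for N L
  \<comment> \<open>The mesh may use a quarter of \<open>\<epsilon>\<close>; for fixed
    \<open>N\<close> the other discretization errors vanish as L grows.\<close>
  have "(\<lambda>N. C * ((A + B) / real N)) \<longlonglongrightarrow> 0"
    using tendsto_mult_left[OF lim_const_over_n[of "A + B"], of C] by simp
  then have "\<forall>\<^sub>F N in sequentially. C * ((A + B) / real N) < \<epsilon> / 4"
    using \<epsilon> by (intro order_tendstoD) auto
  then obtain N where N: "N > 0" "C * ((A + B) / real N) < \<epsilon> / 4"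
    using eventually_gt_at_top[of 0] by (metis (mono_tags, lifting) eventually_conj eventually_happens' sequentially_bot)
  define z where "z = C * ((A + B) / real N)"
  have "((\<lambda>L. err N L) \<longlongrightarrow> 0 + C * ((A + B) / real N + 0)) at_top"
    unfolding err_def by (intro tendsto_add tendsto_mult tendsto_const tendsto_divide_0[OF tendsto_const] filterlim_at_top_imp_at_infinity filterlim_ident)
  then have "((\<lambda>L. err N L) \<longlongrightarrow> z) at_top" by (simp add: z_def)
  moreover have "z < \<epsilon> / 2" using N(2)[folded z_def] \<epsilon> by simp
  ultimately have err: "\<forall>\<^sub>F L in at_top. err N L < \<epsilon> / 2" by (rule order_tendstoD)
  define S where "S L i j = {\<omega> \<in> space (M L). (T_grid N L i j \<omega>)\<^sup>2 \<ge> (\<epsilon> / 2)\<^sup>2}" for L i j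
  define \<eta>1 where "\<eta>1 = \<eta> / (3 * (real N + 1)\<^sup>2)"
  have N1: "(real N + 1)\<^sup>2 > 0" by (rule zero_less_power) simp
  then have \<eta>1: "\<eta>1 > 0" using \<eta> by (simp add: \<eta>1_def)
  have S: "\<forall>\<^sub>F L in at_top. \<forall>i\<in>{..N}. \<forall>j\<in>{..N}. S L i j \<in> sets (M L) \<and> measure (M L) (S L i j) \<le> \<eta>1"
  proof (intro eventually_ball_finite ballI finite_atMost)
    fix i j assume "i \<in> {..N}" "j \<in> {..N}"
    then have "real i * A / real N \<in> {0..A}" "real j * B / real N \<in> {0..B}"
      using N AB by (auto simp: field_simps)
    then show "\<forall>\<^sub>F L in at_top. S L i j \<in> sets (M L) \<and> measure (M L) (S L i j) \<le> \<eta>1"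
      unfolding S_def using \<epsilon> \<eta>1 by (intro T_small) auto
  qed
  define Sx where "Sx L = {\<omega> \<in> space (M L). \<bar>(SUP x\<in>{0..A}. \<bar>1 / L * H L (L * x) 0 \<omega> - chi x\<bar>) - 0\<bar> > \<epsilon>1}" for L
  define Sy where "Sy L = {\<omega> \<in> space (M L). \<bar>(SUP y\<in>{0..B}. \<bar>1 / L * H L 0 (L * y) \<omega> - psi y\<bar>) - 0\<bar> > \<epsilon>1}" for L
  have Sx: "\<forall>\<^sub>F L in at_top. Sx L \<in> sets (M L) \<and> measure (M L) (Sx L) \<le> \<eta> / 3"
    unfolding Sx_def using eventually_good_boundary[OF chi_limit \<epsilon>1(1), of "\<eta> / 3"] \<eta> by simp
  have Sy: "\<forall>\<^sub>F L in at_top. Sy L \<in> sets (M L) \<and> measure (M L) (Sy L) \<le> \<eta> / 3"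
    unfolding Sy_def using eventually_good_boundary[OF psi_limit \<epsilon>1(1), of "\<eta> / 3"] \<eta> by simp
  show ?thesis
    using S Sx Sy err model q_eq eventually_gt_at_top[of 0]
  proof eventually_elim
    case (elim L)
    interpret P: shs6v "M L" I J "q L" "\<alpha> L" "V L" "E L" by (rule elim(5))
    have L: "L > 0" by (rule elim(7))
    have "AE \<omega> in M L. regular L \<omega>"
      using P.conservation AE_space
      by eventually_elim (auto simp: regular_def P.V_le P.E_le)
    \<comment> \<open>A measurable null set containing the irregular configurations; this set, not
      the irregular set itself, enters \<open>Bad\<close>.\<close>
    then obtain N0 where N0: "{\<omega> \<in> space (M L). \<not> regular L \<omega>} \<subseteq> N0" "emeasure (M L) N0 = 0" "N0 \<in> sets (M L)"
      by (rule AE_E)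
    define G where "G = (\<Union>p\<in>{..N} \<times> {..N}. S L (fst p) (snd p))"
    have G: "G \<in> sets (M L)" unfolding G_def using elim(1) by (intro sets.finite_UN) auto
    have "measure (M L) G \<le> (\<Sum>p\<in>{..N} \<times> {..N}. measure (M L) (S L (fst p) (snd p)))"
      unfolding G_def using elim(1) by (intro P.finite_measure_subadditive_finite) auto
    also have "\<dots> \<le> (\<Sum>p\<in>{..N} \<times> {..N}. \<eta>1)"
      using elim(1) by (intro sum_mono) auto
    also have "\<dots> = (real N + 1)\<^sup>2 * \<eta>1"
      by (simp add: power2_eq_square algebra_simps)
    also have "\<dots> = \<eta> / 3"
      using N1 by (simp add: \<eta>1_def)
    finally have mG: "measure (M L) G \<le> \<eta> / 3" .
    have sets: "Sx L \<in> sets (M L)" "Sy L \<in> sets (M L)" using elim by auto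
    define Bad where "Bad = N0 \<union> (Sx L \<union> (Sy L \<union> G))"
    have "measure (M L) Bad \<le> measure (M L) N0 + measure (M L) (Sx L \<union> (Sy L \<union> G))"
      unfolding Bad_def using N0(3) sets G by (intro measure_Un_le) auto
    also have "measure (M L) (Sx L \<union> (Sy L \<union> G)) \<le> measure (M L) (Sx L) + measure (M L) (Sy L \<union> G)"
      using sets G by (intro measure_Un_le) auto
    also have "measure (M L) (Sy L \<union> G) \<le> measure (M L) (Sy L) + measure (M L) G"
      using sets G by (intro measure_Un_le) auto
    also have "measure (M L) N0 = 0" using N0(2) by (simp add: measure_def)
    finally have "measure (M L) Bad \<le> \<eta>" using mG elim(2,3) by linarith
    moreover have "Bad \<in> sets (M L)" unfolding Bad_def using N0(3) sets G by auto
    moreover have "approx \<epsilon> (u L \<omega>) \<and>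
        (\<forall>x\<in>{0..A}. \<forall>y\<in>{0..B}. \<bar>w L \<omega> x y\<bar> \<le> R)" if \<omega>: "\<omega> \<in> space (M L) - Bad" for \<omega>
    proof -
      have sp: "\<omega> \<in> space (M L)" and notin: "\<omega> \<notin> N0" "\<omega> \<notin> Sx L" "\<omega> \<notin> Sy L" "\<omega> \<notin> G"
        using \<omega> by (simp_all add: Bad_def)
      have reg: "regular L \<omega>" using sp notin(1) N0(1) by blast
      have grid: "\<bar>T_grid N L i j \<omega>\<bar> \<le> \<epsilon> / 2"
        if "i \<le> N" "j \<le> N" for i j
      proof -
        have "\<omega> \<notin> S L i j" using notin(4) that by (force simp: G_def)
        then have "(T_grid N L i j \<omega>)\<^sup>2 \<le> (\<epsilon> / 2)\<^sup>2"
          using sp by (simp add: S_def not_le)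
        then have "\<bar>T_grid N L i j \<omega>\<bar> \<le> \<bar>\<epsilon> / 2\<bar>"
          unfolding abs_le_square_iff .
        then show ?thesis using \<epsilon> by simp
      qed
      show ?thesis
      proof
        show "approx \<epsilon> (u L \<omega>)"
          by (rule good_configuration[OF reg L elim(6) N(1) grid elim(4)[unfolded err_def C_def] _ _ \<epsilon>1(2) \<epsilon>1(3)[unfolded K2_def]])
            (use sp notin in \<open>auto simp: Sx_def Sy_def not_less\<close>)
        show "\<forall>x\<in>{0..A}. \<forall>y\<in>{0..B}. \<bar>w L \<omega> x y\<bar> \<le> R"
          using w_bound[OF reg L] by blast
      qed
    qed
    ultimately show ?case by blast
  qed
qed

section \<open>The limit shape and convergence to it\<close>

text \<open>An event of measure at most 1/2 cannot exhaust the space, so every tolerance is realised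
  by some \<open>u L \<omega>\<close>. The bound \<open>R\<close> on rescaled heights gives a
  positive lower bound that survives the limit.\<close>

lemma limit_exists:
  obtains h where "bvp (\<lambda>x y. exp (\<delta> * h x y))"
    and "\<And>x y. x \<in> {0..A} \<Longrightarrow> y \<in> {0..B} \<Longrightarrow> \<delta> * h x y \<ge> - (\<bar>\<delta>\<bar> * R)"
proof -
  have "\<exists>U. bvp U \<and>
      (\<forall>x\<in>{0..A}. \<forall>y\<in>{0..B}. U x y \<ge> exp (- (\<bar>\<delta>\<bar> * R)))"
  proof (rule telegraph_bvp_exists)
    fix \<epsilon> :: real assume "\<epsilon> > 0"
    from eventually_conj[OF good_event[OF this, of "1 / 2"] model]
    obtain L Bad where model': "shs6v (M L) I J (q L) (\<alpha> L) (V L) (E L)"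
      and Bad: "Bad \<in> sets (M L)" "measure (M L) Bad \<le> 1 / 2"
      and good: "\<And>\<omega>. \<omega> \<in> space (M L) - Bad \<Longrightarrow>
        approx \<epsilon> (u L \<omega>) \<and>
        (\<forall>x\<in>{0..A}. \<forall>y\<in>{0..B}. \<bar>w L \<omega> x y\<bar> \<le> R)"
      using eventually_happens'[OF trivial_limit_at_top_linorder] by force
    interpret P: shs6v "M L" I J "q L" "\<alpha> L" "V L" "E L" by (rule model')
    have "space (M L) - Bad \<noteq> {}"
    proof
      assume "space (M L) - Bad = {}"
      then have "Bad = space (M L)" using sets.sets_into_space[OF Bad(1)] by blast
      then show False using Bad(2) P.prob_space by simp
    qed
    then obtain \<omega> where \<omega>: "\<omega> \<in> space (M L) - Bad" by blast
    have "u L \<omega> x y \<ge> exp (- (\<bar>\<delta>\<bar> * R))" if "x \<in> {0..A}" "y \<in> {0..B}" for x y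
      using \<delta>_w_le[of "w L \<omega> x y" R] good[OF \<omega>] that unfolding u_def by (simp add: abs_le_iff)
    then show "\<exists>u. approx \<epsilon> u \<and>
        (\<forall>x\<in>{0..A}. \<forall>y\<in>{0..B}. u x y \<ge> exp (- (\<bar>\<delta>\<bar> * R)))"
      using good[OF \<omega>] by blast
  qed (use \<kappa> AB in auto)
  then obtain U where U: "bvp U"
    and ge: "\<And>x y. x \<in> {0..A} \<Longrightarrow> y \<in> {0..B} \<Longrightarrow> U x y \<ge> exp (- (\<bar>\<delta>\<bar> * R))" by blast
  define h where "h x y = ln (U x y) / \<delta>" for x y
  have \<delta>h: "\<delta> * h x y = ln (U x y)" for x y using \<delta> by (simp add: h_def)
  have eq: "exp (\<delta> * h x y) = U x y" if "x \<in> {0..A}" "y \<in> {0..B}" for x y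
    using ge[OF that] unfolding \<delta>h by (intro exp_ln) (rule less_le_trans[OF exp_gt_zero])
  show ?thesis
  proof
    show "bvp (\<lambda>x y. exp (\<delta> * h x y))"
      by (rule telegraph_bvp_cong[OF U]) (use eq AB in auto)
    show "\<delta> * h x y \<ge> - (\<bar>\<delta>\<bar> * R)" if "x \<in> {0..A}" "y \<in> {0..B}" for x y
    proof -
      have "exp (- (\<bar>\<delta>\<bar> * R)) \<le> exp (\<delta> * h x y)" using ge[OF that] eq[OF that] by simp
      then show ?thesis by simp
    qed
  qed
qed

lemma law_of_large_numbers:
  assumes h: "bvp (\<lambda>x y. exp (\<delta> * h x y))"
    and h_ge: "\<And>x y. x \<in> {0..A} \<Longrightarrow> y \<in> {0..B} \<Longrightarrow> \<delta> * h x y \<ge> - (\<bar>\<delta>\<bar> * R)"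
  shows "tendsto_in_prob M
    (\<lambda>L \<omega>. 1 / L * deviation h L \<omega>) 0 at_top"
  unfolding tendsto_in_prob_def
proof (intro conjI allI impI)
  show "\<forall>\<^sub>F L in at_top. (\<lambda>\<omega>. 1 / L * deviation h L \<omega>)
      \<in> borel_measurable (M L)"
    using model eventually_gt_at_top[of 0]
  proof eventually_elim
    case (elim L)
    interpret P: shs6v "M L" I J "q L" "\<alpha> L" "V L" "E L" by (rule elim(1))
    obtain N where N: "L * (A + B) + 2 \<le> real N" using real_arch_simple by blast
    show ?case
    proof (rule P.finite_window_measurable[of N])
      fix \<omega> \<omega>' assume *: "\<And>a b. a < N \<Longrightarrow> b < N \<Longrightarrow> V L a b \<omega> = V L a b \<omega>' \<and> E L a b \<omega> = E L a b \<omega>'"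
      have "H L (L * x) (L * y) \<omega> = H L (L * x) (L * y) \<omega>'" if "x \<in> {0..A}" "y \<in> {0..B}" for x y
      proof (rule height_ext_cong[OF *])
        have "L * x \<le> L * (A + B)" "L * y \<le> L * (A + B)"
          using that elim(2) AB by (auto intro!: mult_left_mono)
        then show "L * x + 2 \<le> real N" "L * y + 2 \<le> real N" using N by linarith+
        show "0 \<le> L * x" "0 \<le> L * y" using that elim(2) by auto
      qed
      then have "deviation h L \<omega> =
          deviation h L \<omega>'"
        by (intro SUP_cong) auto
      then show "1 / L * deviation h L \<omega> =
          1 / L * deviation h L \<omega>'" by simp
    qed
  qed
next
  fix \<kappa> :: real assume \<kappa>0: "\<kappa> > 0"
  define K where "K = 2 * (4 + \<kappa>\<^sub>1 * A + \<kappa>\<^sub>2 * B) * exp (2 * (\<kappa>\<^sub>1 + \<kappa>\<^sub>2) * (A + B))"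
  have K: "K > 0" unfolding K_def using \<kappa> AB by (intro mult_pos_pos add_pos_nonneg) auto
  \<comment> \<open>Chosen so that
    \<open>K0 * K * \<epsilon> = \<bar>\<delta>\<bar> * \<kappa>\<close>: \<open>K\<close> is the
    stability constant, and \<open>K0\<close> is the cost of inverting \<open>exp\<close> above
    \<open>- (\<bar>\<delta>\<bar> * R)\<close>.\<close>
  define \<epsilon> where "\<epsilon> = \<kappa> * \<bar>\<delta>\<bar> / (K0 * K)"
  have \<epsilon>: "\<epsilon> > 0" using \<kappa>0 \<delta> K K0 by (simp add: \<epsilon>_def)
  let ?X = "\<lambda>L \<omega>. 1 / L * deviation h L \<omega>"
  show "((\<lambda>L. measure (M L) {\<omega> \<in> space (M L). \<bar>?X L \<omega> - 0\<bar> > \<kappa>}) \<longlongrightarrow> 0) at_top"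
  proof (rule tendstoI)
    fix \<eta> :: real assume \<eta>: "\<eta> > 0"
    have "\<forall>\<^sub>F L in at_top. measure (M L) {\<omega> \<in> space (M L). \<bar>?X L \<omega> - 0\<bar> > \<kappa>} \<le> \<eta> / 2"
      using good_event[OF \<epsilon>, of "\<eta> / 2", OF half_gt_zero[OF \<eta>]] model eventually_gt_at_top[of 0]
    proof eventually_elim
      case (elim L)
      interpret P: shs6v "M L" I J "q L" "\<alpha> L" "V L" "E L" by (rule elim(2))
      obtain Bad where Bad: "Bad \<in> sets (M L)" "measure (M L) Bad \<le> \<eta> / 2"
        and good: "\<And>\<omega>. \<omega> \<in> space (M L) - Bad \<Longrightarrow>
          approx \<epsilon> (u L \<omega>) \<and>
          (\<forall>x\<in>{0..A}. \<forall>y\<in>{0..B}. \<bar>w L \<omega> x y\<bar> \<le> R)"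
        using elim(1) by blast
      have "\<bar>?X L \<omega> - 0\<bar> \<le> \<kappa>" if \<omega>: "\<omega> \<in> space (M L) - Bad" for \<omega>
      proof -
        have pt: "\<bar>H L (L * x) (L * y) \<omega> - L * h x y\<bar> \<le> L * \<kappa>" if xy: "x \<in> {0..A}" "y \<in> {0..B}" for x y
        proof -
          have "- (\<bar>\<delta>\<bar> * R) \<le> \<delta> * w L \<omega> x y"
            using \<delta>_w_le[of "w L \<omega> x y" R] good[OF \<omega>] xy by (simp add: abs_le_iff)
          then have "\<bar>\<delta> * w L \<omega> x y - \<delta> * h x y\<bar> \<le> K0 * \<bar>u L \<omega> x y - exp (\<delta> * h x y)\<bar>"
            unfolding u_def K0_def by (rule diff_le_exp_diff[OF _ h_ge[OF xy]])
          also have "\<bar>u L \<omega> x y - exp (\<delta> * h x y)\<bar> \<le> K * (\<epsilon> + 0)"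
            unfolding K_def using good[OF \<omega>] \<kappa> AB xy
            by (intro telegraph_stability[OF _ h[folded telegraph_approx_0_iff]]) auto
          finally have "\<bar>\<delta>\<bar> * \<bar>w L \<omega> x y - h x y\<bar> \<le> K0 * (K * (\<epsilon> + 0))"
            using K0 by (simp add: abs_mult flip: right_diff_distrib)
          also have "\<dots> = \<bar>\<delta>\<bar> * \<kappa>" using K K0 by (simp add: \<epsilon>_def)
          finally have "\<bar>w L \<omega> x y - h x y\<bar> \<le> \<kappa>" using \<delta> by simp
          then have "L * \<bar>w L \<omega> x y - h x y\<bar> \<le> L * \<kappa>" using elim(3) by simp
          moreover have "L * \<bar>w L \<omega> x y - h x y\<bar> = \<bar>H L (L * x) (L * y) \<omega> - L * h x y\<bar>"
          proof -
            have "H L (L * x) (L * y) \<omega> - L * h x y = L * (w L \<omega> x y - h x y)"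
              using elim(3) by (simp add: w_def right_diff_distrib)
            then show ?thesis using elim(3) by (simp add: abs_mult)
          qed
          ultimately show ?thesis by simp
        qed
        define s where "s = deviation h L \<omega>"
        have "s \<le> L * \<kappa>"
          unfolding s_def using AB pt by (intro cSUP_least) auto
        \<comment> \<open>The absolute value at the origin is a member of the set, and
          \<open>pt\<close> provides the boundedness needed to compare it with the supremum.\<close>
        moreover have "s \<ge> 0"
        proof -
          have "\<bar>H L (L * 0) (L * 0) \<omega> - L * h 0 0\<bar> \<le> s"
            unfolding s_def using AB pt
            by (intro cSUP_upper2[of _ _ "(0, 0)"]) (auto intro!: bdd_aboveI2[where M = "L * \<kappa>"])
          then show ?thesis by linarith
        qed
        ultimately show ?thesis unfolding s_def[symmetric] using elim(3) by (simp add: field_simps)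
      qed
      then have "{\<omega> \<in> space (M L). \<bar>?X L \<omega> - 0\<bar> > \<kappa>} \<subseteq> Bad" by force
      then have "measure (M L) {\<omega> \<in> space (M L). \<bar>?X L \<omega> - 0\<bar> > \<kappa>} \<le> measure (M L) Bad"
        by (intro P.finite_measure_mono Bad)
      then show ?case using Bad(2) by linarith
    qed
    then show "\<forall>\<^sub>F L in at_top. dist (measure (M L) {\<omega> \<in> space (M L). \<bar>?X L \<omega> - 0\<bar> > \<kappa>}) 0 < \<eta>"
      by eventually_elim (use \<eta> in \<open>simp add: dist_real_def\<close>)
  qed
qed

end

section \<open>Limit of the spectral parameter and conclusion\<close>

text \<open>The defining relation is linear in \<open>\<alpha>\<close>: with
  \<open>x = exp (c / L)\<close> and \<open>y = exp (d / L)\<close> it reads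
  \<open>\<alpha> * (y - x) = x - 1\<close>, and \<open>y - x\<close> and \<open>x - 1\<close> are
  compared after multiplication by L.\<close>

lemma alpha_tendsto:
  fixes q \<alpha> :: "real \<Rightarrow> real" and \<beta>\<^sub>1 \<beta>\<^sub>2 :: real and J :: nat
  assumes q: "\<forall>\<^sub>F L in at_top. q L = exp ((\<beta>\<^sub>1 - \<beta>\<^sub>2) / L)"
    and \<alpha>: "\<forall>\<^sub>F L in at_top. (1 + \<alpha> L * q L ^ J) / (1 + \<alpha> L) = exp (- (J * \<beta>\<^sub>2 / L))"
    and "\<beta>\<^sub>1 > 0" "J \<ge> 1"
  shows "(\<alpha> \<longlongrightarrow> - (\<beta>\<^sub>2 / \<beta>\<^sub>1)) at_top"
proof -
  define c d where "c = - (real J * \<beta>\<^sub>2)" and "d = real J * (\<beta>\<^sub>1 - \<beta>\<^sub>2)"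
  have dc: "d - c = real J * \<beta>\<^sub>1" by (simp add: c_def d_def algebra_simps)
  have nz: "d - c \<noteq> 0" unfolding dc using assms(3,4) by simp
  have "((\<lambda>L. (L * (exp (c / L) - 1)) / (L * (exp (d / L) - 1) - L * (exp (c / L) - 1))) \<longlongrightarrow> c / (d - c)) at_top"
    by (intro tendsto_divide tendsto_diff tendsto_mult_exp_minus_one nz)
  then show ?thesis
  proof (rule Lim_transform_eventually[OF tendsto_eq_rhs])
    show "\<forall>\<^sub>F L in at_top. (L * (exp (c / L) - 1)) / (L * (exp (d / L) - 1) - L * (exp (c / L) - 1)) = \<alpha> L"
      using q \<alpha> eventually_gt_at_top[of 0]
    proof eventually_elim
      case (elim L)
      define x y where "x = exp (c / L)" and "y = exp (d / L)"
      have y: "q L ^ J = y" using elim by (simp add: y_def d_def flip: exp_of_nat_mult)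
      have eq: "(1 + \<alpha> L * y) / (1 + \<alpha> L) = x" using elim(2) by (simp add: y x_def c_def)
      have "x \<noteq> 0" by (simp add: x_def)
      \<comment> \<open>Division by 0 yields 0, whereas the quotient is an exponential.\<close>
      with eq have "1 + \<alpha> L \<noteq> 0" by auto
      with eq have "1 + \<alpha> L * y = x * (1 + \<alpha> L)" by (simp add: divide_eq_eq)
      then have "\<alpha> L * (y - x) = x - 1" by (simp add: algebra_simps)
      moreover have "y - x \<noteq> 0" using nz elim(3) by (simp add: x_def y_def)
      ultimately have "\<alpha> L = (x - 1) / (y - x)" by (simp add: eq_divide_eq)
      moreover have "L * (y - 1) - L * (x - 1) = L * (y - x)" by (simp add: algebra_simps)
      ultimately show ?case using elim(3) by (simp flip: x_def y_def)
    qed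
    show "c / (d - c) = - (\<beta>\<^sub>2 / \<beta>\<^sub>1)" unfolding dc using assms(3,4) by (simp add: c_def)
  qed
qed

lemma lipschitz_imp_bounded:
  fixes f :: "real \<Rightarrow> real"
  assumes "\<exists>C. C-lipschitz_on {0..D} f"
  shows "\<exists>c. \<forall>x\<in>{0..D}. \<bar>f x\<bar> \<le> c"
proof -
  have "continuous_on {0..D} f" using assms lipschitz_on_continuous_on by blast
  then have "bounded (f ` {0..D})" by (intro compact_imp_bounded compact_continuous_image) auto
  then show ?thesis by (auto simp: bounded_iff)
qed

theorem theorem1p6:
  fixes I J :: nat and \<beta>\<^sub>1 \<beta>\<^sub>2 A B \<qq> :: real
    and chi psi :: "real \<Rightarrow> real"
    and q \<alpha> :: "real \<Rightarrow> real"
    and M :: "real \<Rightarrow> 'a measure"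
    and V E :: "real \<Rightarrow> nat \<Rightarrow> nat \<Rightarrow> 'a \<Rightarrow> nat"
    and H :: "real \<Rightarrow> real \<Rightarrow> real \<Rightarrow> 'a \<Rightarrow> real"
  assumes "I \<ge> 1" "J \<ge> 1" "\<beta>\<^sub>1 > 0" "\<beta>\<^sub>2 > 0" "\<beta>\<^sub>1 \<noteq> \<beta>\<^sub>2" "A > 0" "B > 0"
    and q: "\<forall>\<^sub>F L in at_top. q L = exp ((\<beta>\<^sub>1 - \<beta>\<^sub>2) / L)"
    and \<alpha>: "\<forall>\<^sub>F L in at_top. (1 + \<alpha> L * q L ^ J) / (1 + \<alpha> L) = exp (- (J * \<beta>\<^sub>2 / L))"
    and model: "\<forall>\<^sub>F L in at_top. shs6v (M L) I J (q L) (\<alpha> L) (V L) (E L)"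
    and H: "\<And>L x y \<omega>. H L x y \<omega> = height_ext (\<lambda>a b. V L a b \<omega>) (\<lambda>a b. E L a b \<omega>) x y"
    and \<qq>: "\<qq> = exp (\<beta>\<^sub>1 - \<beta>\<^sub>2)"
    and chi_mono: "mono_on {0..A} chi \<or> antimono_on {0..A} chi"
    and psi_mono: "mono_on {0..B} psi \<or> antimono_on {0..B} psi"
    and chi_lipschitz: "\<exists>C. C-lipschitz_on {0..A} chi"
    and psi_lipschitz: "\<exists>C. C-lipschitz_on {0..B} psi"
    and chi_limit:
      "tendsto_in_prob M (\<lambda>L \<omega>. SUP x\<in>{0..A}. \<bar>1 / L * H L (L * x) 0 \<omega> - chi x\<bar>) 0 at_top"
    and psi_limit:
      "tendsto_in_prob M (\<lambda>L \<omega>. SUP y\<in>{0..B}. \<bar>1 / L * H L 0 (L * y) \<omega> - psi y\<bar>) 0 at_top"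
  shows "\<exists>h :: real \<Rightarrow> real \<Rightarrow> real.
    telegraph_bvp (I * \<beta>\<^sub>1) (J * \<beta>\<^sub>2) A B
      (\<lambda>x. \<qq> powr chi x) (\<lambda>y. \<qq> powr psi y) (\<lambda>x y. \<qq> powr h x y) \<and>
    (\<forall>u. telegraph_bvp (I * \<beta>\<^sub>1) (J * \<beta>\<^sub>2) A B
           (\<lambda>x. \<qq> powr chi x) (\<lambda>y. \<qq> powr psi y) u \<longrightarrow>
         (\<forall>x\<in>{0..A}. \<forall>y\<in>{0..B}. u x y = \<qq> powr h x y)) \<and>
    tendsto_in_prob M
      (\<lambda>L \<omega>. 1 / L * (SUP (x, y)\<in>{0..A} \<times> {0..B}. \<bar>H L (L * x) (L * y) \<omega> - L * h x y\<bar>))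
      0 at_top"
proof -
  \<comment> \<open>\<open>\<delta>\<close> is the logarithm of \<open>\<qq>\<close>, and
    \<open>- \<rho>\<close> is the limit of \<open>\<alpha>\<close>. Distinct rates give
    \<open>\<delta> \<noteq> 0\<close> and \<open>\<rho> \<noteq> 1\<close>.\<close>
  define \<delta> \<rho> where "\<delta> = \<beta>\<^sub>1 - \<beta>\<^sub>2" and "\<rho> = \<beta>\<^sub>2 / \<beta>\<^sub>1"
  have \<rho>: "\<rho> \<noteq> 0" "\<rho> \<noteq> 1" "\<delta> \<noteq> 0" using assms(3-5) by (auto simp: \<rho>_def \<delta>_def)
  have rates: "\<delta> / (1 - \<rho>) = \<beta>\<^sub>1" "\<delta> * \<rho> / (1 - \<rho>) = \<beta>\<^sub>2"
  proof -
    have "1 - \<rho> = \<delta> / \<beta>\<^sub>1" using \<open>\<beta>\<^sub>1 > 0\<close> by (simp add: \<rho>_def \<delta>_def diff_divide_distrib)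
    then show "\<delta> / (1 - \<rho>) = \<beta>\<^sub>1" "\<delta> * \<rho> / (1 - \<rho>) = \<beta>\<^sub>2"
      using \<rho>(3) \<open>\<beta>\<^sub>1 > 0\<close> by (simp_all add: \<rho>_def)
  qed
  have H_eq: "H = (\<lambda>L x y \<omega>. height_ext (\<lambda>a b. V L a b \<omega>) (\<lambda>a b. E L a b \<omega>) x y)"
    by (intro ext) (rule H)
  interpret W: vertex_weight_scaling q \<alpha> \<delta> \<rho>
  proof
    show "\<forall>\<^sub>F L in at_top. q L = exp (\<delta> / L)" using q by (simp add: \<delta>_def)
    show "(\<alpha> \<longlongrightarrow> - \<rho>) at_top"
      unfolding \<rho>_def by (rule alpha_tendsto[OF q \<alpha>]) (use assms(2-4) in auto)
  qed (use \<rho> in auto)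
  have \<beta>: "W.\<beta>\<^sub>1 = \<beta>\<^sub>1" "W.\<beta>\<^sub>2 = \<beta>\<^sub>2"
    unfolding W.\<beta>\<^sub>1_def W.\<beta>\<^sub>2_def by (rule rates)+
  interpret S: shs6v_scaling q \<alpha> \<delta> \<rho> I J M V E A B chi psi
  proof
    show "\<exists>c. \<forall>x\<in>{0..A}. \<bar>chi x\<bar> \<le> c" using chi_lipschitz by (rule lipschitz_imp_bounded)
    show "\<exists>c. \<forall>y\<in>{0..B}. \<bar>psi y\<bar> \<le> c" using psi_lipschitz by (rule lipschitz_imp_bounded)
  qed (use assms(1-7) model chi_limit psi_limit in \<open>auto simp: \<beta> H_eq\<close>)
  have powr: "\<qq> powr z = exp (\<delta> * z)" for z
    by (simp add: \<qq> powr_def \<delta>_def mult.commute)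
  have \<kappa>: "S.\<kappa>\<^sub>1 = I * \<beta>\<^sub>1" "S.\<kappa>\<^sub>2 = J * \<beta>\<^sub>2"
    by (simp_all add: S.\<kappa>\<^sub>1_def S.\<kappa>\<^sub>2_def \<beta>)
  obtain h where bvp: "telegraph_bvp (I * \<beta>\<^sub>1) (J * \<beta>\<^sub>2) A B
      (\<lambda>x. exp (\<delta> * chi x)) (\<lambda>y. exp (\<delta> * psi y)) (\<lambda>x y. exp (\<delta> * h x y))"
    and h: "\<And>x y. x \<in> {0..A} \<Longrightarrow> y \<in> {0..B} \<Longrightarrow> \<delta> * h x y \<ge> - (\<bar>\<delta>\<bar> * S.R)"
    using S.limit_exists unfolding \<kappa> by blast
  show ?thesis
    unfolding powr
  proof (intro exI[of _ h] conjI allI impI ballI)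
    show "tendsto_in_prob M
      (\<lambda>L \<omega>. 1 / L * (SUP (x, y)\<in>{0..A} \<times> {0..B}. \<bar>H L (L * x) (L * y) \<omega> - L * h x y\<bar>)) 0 at_top"
      unfolding H_eq by (rule S.law_of_large_numbers[OF bvp[folded \<kappa>] h])
    show "u x y = exp (\<delta> * h x y)"
      if "telegraph_bvp (I * \<beta>\<^sub>1) (J * \<beta>\<^sub>2) A B (\<lambda>x. exp (\<delta> * chi x)) (\<lambda>y. exp (\<delta> * psi y)) u"
        and "x \<in> {0..A}" "y \<in> {0..B}" for u x y
      by (rule telegraph_bvp_unique[OF that(1) bvp]) (use assms(1-7) that in auto)
  qed (rule bvp)
qed

end
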